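(* Let $k$ be a field of characteristic $0$, let $R$ be a finite field extension of $k$, let $A=R[\mathcal S,\mathcal D;\sigma,\delta]$ be a differential difference algebra of type $(m,n)$ over $R$, put $l=m+n$, let $I$ be a proper left ideal of $A$, and let $G$ be a finite left Gröbner-Shirshov basis for $I$ with respect to a total degree DD-monomial ordering. Set $p=\max\{\operatorname{tdeg}_{x_i}(\operatorname{lm}(g)): g\in G,\ 1\le i\le l\}$, and let $M=A/I$. Then: (i) There exists a unique polynomial $h\in\mathbb Q[x]$ such that the Hilbert function $\operatorname{HF}_M$ of the left $A$-module $M$ satisfies $\operatorname{HF}_M(t)=h(t)$ for all integers $t\ge lp$. (ii) The Gelfand-Kirillov dimension of $M$ is equal to the degree of $h$, and $$\operatorname{GKdim}(M)=\deg h=\max\{|\operatorname{top}_p(u)| : u\in \operatorname{Irr}(G)\cap\mathcal M_{\le t},\ \operatorname{sh}_p(u)=u\}\quad\text{for any integer } t\ge lp.$$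
   Context: All algebras are unital associative $k$-algebras; $\mathbb N$ includes $0$. A derivation on an algebra $R$ is a $k$-linear map $\delta$ with $\delta(ab)=a\delta(b)+\delta(a)b$. $R\langle a_1,\dots,a_s\rangle$ denotes the subalgebra generated by $R$ and $a_1,\dots,a_s$. Differential difference algebra: an algebra $A$ is a differential difference algebra of type $(m,n)$ ($m,n\in\mathbb N$) over a subalgebra $R\subseteq A$, written $A=R[\mathcal S,\mathcal D;\sigma,\delta]$, if there are elements $S_1,\dots,S_m,D_1,\dots,D_n\in A$ such that: (i) the elements $S_1^{\alpha_1}\cdots S_m^{\alpha_m}D_1^{\beta_1}\cdots D_n^{\beta_n}$ ($\alpha_i,\beta_j\in\mathbb N$) form a basis of $A$ as a free left $R$-module; (ii) $D_ir=rD_i+\delta_i(r)$ for $r\in R$, $1\le i\le n$, with $\delta_i$ a derivation on $R$; (iii) $S_ir=\sigma_i^{-1}(r)S_i$ (equivalently $rS_i=S_i\sigma_i(r)$) for $r\in R$, $1\le i\le m$, where $\sigma_i$ is a $k$-algebra automorphism of $R\langle D_1,\dots,D_n\rangle$ restricting to an automorphism of $R$ and with $\sigma_i(D_j)=\sum_{s=1}^n a_{ijs}D_s$, $a_{ijs}\in R$; (iv) $D_iS_j=S_j\sigma_j(D_i)$; (v) the $S_i$ commute with each other and the $D_j$ commute with each other; (vi) the $\delta_i$ commute with each other and the $\sigma_i$ commute with each other. These elements are fixed. Notation: $x_i=S_i$ ($1\le i\le m$), $x_{m+j}=D_j$ ($1\le j\le n$), $X^\alpha=x_1^{\alpha_1}\cdots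 x_l^{\alpha_l}$ for $\alpha\in\mathbb N^l$; $\mathcal M=\{X^\alpha:\alpha\in\mathbb N^l\}$; $\operatorname{tdeg}(X^\alpha)=|\alpha|=\sum\alpha_i$, $\operatorname{tdeg}_{x_i}(X^\alpha)=\alpha_i$; $\mathcal M_i=\{u\in\mathcal M:\operatorname{tdeg}u=i\}$, $\mathcal M_{\le i}=\{u\in\mathcal M:\operatorname{tdeg}u\le i\}$. A DD-monomial ordering is a (total) well-ordering $>$ on $\mathcal M$ such that $u>v$ implies $\operatorname{lm}(fu)>\operatorname{lm}(fv)$ for all $0\ne f\in A$; it is a total degree ordering if $u>v$ whenever $\operatorname{tdeg}u>\operatorname{tdeg}v$. Here, for $0\neq f\in A$ written as a left $R$-combination of elements of $\mathcal M$, $\operatorname{lm}(f)$ is the largest element of $\mathcal M$ occurring with nonzero coefficient. An element $f\in A$ is right divisible by $g$ if $f=hg$ for some $h\in A$. A set $G\subseteq I$ (of nonzero elements) is a left Gröbner-Shirshov basis of $I$ if for every $0\neq f\in I$ there is $g\in G$ with $\operatorname{lm}(f)$ right divisible by $\operatorname{lm}(g)$. $\operatorname{Irr}(G)=\{w\in\mathcal M: w\ne f\operatorname{lm}(g)\text{ for all }g\in G,f\in A\}$. For $u=X^\alpha$ and $p\in\mathbb N$: $\operatorname{top}_p(u)=\{i:1\le i\le l,\ \alpha_i\ge p\}$; $\operatorname{sh}_p(u)=X^\beta$ with $\beta_i=\min\{p,\alpha_i\}$. Let $A_i$ be the $R$-subspace of $A$ spanned by $\mathcal M_i$, and $M_i=(A_i+I)/I$.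 The Hilbert function of $M=A/I$ is $\operatorname{HF}_M(i)=\dim_k(M_0+\cdots+M_i)$, $i\in\mathbb N$. The Gelfand-Kirillov dimension of a left $A$-module $M$ is $\operatorname{GKdim}(M)=\sup_{V,F}\limsup_{n\to\infty}\log_n\dim_k(V^nF)$, the supremum over all finite-dimensional subspaces $V\subseteq A$ containing $1$ and finite-dimensional subspaces $F\subseteq M$. Convention: if $G=\emptyset$ (which can occur only for $I=0$), then $p=0$; likewise $p=0$ if $l=0$. *)

theory Defs
  imports
    "HOL-Library.Extended_Real"
    "HOL-Library.Liminf_Limsup"
    "HOL-Library.Set_Algebras"
    "HOL-Computational_Algebra.Polynomial"
    "Jordan_Normal_Form.VS_Connect"
begin

text \<open>
  Indices are shifted to start from 0: the \<open>i\<close>-th of \<open>N\<close> objects has index \<open>i < N\<close>.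
  Linear algebra inside an algebra (a type with a scalar multiplication \<open>scale\<close>) uses the library's
  \<open>vector_space\<close>.  Modules with an explicit carrier are HOL-Algebra \<open>module\<close> records.
\<close>

section \<open>Algebras over a field, subalgebras, derivations, automorphisms\<close>

locale k_algebra = vector_space scale
  for scale :: "'k::field \<Rightarrow> 'a::ring_1 \<Rightarrow> 'a" +
  assumes scale_mult_left: "scale c a * b = scale c (a * b)"
    and scale_mult_right: "a * scale c b = scale c (a * b)"

definition fin_dim_subspace :: "('k::field \<Rightarrow> 'a::ring_1 \<Rightarrow> 'a) \<Rightarrow> 'a set \<Rightarrow> bool" where
  "fin_dim_subspace scale V \<longleftrightarrow> (\<exists>B. finite B \<and> V = Modules.module.span scale B)"

definition subalgebra :: "('k::field \<Rightarrow> 'a::ring_1 \<Rightarrow> 'a) \<Rightarrow> 'a set \<Rightarrow> bool" where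
  "subalgebra scale B \<longleftrightarrow>
     Modules.module.subspace scale B \<and> 1 \<in> B \<and> (\<forall>a\<in>B. \<forall>b\<in>B. a * b \<in> B)"

definition subalgebra_generated :: "('k::field \<Rightarrow> 'a::ring_1 \<Rightarrow> 'a) \<Rightarrow> 'a set \<Rightarrow> 'a set" where
  "subalgebra_generated scale H = \<Inter>{B. subalgebra scale B \<and> H \<subseteq> B}"

definition finite_field_extension :: "('k::field \<Rightarrow> 'a::ring_1 \<Rightarrow> 'a) \<Rightarrow> 'a set \<Rightarrow> bool" where
  "finite_field_extension scale R \<longleftrightarrow>
     subalgebra scale R \<and>
     (\<forall>a\<in>R. \<forall>b\<in>R. a * b = b * a) \<and>
     (\<forall>a\<in>R. a \<noteq> 0 \<longrightarrow> (\<exists>b\<in>R. a * b = 1)) \<and>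
     fin_dim_subspace scale R"

definition derivation_on :: "('k::field \<Rightarrow> 'a::ring_1 \<Rightarrow> 'a) \<Rightarrow> 'a set \<Rightarrow> ('a \<Rightarrow> 'a) \<Rightarrow> bool" where
  "derivation_on scale R d \<longleftrightarrow>
     d \<in> R \<rightarrow> R \<and>
     (\<forall>a\<in>R. \<forall>b\<in>R. d (a + b) = d a + d b) \<and>
     (\<forall>c. \<forall>a\<in>R. d (scale c a) = scale c (d a)) \<and>
     (\<forall>a\<in>R. \<forall>b\<in>R. d (a * b) = a * d b + d a * b)"

definition algebra_automorphism_on ::
    "('k::field \<Rightarrow> 'a::ring_1 \<Rightarrow> 'a) \<Rightarrow> 'a set \<Rightarrow> ('a \<Rightarrow> 'a) \<Rightarrow> bool" where
  "algebra_automorphism_on scale B s \<longleftrightarrow>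
     bij_betw s B B \<and> s 1 = 1 \<and>
     (\<forall>a\<in>B. \<forall>b\<in>B. s (a + b) = s a + s b) \<and>
     (\<forall>c. \<forall>a\<in>B. s (scale c a) = scale c (s a)) \<and>
     (\<forall>a\<in>B. \<forall>b\<in>B. s (a * b) = s a * s b)"

section \<open>Monomials and left bases\<close>

definition exponents :: "nat \<Rightarrow> (nat \<Rightarrow> nat) set" where
  "exponents l = {\<alpha>. \<forall>i\<ge>l. \<alpha> i = 0}"

text \<open>\<open>x 0 ^ \<alpha> 0 * \<dots> * x (l - 1) ^ \<alpha> (l - 1)\<close>, in this order.\<close>

definition mono_at :: "nat \<Rightarrow> (nat \<Rightarrow> 'a::ring_1) \<Rightarrow> (nat \<Rightarrow> nat) \<Rightarrow> 'a" where
  "mono_at l x \<alpha> = prod_list (map (\<lambda>i. x i ^ \<alpha> i) [0..<l])"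

definition monomials :: "nat \<Rightarrow> (nat \<Rightarrow> 'a::ring_1) \<Rightarrow> 'a set" where
  "monomials l x = mono_at l x ` exponents l"

definition is_left_expansion ::
    "'a set \<Rightarrow> nat \<Rightarrow> (nat \<Rightarrow> 'a::ring_1) \<Rightarrow> 'a \<Rightarrow> ((nat \<Rightarrow> nat) \<Rightarrow> 'a) \<Rightarrow> bool" where
  "is_left_expansion R l x f c \<longleftrightarrow>
     finite {\<alpha>. c \<alpha> \<noteq> 0} \<and> {\<alpha>. c \<alpha> \<noteq> 0} \<subseteq> exponents l \<and> range c \<subseteq> R \<and>
     f = (\<Sum>\<alpha> | c \<alpha> \<noteq> 0. c \<alpha> * mono_at l x \<alpha>)"

definition monos_left_basis :: "'a set \<Rightarrow> nat \<Rightarrow> (nat \<Rightarrow> 'a::ring_1) \<Rightarrow> bool" where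
  "monos_left_basis R l x \<longleftrightarrow> (\<forall>f. \<exists>!c. is_left_expansion R l x f c)"

section \<open>Differential difference algebras\<close>

definition dd_gens :: "nat \<Rightarrow> (nat \<Rightarrow> 'a) \<Rightarrow> (nat \<Rightarrow> 'a) \<Rightarrow> nat \<Rightarrow> 'a" where
  "dd_gens m S D i = (if i < m then S i else D (i - m))"

locale dd_algebra = k_algebra scale
  for scale :: "'k::field \<Rightarrow> 'a::ring_1 \<Rightarrow> 'a"
    and R :: "'a set"
    and m n :: nat
    and S D :: "nat \<Rightarrow> 'a"
    and \<sigma> \<delta> :: "nat \<Rightarrow> 'a \<Rightarrow> 'a" +
  assumes subalgebra_R: "subalgebra scale R"
    and basis: "monos_left_basis R (m + n) (dd_gens m S D)"
    and derivation: "i < n \<Longrightarrow> derivation_on scale R (\<delta> i)"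
    and D_coeff: "i < n \<Longrightarrow> r \<in> R \<Longrightarrow> D i * r = r * D i + \<delta> i r"
    and automorphism:
      "i < m \<Longrightarrow> algebra_automorphism_on scale (subalgebra_generated scale (R \<union> D ` {..<n})) (\<sigma> i)"
    and automorphism_R: "i < m \<Longrightarrow> algebra_automorphism_on scale R (\<sigma> i)"
    and automorphism_D:
      "i < m \<Longrightarrow> j < n \<Longrightarrow> \<exists>a. (\<forall>s<n. a s \<in> R) \<and> \<sigma> i (D j) = (\<Sum>s<n. a s * D s)"
    and S_coeff: "i < m \<Longrightarrow> r \<in> R \<Longrightarrow> r * S i = S i * \<sigma> i r"
    and D_S: "i < n \<Longrightarrow> j < m \<Longrightarrow> D i * S j = S j * \<sigma> j (D i)"
    and S_commute: "i < m \<Longrightarrow> j < m \<Longrightarrow> S i * S j = S j * S i"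
    and D_commute: "i < n \<Longrightarrow> j < n \<Longrightarrow> D i * D j = D j * D i"
    and derivations_commute: "i < n \<Longrightarrow> j < n \<Longrightarrow> r \<in> R \<Longrightarrow> \<delta> i (\<delta> j r) = \<delta> j (\<delta> i r)"
    and automorphisms_commute:
      "i < m \<Longrightarrow> j < m \<Longrightarrow> b \<in> subalgebra_generated scale (R \<union> D ` {..<n}) \<Longrightarrow>
         \<sigma> i (\<sigma> j b) = \<sigma> j (\<sigma> i b)"

section \<open>Degrees, leading monomials, Groebner-Shirshov bases\<close>

text \<open>
  Monomials are elements of the algebra; under \<^const>\<open>monos_left_basis\<close> each of them has exactly one
  exponent vector.
\<close>

definition exponent_of :: "nat \<Rightarrow> (nat \<Rightarrow> 'a::ring_1) \<Rightarrow> 'a \<Rightarrow> nat \<Rightarrow> nat" where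
  "exponent_of l x u = inv_into (exponents l) (mono_at l x) u"

definition tdeg :: "nat \<Rightarrow> (nat \<Rightarrow> 'a::ring_1) \<Rightarrow> 'a \<Rightarrow> nat" where
  "tdeg l x u = (\<Sum>i<l. exponent_of l x u i)"

definition monos_eq :: "nat \<Rightarrow> (nat \<Rightarrow> 'a::ring_1) \<Rightarrow> nat \<Rightarrow> 'a set" where
  "monos_eq l x d = {u \<in> monomials l x. tdeg l x u = d}"

definition monos_le :: "nat \<Rightarrow> (nat \<Rightarrow> 'a::ring_1) \<Rightarrow> nat \<Rightarrow> 'a set" where
  "monos_le l x d = {u \<in> monomials l x. tdeg l x u \<le> d}"

definition mono_support :: "'a set \<Rightarrow> nat \<Rightarrow> (nat \<Rightarrow> 'a::ring_1) \<Rightarrow> 'a \<Rightarrow> 'a set" where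
  "mono_support R l x f =
     mono_at l x ` {\<alpha>. (THE c. is_left_expansion R l x f c) \<alpha> \<noteq> 0}"

text \<open>
  An ordering is given by its reflexive relation: \<open>(v, u) \<in> ord\<close> means \<open>v \<le> u\<close>.
\<close>

definition lm :: "'a set \<Rightarrow> nat \<Rightarrow> (nat \<Rightarrow> 'a::ring_1) \<Rightarrow> 'a rel \<Rightarrow> 'a \<Rightarrow> 'a" where
  "lm R l x ord f =
     (THE u. u \<in> mono_support R l x f \<and> (\<forall>v\<in>mono_support R l x f. (v, u) \<in> ord))"

definition dd_monomial_ordering :: "'a set \<Rightarrow> nat \<Rightarrow> (nat \<Rightarrow> 'a::ring_1) \<Rightarrow> 'a rel \<Rightarrow> bool" where
  "dd_monomial_ordering R l x ord \<longleftrightarrow>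
     well_order_on (monomials l x) ord \<and>
     (\<forall>u\<in>monomials l x. \<forall>v\<in>monomials l x. (v, u) \<in> ord - Id \<longrightarrow>
        (\<forall>f. f \<noteq> 0 \<longrightarrow> (lm R l x ord (f * v), lm R l x ord (f * u)) \<in> ord - Id))"

definition total_degree_ordering :: "nat \<Rightarrow> (nat \<Rightarrow> 'a::ring_1) \<Rightarrow> 'a rel \<Rightarrow> bool" where
  "total_degree_ordering l x ord \<longleftrightarrow>
     (\<forall>u\<in>monomials l x. \<forall>v\<in>monomials l x. tdeg l x u > tdeg l x v \<longrightarrow> (v, u) \<in> ord - Id)"

definition right_divisible :: "'a::ring_1 \<Rightarrow> 'a \<Rightarrow> bool" where
  "right_divisible f g \<longleftrightarrow> (\<exists>h. f = h * g)"

definition left_ideal :: "'a::ring_1 set \<Rightarrow> bool" where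
  "left_ideal I \<longleftrightarrow>
     0 \<in> I \<and> (\<forall>a\<in>I. \<forall>b\<in>I. a + b \<in> I) \<and> (\<forall>a. \<forall>b\<in>I. a * b \<in> I)"

definition left_GS_basis ::
    "'a set \<Rightarrow> nat \<Rightarrow> (nat \<Rightarrow> 'a::ring_1) \<Rightarrow> 'a rel \<Rightarrow> 'a set \<Rightarrow> 'a set \<Rightarrow> bool" where
  "left_GS_basis R l x ord I G \<longleftrightarrow>
     G \<subseteq> I - {0} \<and>
     (\<forall>f\<in>I. f \<noteq> 0 \<longrightarrow> (\<exists>g\<in>G. right_divisible (lm R l x ord f) (lm R l x ord g)))"

definition Irr :: "'a set \<Rightarrow> nat \<Rightarrow> (nat \<Rightarrow> 'a::ring_1) \<Rightarrow> 'a rel \<Rightarrow> 'a set \<Rightarrow> 'a set" where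
  "Irr R l x ord G = {w \<in> monomials l x. \<forall>g\<in>G. \<forall>f. w \<noteq> f * lm R l x ord g}"

definition max_lm_exponent ::
    "'a set \<Rightarrow> nat \<Rightarrow> (nat \<Rightarrow> 'a::ring_1) \<Rightarrow> 'a rel \<Rightarrow> 'a set \<Rightarrow> nat" where
  "max_lm_exponent R l x ord G =
     (if G = {} \<or> l = 0 then 0
      else Max {exponent_of l x (lm R l x ord g) i | g i. g \<in> G \<and> i < l})"

definition top_at :: "nat \<Rightarrow> (nat \<Rightarrow> 'a::ring_1) \<Rightarrow> nat \<Rightarrow> 'a \<Rightarrow> nat set" where
  "top_at l x p u = {i. i < l \<and> exponent_of l x u i \<ge> p}"

definition sh_at :: "nat \<Rightarrow> (nat \<Rightarrow> 'a::ring_1) \<Rightarrow> nat \<Rightarrow> 'a \<Rightarrow> 'a" where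
  "sh_at l x p u = mono_at l x (\<lambda>i. min p (exponent_of l x u i))"

section \<open>Left modules, quotients by left ideals\<close>

text \<open>
  A left module over (the type of) an algebra is a \<open>module\<close> record with scalars in that algebra.
  The record fields \<^const>\<open>mult\<close> and \<^const>\<open>one\<close> play no role for modules.
\<close>

definition quotient_module :: "'a::ring_1 set \<Rightarrow> ('a, 'a set) module" where
  "quotient_module I =
     \<lparr>carrier = range (\<lambda>a. a +o I), mult = undefined, one = undefined,
      zero = I, add = (+), smult = (\<lambda>a X. \<Union>b\<in>X. (a * b) +o I)\<rparr>"

text \<open>The underlying \<open>k\<close>-vector space of a left module.\<close>

definition k_module ::
    "('k::field \<Rightarrow> 'a::ring_1 \<Rightarrow> 'a) \<Rightarrow> ('a, 'm) module \<Rightarrow> ('k, 'm) module" where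
  "k_module scale M =
     \<lparr>carrier = carrier M, mult = mult M, one = one M, zero = zero M, add = add M,
      smult = (\<lambda>c v. smult M (scale c 1) v)\<rparr>"

definition k_span ::
    "('k::field \<Rightarrow> 'a::ring_1 \<Rightarrow> 'a) \<Rightarrow> ('a, 'm) module \<Rightarrow> 'm set \<Rightarrow> 'm set" where
  "k_span scale M T = LinearCombinations.module.span class_ring (k_module scale M) T"

text \<open>The dimension of a finite-dimensional \<open>k\<close>-subspace \<open>W\<close> of \<open>M\<close>.\<close>

definition k_dim ::
    "('k::field \<Rightarrow> 'a::ring_1 \<Rightarrow> 'a) \<Rightarrow> ('a, 'm) module \<Rightarrow> 'm set \<Rightarrow> nat" where
  "k_dim scale M W = vectorspace.dim class_ring ((k_module scale M)\<lparr>carrier := W\<rparr>)"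

section \<open>Hilbert function\<close>

definition left_span :: "'a set \<Rightarrow> 'a::ring_1 set \<Rightarrow> 'a set" where
  "left_span R T = {\<Sum>u\<in>U. c u * u | U c. finite U \<and> U \<subseteq> T \<and> c \<in> U \<rightarrow> R}"

definition hom_component :: "'a set \<Rightarrow> nat \<Rightarrow> (nat \<Rightarrow> 'a::ring_1) \<Rightarrow> 'a set \<Rightarrow> nat \<Rightarrow> 'a set set" where
  "hom_component R l x I i = (\<lambda>a. a +o I) ` left_span R (monos_eq l x i)"

definition sum_components :: "('a, 'm) module \<Rightarrow> (nat \<Rightarrow> 'm set) \<Rightarrow> nat \<Rightarrow> 'm set" where
  "sum_components M N i = {finsum M w {..i} | w. w \<in> (\<Pi> j\<in>{..i}. N j)}"

definition hilbert_function ::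
    "('k::field \<Rightarrow> 'a::ring_1 \<Rightarrow> 'a) \<Rightarrow> 'a set \<Rightarrow> nat \<Rightarrow> (nat \<Rightarrow> 'a) \<Rightarrow> 'a set \<Rightarrow> nat \<Rightarrow> nat" where
  "hilbert_function scale R l x I i =
     k_dim scale (quotient_module I)
       (sum_components (quotient_module I) (hom_component R l x I) i)"

section \<open>Gelfand-Kirillov dimension\<close>

definition power_space :: "('k::field \<Rightarrow> 'a::ring_1 \<Rightarrow> 'a) \<Rightarrow> 'a set \<Rightarrow> nat \<Rightarrow> 'a set" where
  "power_space scale V n =
     Modules.module.span scale {prod_list vs | vs. length vs = n \<and> set vs \<subseteq> V}"

definition act_space ::
    "('k::field \<Rightarrow> 'a::ring_1 \<Rightarrow> 'a) \<Rightarrow> ('a, 'm) module \<Rightarrow> 'a set \<Rightarrow> 'm set \<Rightarrow> 'm set" where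
  "act_space scale M U F = k_span scale M {smult M u f | u f. u \<in> U \<and> f \<in> F}"

text \<open>Logarithm with the convention that the logarithm of 0 is minus infinity (for \<open>F = 0\<close>).\<close>

definition log_nat :: "nat \<Rightarrow> nat \<Rightarrow> ereal" where
  "log_nat b d = (if d = 0 then -\<infinity> else ereal (log (real b) (real d)))"

definition GKdim :: "('k::field \<Rightarrow> 'a::ring_1 \<Rightarrow> 'a) \<Rightarrow> ('a, 'm) module \<Rightarrow> ereal" where
  "GKdim scale M =
     (SUP (V, F) \<in> {(V, F). fin_dim_subspace scale V \<and> 1 \<in> V \<and>
                          (\<exists>B. finite B \<and> B \<subseteq> carrier M \<and> F = k_span scale M B)}.
        limsup (\<lambda>n. log_nat n (k_dim scale M (act_space scale M (power_space scale V n) F))))"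

end

theory Submission
  imports Defs
begin

text \<open>
  The theorem is reduced to counting exponent vectors.  Write \<open>X\<^sup>\<alpha>\<close> for the monomial with exponent
  \<open>\<alpha>\<close>, and compare exponents coordinatewise.

  \<^bold>\<open>Divisibility.\<close>  Since \<open>D\<^sub>i S\<^sub>j\<close> is \<open>S\<^sub>j\<close> times a linear form in the \<open>D\<^sub>s\<close>, multiplying \<open>X\<^sup>\<gamma>\<close> on the left by
  a generator gives a combination of monomials \<open>X\<^bsup>\<gamma> + e\<^sub>s\<^esup>\<close> (\<open>x_mono\<close>).  Hence total degree filters the
  algebra (\<open>mult_below\<close>), and the monomials with exponent above \<open>\<beta>\<close> span a left ideal
  (\<open>mult_above\<close>), so that \<open>X\<^sup>\<beta>\<close> can divide \<open>X\<^sup>\<alpha>\<close> on the right only if \<open>\<beta> \<le> \<alpha>\<close>.  Conversely, if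
  \<open>\<beta> \<le> \<alpha>\<close>, then \<open>X\<^sup>\<alpha> = h X\<^sup>\<beta>\<close> for some \<open>h\<close> whose degree is the difference of the degrees
  (\<open>mono_left_factor\<close>): each \<open>\<sigma>\<^sub>j\<close> permutes the finite-dimensional space of elements of \<open>R\<langle>D\<rangle>\<close> of bounded
  degree, so the missing powers of the \<open>D\<^sub>s\<close> can be moved to the left across the \<open>S\<^sub>j\<close> without raising
  their degree.  Therefore \<open>Irr G\<close> consists of the \<open>X\<^sup>\<alpha>\<close> with \<open>\<alpha>\<close> above none of the exponents of the
  leading monomials of \<open>G\<close>, as for commutative polynomials.

  \<^bold>\<open>Hilbert function.\<close>  If \<open>\<beta> \<le> \<alpha>\<close> and \<open>X\<^sup>\<beta>\<close> is the leading monomial of \<open>g\<close>, then \<open>X\<^sup>\<alpha>\<close> is the leading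
  monomial of a multiple of \<open>g\<close> (\<open>reducible_lead\<close>).  Because the ordering refines the degree, the
  irreducible monomials of degree at most \<open>t\<close> are a left \<open>R\<close>-basis, modulo the ideal, of the elements of
  degree at most \<open>t\<close> (\<open>normal_form\<close>, \<open>normal_independent\<close>).  So the value of the Hilbert function
  at \<open>t\<close> is the degree of \<open>R\<close> over \<open>k\<close> times the number of these monomials (\<open>k_dim_below\<close>).

  \<^bold>\<open>Counting.\<close>  No leading exponent has an entry larger than \<open>p\<close>, so \<open>X\<^sup>\<alpha>\<close> is irreducible if and only if
  the monomial with exponent \<open>\<beta> = min p \<alpha>\<close> is.  For a fixed \<open>\<beta>\<close> with \<open>e\<close> of its \<open>l\<close> entries equal to \<open>p\<close>, the
  number of such \<open>\<alpha>\<close> of degree at most \<open>t\<close> is the binomial coefficient of \<open>t - |\<beta>| + e\<close> over \<open>e\<close>: a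
  polynomial in \<open>t\<close> of degree \<open>e\<close> with positive leading coefficient, valid for \<open>t \<ge> |\<beta>|\<close> and hence for
  \<open>t \<ge> l * p\<close>.  The degrees of these polynomials cannot cancel in the sum, so the degree of the sum
  is the largest \<open>e\<close> (\<open>staircase_hilbert_polynomial\<close>).

  \<^bold>\<open>Gelfand-Kirillov dimension.\<close>  The spaces \<open>V\<^sup>k F\<close> lie in the images of the elements of degree at most
  \<open>s * k + q\<close> for suitable \<open>s\<close> and \<open>q\<close>, and for \<open>V\<close> the elements of degree at most 1 and \<open>F\<close> spanned by
  the coset of 1 they are the images of the elements of degree at most \<open>k\<close>.  The logarithms to the
  base \<open>k\<close> of the dimensions of these images tend to the degree of the Hilbert polynomial
  (\<open>GKdim_eq\<close>, \<open>log_nat_poly_affine_tendsto\<close>).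
\<close>

section \<open>Counting exponent vectors outside a union of orthants\<close>

text \<open>
  Splitting off the value \<open>k\<close> at one point of \<open>T\<close> leaves a function with sum at most \<open>s - k\<close> on
  the rest, so the induction is the hockey-stick identity for binomial coefficients.
\<close>

lemma card_bounded_sum:
  fixes T :: "'b set"
  assumes "finite T"
  shows "finite {\<gamma>::'b \<Rightarrow> nat. (\<forall>i. i \<notin> T \<longrightarrow> \<gamma> i = 0) \<and> sum \<gamma> T \<le> s} \<and>
    card {\<gamma>::'b \<Rightarrow> nat. (\<forall>i. i \<notin> T \<longrightarrow> \<gamma> i = 0) \<and> sum \<gamma> T \<le> s} = (s + card T) choose card T"
  using assms
proof (induction T arbitrary: s rule: finite_induct)
  case empty
  have "{\<gamma>::'b \<Rightarrow> nat. (\<forall>i. i \<notin> {} \<longrightarrow> \<gamma> i = 0) \<and> sum \<gamma> {} \<le> s} = {\<lambda>_. 0}"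
    by auto
  then show ?case by simp
next
  case (insert a T)
  define X where "X T s = {\<gamma>::'b \<Rightarrow> nat. (\<forall>i. i \<notin> T \<longrightarrow> \<gamma> i = 0) \<and> sum \<gamma> T \<le> s}" for T s
  let ?f = "\<lambda>(k, \<gamma>). \<gamma>(a := k)"
  have sum_upd: "sum (\<gamma>(a := k)) T = sum \<gamma> T" for \<gamma> :: "'b \<Rightarrow> nat" and k
    using insert.hyps by (intro sum.cong) auto
  have bij: "bij_betw ?f (SIGMA k:{..s}. X T (s - k)) (X (insert a T) s)"
  proof (intro bij_betwI[where g = "\<lambda>\<gamma>. (\<gamma> a, \<gamma>(a := 0))"])
    show "?f \<in> (SIGMA k:{..s}. X T (s - k)) \<rightarrow> X (insert a T) s"
      using insert.hyps by (auto simp: X_def sum_upd simp del: fun_upd_apply) auto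
    show "(\<lambda>\<gamma>. (\<gamma> a, \<gamma>(a := 0))) \<in> X (insert a T) s \<rightarrow> (SIGMA k:{..s}. X T (s - k))"
      using insert.hyps by (auto simp: X_def sum_upd simp del: fun_upd_apply) auto
    show "(\<lambda>\<gamma>. (\<gamma> a, \<gamma>(a := 0))) (?f z) = z" if "z \<in> (SIGMA k:{..s}. X T (s - k))" for z
      using that insert.hyps by (auto simp: X_def fun_eq_iff)
    show "?f ((\<lambda>\<gamma>. (\<gamma> a, \<gamma>(a := 0))) \<gamma>) = \<gamma>" for \<gamma>
      by auto
  qed
  have IH: "finite (X T s)" "card (X T s) = (s + card T) choose card T" for s
    using insert.IH[of s] by (auto simp: X_def)
  have "card (X (insert a T) s) = (\<Sum>k\<le>s. card (X T (s - k)))"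
    using bij_betw_same_card[OF bij] IH by simp
  also have "\<dots> = (\<Sum>k\<le>s. (card T + (s - k)) choose card T)"
    by (simp add: IH add.commute)
  also have "\<dots> = (\<Sum>k\<le>s. (card T + k) choose card T)"
    by (rule sum.reindex_bij_witness[where i = "\<lambda>k. s - k" and j = "\<lambda>k. s - k"]) auto
  also have "\<dots> = (s + card (insert a T)) choose card (insert a T)"
    using choose_rising_sum(1)[of "card T" s] insert.hyps by (simp add: add_ac)
  finally show ?case
    using bij_betw_finite[OF bij] IH unfolding X_def by auto
qed

text \<open>
  Clipping at \<open>p\<close> is the operation \<open>sh\<^sub>p\<close> of the theorem on exponent vectors, and \<open>full_at\<close> below
  is its \<open>top\<^sub>p\<close>.
\<close>

definition clip :: "nat \<Rightarrow> (nat \<Rightarrow> nat) \<Rightarrow> nat \<Rightarrow> nat" where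
  "clip p \<alpha> = (\<lambda>i. min p (\<alpha> i))"

definition tot_deg :: "nat \<Rightarrow> (nat \<Rightarrow> nat) \<Rightarrow> nat" where
  "tot_deg l \<alpha> = (\<Sum>i<l. \<alpha> i)"

definition full_at :: "nat \<Rightarrow> nat \<Rightarrow> (nat \<Rightarrow> nat) \<Rightarrow> nat set" where
  "full_at l p \<beta> = {i. i < l \<and> p \<le> \<beta> i}"

lemma finite_full_at [simp]: "finite (full_at l p \<beta>)"
  by (simp add: full_at_def)

lemma finite_exponents_total: "finite {\<alpha> \<in> exponents l. tot_deg l \<alpha> \<le> t}"
proof -
  have "{\<alpha> \<in> exponents l. tot_deg l \<alpha> \<le> t} = {\<gamma>. (\<forall>i. i \<notin> {..<l} \<longrightarrow> \<gamma> i = 0) \<and> sum \<gamma> {..<l} \<le> t}"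
    by (auto simp: exponents_def tot_deg_def)
  then show ?thesis using card_bounded_sum[of "{..<l}" t] by simp
qed

text \<open>
  A vector that clips to \<open>\<beta>\<close> agrees with \<open>\<beta>\<close> wherever \<open>\<beta>\<close> is below \<open>p\<close>, and exceeds it by an
  arbitrary amount at the other coordinates; only the total excess is bounded.
\<close>

lemma card_clip_fibre:
  assumes \<beta>: "\<beta> \<in> exponents l" "clip p \<beta> = \<beta>" and t: "tot_deg l \<beta> \<le> t"
  shows "card {\<alpha> \<in> exponents l. clip p \<alpha> = \<beta> \<and> tot_deg l \<alpha> \<le> t} =
    (t - tot_deg l \<beta> + card (full_at l p \<beta>)) choose card (full_at l p \<beta>)"
proof -
  let ?T = "full_at l p \<beta>"
  let ?X = "{\<gamma>::nat \<Rightarrow> nat. (\<forall>i. i \<notin> ?T \<longrightarrow> \<gamma> i = 0) \<and> sum \<gamma> ?T \<le> t - tot_deg l \<beta>}"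
  have le_p: "\<beta> i \<le> p" for i
    using \<beta>(2) by (metis clip_def min.cobounded1)
  have sumT: "sum \<gamma> ?T = tot_deg l \<gamma>" if "\<forall>i. i \<notin> ?T \<longrightarrow> \<gamma> i = 0" for \<gamma>
    unfolding tot_deg_def using that by (intro sum.mono_neutral_left) (auto simp: full_at_def)
  have "bij_betw (\<lambda>\<gamma> i. \<beta> i + \<gamma> i) ?X {\<alpha> \<in> exponents l. clip p \<alpha> = \<beta> \<and> tot_deg l \<alpha> \<le> t}"
  proof (intro bij_betwI[where g = "\<lambda>\<alpha> i. \<alpha> i - \<beta> i"] funcsetI)
    fix \<gamma> assume \<gamma>: "\<gamma> \<in> ?X"
    then have z: "\<forall>i. i \<notin> ?T \<longrightarrow> \<gamma> i = 0" and s: "tot_deg l \<gamma> \<le> t - tot_deg l \<beta>"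
      using sumT[of \<gamma>] by auto
    have "(\<lambda>i. \<beta> i + \<gamma> i) \<in> exponents l"
      using \<beta>(1) z by (auto simp: exponents_def full_at_def)
    moreover have "clip p (\<lambda>i. \<beta> i + \<gamma> i) = \<beta>"
    proof
      fix i show "clip p (\<lambda>i. \<beta> i + \<gamma> i) i = \<beta> i"
        using le_p[of i] z by (cases "i \<in> ?T") (auto simp: clip_def full_at_def)
    qed
    moreover have "tot_deg l (\<lambda>i. \<beta> i + \<gamma> i) \<le> t"
      using s t by (simp add: tot_deg_def sum.distrib)
    ultimately show "(\<lambda>i. \<beta> i + \<gamma> i) \<in> {\<alpha> \<in> exponents l. clip p \<alpha> = \<beta> \<and> tot_deg l \<alpha> \<le> t}"
      by simp
  next
    fix \<alpha> assume "\<alpha> \<in> {\<alpha> \<in> exponents l. clip p \<alpha> = \<beta> \<and> tot_deg l \<alpha> \<le> t}"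
    then have a: "\<alpha> \<in> exponents l" "clip p \<alpha> = \<beta>" "tot_deg l \<alpha> \<le> t" by auto
    have z: "\<forall>i. i \<notin> ?T \<longrightarrow> \<alpha> i - \<beta> i = 0"
      using a(1,2) by (auto simp: clip_def full_at_def exponents_def fun_eq_iff min_def)
        (metis le_eq_less_or_eq not_le)
    have le: "\<beta> i \<le> \<alpha> i" for i using a(2) by (auto simp: clip_def)
    have "tot_deg l (\<lambda>i. \<alpha> i - \<beta> i) = tot_deg l \<alpha> - tot_deg l \<beta>"
      unfolding tot_deg_def by (rule sum_subtractf_nat) (use le in auto)
    then have "sum (\<lambda>i. \<alpha> i - \<beta> i) ?T \<le> t - tot_deg l \<beta>"
      using sumT[OF z] a(3) by simp
    then show "(\<lambda>i. \<alpha> i - \<beta> i) \<in> ?X"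
      using z by simp
    show "(\<lambda>i. \<beta> i + (\<alpha> i - \<beta> i)) = \<alpha>"
      using le by auto
  qed auto
  from bij_betw_same_card[OF this] show ?thesis
    using card_bounded_sum[of ?T "t - tot_deg l \<beta>"] by simp
qed

definition binomial_poly :: "nat \<Rightarrow> nat \<Rightarrow> rat poly" where
  "binomial_poly b e = Polynomial.smult (1 / fact e) (\<Prod>j<e. [:of_nat (Suc j) - of_nat b, 1:])"

text \<open>
  The condition \<open>b \<le> t\<close> is where the bound \<open>t \<ge> l * p\<close> of the theorem comes from: below it the
  truncated difference \<open>t - b\<close> is no longer a polynomial in \<open>t\<close>.
\<close>

lemma poly_binomial_poly:
  assumes "b \<le> t"
  shows "poly (binomial_poly b e) (of_nat t) = of_nat ((t - b + e) choose e)"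
proof -
  have "of_nat ((t - b + e) choose e) * fact e = (\<Prod>j<e. of_nat (t - b) + of_nat (Suc j) :: rat)"
  proof (induction e)
    case (Suc e)
    have "Suc e * ((t - b + Suc e) choose Suc e) = (t - b + Suc e) * ((t - b + e) choose e)"
      using Suc_times_binomial_eq[of "t - b + e" e] by simp
    then have "of_nat (Suc e) * of_nat ((t - b + Suc e) choose Suc e) =
        (of_nat (t - b + Suc e) * of_nat ((t - b + e) choose e) :: rat)"
      by (simp only: of_nat_mult[symmetric])
    then have "of_nat (Suc e) * of_nat ((t - b + Suc e) choose Suc e) * fact e =
        (of_nat (t - b + Suc e) * of_nat ((t - b + e) choose e) * fact e :: rat)"
      by (rule arg_cong[where f = "\<lambda>z. z * fact e"])
    then have "of_nat ((t - b + Suc e) choose Suc e) * fact (Suc e) =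
        (of_nat (t - b + Suc e) * (of_nat ((t - b + e) choose e) * fact e) :: rat)"
      by (simp only: fact_Suc of_nat_mult mult_ac)
    also have "\<dots> = of_nat (t - b + Suc e) * (\<Prod>j<e. of_nat (t - b) + of_nat (Suc j))"
      by (rule arg_cong[OF Suc])
    also have "\<dots> = (\<Prod>j<Suc e. of_nat (t - b) + of_nat (Suc j))"
      unfolding prod.lessThan_Suc of_nat_add by (rule mult.commute)
    finally show ?case .
  qed simp
  then show ?thesis
    using assms by (simp add: binomial_poly_def poly_prod of_nat_diff field_simps)
qed

lemma binomial_poly_lead:
  "degree (binomial_poly b e) = e" "lead_coeff (binomial_poly b e) > 0"
proof -
  have "degree (\<Prod>j<e. [:of_nat (Suc j) - of_nat b, 1:] :: rat poly) = e"
    by (subst degree_prod_eq_sum_degree) auto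
  then show *: "degree (binomial_poly b e) = e"
    by (simp add: binomial_poly_def)
  show "lead_coeff (binomial_poly b e) > 0"
    unfolding binomial_poly_def lead_coeff_smult lead_coeff_prod by (simp)
qed

text \<open>
  Positive leading coefficients cannot cancel.  This is what turns the degree of a sum of fibre
  polynomials into the maximum of their degrees.
\<close>

lemma lead_coeff_add_pos:
  fixes f g :: "'b::linordered_idom poly"
  assumes "lead_coeff f > 0" "lead_coeff g > 0"
  shows "degree (f + g) = max (degree f) (degree g)" "lead_coeff (f + g) > 0"
proof -
  consider "degree f < degree g" | "degree g < degree f" | "degree f = degree g" by linarith
  then have "degree (f + g) = max (degree f) (degree g) \<and> lead_coeff (f + g) > 0"
  proof cases
    case 1 then show ?thesis
      using assms by (simp add: degree_add_eq_right coeff_eq_0)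
  next
    case 2 then show ?thesis
      using assms by (simp add: degree_add_eq_left coeff_eq_0)
  next
    case 3
    then have "coeff (f + g) (degree f) > 0" using assms by simp
    then have "degree f \<le> degree (f + g)" by (intro le_degree) auto
    moreover have "degree (f + g) \<le> degree f" using 3 by (simp add: degree_add_le)
    ultimately show ?thesis using 3 \<open>coeff (f + g) (degree f) > 0\<close> by simp
  qed
  then show "degree (f + g) = max (degree f) (degree g)" "lead_coeff (f + g) > 0" by auto
qed

lemma lead_coeff_sum_pos:
  fixes f :: "'c \<Rightarrow> 'b::linordered_idom poly"
  assumes "finite X" "X \<noteq> {}" "\<And>x. x \<in> X \<Longrightarrow> lead_coeff (f x) > 0"
  shows "degree (\<Sum>x\<in>X. f x) = Max ((\<lambda>x. degree (f x)) ` X) \<and> lead_coeff (\<Sum>x\<in>X. f x) > 0"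
  using assms
proof (induction X rule: finite_ne_induct)
  case (insert x X)
  then have IH: "degree (sum f X) = Max ((\<lambda>x. degree (f x)) ` X)" "lead_coeff (sum f X) > 0"
    and x: "lead_coeff (f x) > 0"
    by blast+
  have "Max ((\<lambda>x. degree (f x)) ` insert x X) = max (degree (f x)) (degree (sum f X))"
    using insert.hyps IH(1) by simp
  moreover have "sum f (insert x X) = f x + sum f X"
    using insert.hyps by simp
  ultimately show ?case
    using lead_coeff_add_pos[OF x IH(2)] by metis
qed simp

text \<open>
  The exponent vectors of the monomials outside the monomial ideal generated by the exponents \<open>B\<close>.
\<close>

definition staircase :: "nat \<Rightarrow> (nat \<Rightarrow> nat) set \<Rightarrow> (nat \<Rightarrow> nat) set" where
  "staircase l B = {\<alpha> \<in> exponents l. \<forall>\<beta>\<in>B. \<not> \<beta> \<le> \<alpha>}"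

lemma le_clip_iff:
  assumes "\<And>i. \<beta> i \<le> p"
  shows "\<beta> \<le> clip p \<alpha> \<longleftrightarrow> \<beta> \<le> \<alpha>"
  using assms by (auto simp: le_fun_def clip_def)

lemma clip_clip [simp]: "clip p (clip p \<alpha>) = clip p \<alpha>"
  by (auto simp: clip_def)

text \<open>
  If the corners of a staircase have entries at most \<open>p\<close>, membership does not see entries beyond
  \<open>p\<close>.  The staircase is therefore a union of full fibres of clipping.
\<close>

lemma clip_in_staircase:
  assumes "\<forall>\<beta>\<in>B. \<forall>i. \<beta> i \<le> p"
  shows "\<alpha> \<in> exponents l \<Longrightarrow> clip p \<alpha> \<in> staircase l B \<longleftrightarrow> \<alpha> \<in> staircase l B"
  using assms le_clip_iff by (auto simp: staircase_def exponents_def clip_def le_fun_def)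

lemma tot_deg_le_if_clipped:
  assumes "clip p \<beta> = \<beta>"
  shows "tot_deg l \<beta> \<le> l * p"
proof -
  have "\<beta> i \<le> p" for i using assms by (metis clip_def min.cobounded1)
  then have "(\<Sum>i<l. \<beta> i) \<le> (\<Sum>i<l. p)" by (intro sum_mono) auto
  then show ?thesis by (simp add: tot_deg_def)
qed

text \<open>
  Group the vectors of the staircase by their clipped vector \<open>\<beta>\<close>.  The fibre over \<open>\<beta>\<close> is counted by
  a binomial coefficient which, for \<open>t\<close> at least the total degree of \<open>\<beta>\<close>, is a polynomial in \<open>t\<close>
  whose degree is the number of full coordinates of \<open>\<beta>\<close>.  Clipped vectors have total degree at most
  \<open>l * p\<close>, so all of these formulas hold from \<open>l * p\<close> on.  The factor \<open>d\<close> will be the degree of the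
  field extension.
\<close>

lemma staircase_hilbert_polynomial:
  assumes B: "\<forall>\<beta>\<in>B. \<forall>i. \<beta> i \<le> p" and 0: "(\<lambda>_. 0) \<in> staircase l B" and d: "0 < (d::nat)"
  obtains h :: "rat poly"
  where "\<And>t. l * p \<le> t \<Longrightarrow>
      of_nat (d * card {\<alpha> \<in> staircase l B. tot_deg l \<alpha> \<le> t}) = poly h (of_nat t)"
    and "lead_coeff h > 0"
    and "degree h = Max ((\<lambda>\<beta>. card (full_at l p \<beta>)) ` {\<beta> \<in> staircase l B. clip p \<beta> = \<beta>})"
proof -
  let ?C = "{\<beta> \<in> staircase l B. clip p \<beta> = \<beta>}"
  let ?e = "\<lambda>\<beta>. card (full_at l p \<beta>)"
  let ?q = "\<lambda>\<beta>. binomial_poly (tot_deg l \<beta>) (?e \<beta>)"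
  define h where "h = Polynomial.smult (of_nat d) (\<Sum>\<beta>\<in>?C. ?q \<beta>)"
  have "?C \<subseteq> {\<alpha> \<in> exponents l. tot_deg l \<alpha> \<le> l * p}"
    by (auto simp: staircase_def tot_deg_le_if_clipped)
  then have fin: "finite ?C"
    using finite_exponents_total finite_subset by blast
  have ne: "?C \<noteq> {}"
    using 0 by (auto simp: clip_def)
  have lead: "degree (\<Sum>\<beta>\<in>?C. ?q \<beta>) = Max ((\<lambda>\<beta>. degree (?q \<beta>)) ` ?C) \<and> lead_coeff (\<Sum>\<beta>\<in>?C. ?q \<beta>) > 0"
    by (rule lead_coeff_sum_pos[OF fin ne]) (rule binomial_poly_lead)
  show ?thesis
  proof
    fix t assume t: "l * p \<le> t"
    have tot: "tot_deg l \<beta> \<le> t" if "\<beta> \<in> ?C" for \<beta>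
      using that t tot_deg_le_if_clipped[of p \<beta> l] by auto
    let ?F = "\<lambda>\<beta>. {\<alpha> \<in> exponents l. clip p \<alpha> = \<beta> \<and> tot_deg l \<alpha> \<le> t}"
    have split: "{\<alpha> \<in> staircase l B. tot_deg l \<alpha> \<le> t} = (\<Union>\<beta>\<in>?C. ?F \<beta>)"

    proof (rule equalityI; rule subsetI)
      fix \<alpha> assume \<alpha>: "\<alpha> \<in> {\<alpha> \<in> staircase l B. tot_deg l \<alpha> \<le> t}"
      then have "\<alpha> \<in> exponents l" by (simp add: staircase_def)
      then have "clip p \<alpha> \<in> staircase l B"
        using clip_in_staircase[OF B] \<alpha> by blast
      then show "\<alpha> \<in> (\<Union>\<beta>\<in>?C. ?F \<beta>)"
        using \<alpha> \<open>\<alpha> \<in> exponents l\<close> by (intro UN_I[of "clip p \<alpha>"]) simp_all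
    next
      fix \<alpha> assume "\<alpha> \<in> (\<Union>\<beta>\<in>?C. ?F \<beta>)"
      then have "clip p \<alpha> \<in> staircase l B" "\<alpha> \<in> exponents l" "tot_deg l \<alpha> \<le> t"
        by auto
      then show "\<alpha> \<in> {\<alpha> \<in> staircase l B. tot_deg l \<alpha> \<le> t}"
        using clip_in_staircase[OF B] by blast
    qed
    have "card {\<alpha> \<in> staircase l B. tot_deg l \<alpha> \<le> t} = (\<Sum>\<beta>\<in>?C. card (?F \<beta>))"
      unfolding split
    proof (rule card_UN_disjoint[OF fin])
      have "?F \<beta> \<subseteq> {\<alpha> \<in> exponents l. tot_deg l \<alpha> \<le> t}" for \<beta> by blast
      then show "\<forall>\<beta>\<in>?C. finite (?F \<beta>)"
        using finite_exponents_total finite_subset by blast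
    qed auto
    also have "\<dots> = (\<Sum>\<beta>\<in>?C. (t - tot_deg l \<beta> + ?e \<beta>) choose ?e \<beta>)"
    proof (rule sum.cong[OF refl])
      fix \<beta> assume \<beta>: "\<beta> \<in> ?C"
      then show "card (?F \<beta>) = (t - tot_deg l \<beta> + ?e \<beta>) choose ?e \<beta>"
        using tot[OF \<beta>] by (intro card_clip_fibre) (auto simp: staircase_def)
    qed
    finally have "card {\<alpha> \<in> staircase l B. tot_deg l \<alpha> \<le> t} = \<dots>" .
    moreover have "poly h (of_nat t) = of_nat d * (\<Sum>\<beta>\<in>?C. of_nat ((t - tot_deg l \<beta> + ?e \<beta>) choose ?e \<beta>))"
      unfolding h_def poly_smult poly_sum
      by (rule arg_cong[OF sum.cong[OF refl]], rule poly_binomial_poly[OF tot])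
    ultimately show "of_nat (d * card {\<alpha> \<in> staircase l B. tot_deg l \<alpha> \<le> t}) = poly h (of_nat t)"
      by (simp only: of_nat_mult of_nat_sum)
  next
    show "lead_coeff h > 0"
      unfolding h_def lead_coeff_smult using conjunct2[OF lead] d by (intro mult_pos_pos) simp_all
    show "degree h = Max (?e ` ?C)"
      using lead d by (simp add: h_def binomial_poly_lead)
  qed
qed

section \<open>Growth of polynomials on a logarithmic scale\<close>

text \<open>
  With \<open>e\<close> the degree of \<open>h\<close>, the logarithm of \<open>f t\<close> to the base \<open>t\<close> is
  \<open>ln (f t / t ^ e) / ln t + e\<close>, and \<open>f t / t ^ e\<close> tends to the positive leading coefficient.
\<close>

lemma log_nat_poly_tendsto:
  fixes h :: "rat poly" and f :: "nat \<Rightarrow> nat"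
  assumes h: "lead_coeff h > 0" and f: "\<And>t. N \<le> t \<Longrightarrow> of_nat (f t) = poly h (of_nat t)"
  shows "(\<lambda>t. log_nat t (f t)) \<longlonglongrightarrow> ereal (real (degree h))"
proof -
  let ?e = "degree h"
  define g :: "real poly" where "g = map_poly of_rat h"
  have coeff_g: "coeff g i = of_rat (coeff h i)" for i
    by (simp add: g_def coeff_map_poly)
  have deg: "degree g = ?e"
    unfolding g_def by (rule degree_map_poly) auto
  have lc: "lead_coeff g > 0"
    using h by (simp add: deg coeff_g)
  have fg: "real (f t) = poly g (real t)" if "N \<le> t" for t
  proof -
    have "real (f t) = of_rat (of_nat (f t))" by simp
    also have "\<dots> = of_rat (poly h (of_nat t))" using f[OF that] by simp
    also have "\<dots> = poly g (real t)"
      by (simp add: poly_altdef deg coeff_g of_rat_sum of_rat_mult of_rat_power)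
    finally show ?thesis .
  qed
  have "((\<lambda>x. poly g x / x ^ ?e) \<longlongrightarrow> lead_coeff g) at_infinity"
    using poly_divide_tendsto_aux[of g] deg by simp
  then have "((\<lambda>x. poly g x / x ^ ?e) \<longlongrightarrow> lead_coeff g) at_top"
    by (rule tendsto_mono[OF at_top_le_at_infinity])
  then have lim: "(\<lambda>t. poly g (real t) / real t ^ ?e) \<longlonglongrightarrow> lead_coeff g"
    by (rule filterlim_compose) (rule filterlim_real_sequentially)
  then have "(\<lambda>t. ln (poly g (real t) / real t ^ ?e)) \<longlonglongrightarrow> ln (lead_coeff g)"
    using lc by (intro tendsto_ln) auto
  moreover have "filterlim (\<lambda>t. ln (real t)) at_top sequentially"
    by (rule filterlim_compose[OF ln_at_top filterlim_real_sequentially])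
  ultimately have "(\<lambda>t. ln (poly g (real t) / real t ^ ?e) / ln (real t)) \<longlonglongrightarrow> 0"
    by (intro tendsto_divide_0) (auto intro: filterlim_at_top_imp_at_infinity)
  then have "(\<lambda>t. ereal (ln (poly g (real t) / real t ^ ?e) / ln (real t) + real ?e)) \<longlonglongrightarrow> ereal (0 + real ?e)"
    by (intro tendsto_intros)
  moreover have "\<forall>\<^sub>F t in sequentially. ereal (ln (poly g (real t) / real t ^ ?e) / ln (real t) + real ?e) =
      log_nat t (f t)"
    using eventually_ge_at_top[of "max N 2"] order_tendstoD(1)[OF lim lc]
  proof eventually_elim
    case (elim t)
    then have t: "real t > 1" "N \<le> t" by auto
    have pos: "poly g (real t) > 0"
      using elim t by (simp add: zero_less_divide_iff)
    then have "f t \<noteq> 0" using fg[OF t(2)] by auto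
    moreover have "ln (poly g (real t) / real t ^ ?e) = ln (poly g (real t)) - real ?e * ln (real t)"
      using pos t by (simp add: ln_div ln_realpow)
    ultimately show ?case
      using fg[OF t(2)] t by (simp add: log_nat_def log_def diff_divide_distrib)
  qed
  ultimately show ?thesis
    unfolding add_0 by (rule Lim_transform_eventually)
qed

text \<open>
  Replacing the argument by an affine function of it preserves degree and positivity of the leading
  coefficient.  Filtrations of a module by different generating spaces are compared in this way.
\<close>

lemma log_nat_poly_affine_tendsto:
  fixes h :: "rat poly" and f :: "nat \<Rightarrow> nat"
  assumes h: "lead_coeff h > 0" and f: "\<And>t. N \<le> t \<Longrightarrow> of_nat (f t) = poly h (of_nat t)" and "0 < s"
  shows "(\<lambda>t. log_nat t (f (s * t + q))) \<longlonglongrightarrow> ereal (real (degree h))"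
proof -
  let ?h = "pcompose h [:of_nat q, of_nat s:]"
  have "degree ?h = degree h" using \<open>0 < s\<close> by (simp add: degree_pcompose)
  moreover have "lead_coeff ?h > 0"
    using h \<open>0 < s\<close> by (subst lead_coeff_comp) auto
  moreover have "of_nat (f (s * t + q)) = poly ?h (of_nat t)" if "N \<le> t" for t
  proof -
    have "N \<le> s * t + q" using that \<open>0 < s\<close>
      by (metis le_add1 le_trans mult_le_mono1 nat_mult_1 Suc_leI One_nat_def)
    then show ?thesis using f by (simp add: poly_pcompose algebra_simps)
  qed
  ultimately show ?thesis
    using log_nat_poly_tendsto[of ?h N "\<lambda>t. f (s * t + q)"] by simp
qed

lemma rat_poly_unique:
  fixes h g :: "rat poly"
  assumes "\<And>t. N \<le> t \<Longrightarrow> poly h (of_nat t) = poly g (of_nat t)"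
  shows "h = g"
proof (rule ccontr)
  assume "h \<noteq> g"
  then have "finite {z. poly (h - g) z = 0}" by (intro poly_roots_finite) simp
  moreover have "of_nat ` {N..} \<subseteq> {z. poly (h - g) z = 0}"
    using assms by auto
  moreover have "infinite (of_nat ` {N..} :: rat set)"
    by (subst finite_image_iff) (auto simp: inj_on_def infinite_Ici)
  ultimately show False using finite_subset by blast
qed

section \<open>Dimensions in the quotient by a left ideal\<close>

text \<open>
  The quotient module has cosets as elements, with spans and dimensions taken inside a record with an
  explicit carrier.  The lemmas of this part express them through elements of the algebra and
  subspaces of it, so that everything after it can be done in the algebra.
\<close>

locale left_ideal_quotient = k_algebra scale
  for scale :: "'k::field \<Rightarrow> 'a::ring_1 \<Rightarrow> 'a" +
  fixes I :: "'a set"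
  assumes left_ideal_I: "left_ideal I"
begin

abbreviation M where "M \<equiv> quotient_module I"
abbreviation kM where "kM \<equiv> k_module scale M"
abbreviation coset :: "'a \<Rightarrow> 'a set" where "coset a \<equiv> a +o I"

lemma I_add: "a \<in> I \<Longrightarrow> b \<in> I \<Longrightarrow> a + b \<in> I"
  and I_mult: "b \<in> I \<Longrightarrow> a * b \<in> I"
  and I_zero: "0 \<in> I"
  using left_ideal_I by (auto simp: left_ideal_def)

lemma I_uminus: "a \<in> I \<Longrightarrow> - a \<in> I"
  using I_mult[of a "-1"] by simp

lemma I_diff: "a \<in> I \<Longrightarrow> b \<in> I \<Longrightarrow> a - b \<in> I"
  using I_add[of a "- b"] I_uminus by simp

lemma I_sum: "(\<And>x. x \<in> X \<Longrightarrow> f x \<in> I) \<Longrightarrow> sum f X \<in> I"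
  by (induction X rule: infinite_finite_induct) (auto intro: I_add I_zero)

lemma coset_eq_iff: "coset a = coset b \<longleftrightarrow> a - b \<in> I"
proof
  assume "coset a = coset b"
  then have "a + 0 \<in> coset b"
    using I_zero by (auto simp: elt_set_plus_def)
  then show "a - b \<in> I" by (auto simp: elt_set_plus_def)
next
  assume ab: "a - b \<in> I"
  show "coset a = coset b"
  proof (rule equalityI; rule subsetI)
    fix z assume "z \<in> coset a"
    then obtain i where i: "i \<in> I" "z = a + i" by (auto simp: elt_set_plus_def)
    then have "z = b + ((a - b) + i)" by simp
    then show "z \<in> coset b" using I_add[OF ab i(1)] unfolding elt_set_plus_def by blast
  next
    fix z assume "z \<in> coset b"
    then obtain i where i: "i \<in> I" "z = b + i" by (auto simp: elt_set_plus_def)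
    then have "z = a + (i - (a - b))" by simp
    then show "z \<in> coset a" using I_diff[OF i(1) ab] unfolding elt_set_plus_def by blast
  qed
qed

lemma coset_eq_zero_iff: "coset a = I \<longleftrightarrow> a \<in> I"
proof -
  have "coset 0 = I" by (auto simp: elt_set_plus_def)
  then show ?thesis using coset_eq_iff[of a 0] by simp
qed

lemma coset_add: "coset a + coset b = coset (a + b)"
proof (rule equalityI; rule subsetI)
  fix z assume "z \<in> coset a + coset b"
  then obtain i j where "i \<in> I" "j \<in> I" "z = (a + b) + (i + j)"
    by (auto simp: elt_set_plus_def set_plus_def add_ac)
  then show "z \<in> coset (a + b)" using I_add by (auto simp: elt_set_plus_def)
next
  fix z assume "z \<in> coset (a + b)"
  then obtain i where "i \<in> I" "z = (a + i) + (b + 0)" by (auto simp: elt_set_plus_def add_ac)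
  then show "z \<in> coset a + coset b"
    using I_zero by (auto simp: elt_set_plus_def set_plus_def)
qed

lemma carrier_M: "carrier M = range coset"
  and zero_M: "zero M = I"
  and add_M: "add M = (+)"
  by (auto simp: quotient_module_def)

lemma smult_M: "smult M a (coset b) = coset (a * b)"
proof -
  have "coset (a * c) = coset (a * b)" if "c \<in> coset b" for c
  proof -
    have "c - b \<in> I" using that by (auto simp: elt_set_plus_def)
    from I_mult[OF this, of a] show ?thesis by (simp add: coset_eq_iff right_diff_distrib)
  qed
  moreover have "b \<in> coset b" using I_zero by (auto simp: elt_set_plus_def)
  ultimately have "(\<Union>c\<in>coset b. coset (a * c)) = coset (a * b)" by blast
  then show ?thesis by (simp add: quotient_module_def)
qed

lemma carrier_kM: "carrier kM = range coset"
  and zero_kM: "zero kM = I"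
  and add_kM: "add kM = (+)"
  by (simp_all add: k_module_def carrier_M zero_M add_M)

lemma smult_kM: "smult kM c (coset b) = coset (scale c b)"
  by (simp add: k_module_def smult_M scale_mult_left)

lemma coset_zero: "coset 0 = I"
  by (simp add: coset_eq_zero_iff I_zero)

lemma vectorspace_kM: "vectorspace class_ring kM"
proof (rule vs_criteria)
  show "field (class_ring :: 'k ring)" by (rule class_field)
  have "coset 0 \<in> carrier kM" unfolding carrier_kM by (rule rangeI)
  then show "\<zero>\<^bsub>kM\<^esub> \<in> carrier kM" by (simp only: coset_zero zero_kM)
  show "\<forall>v\<in>carrier kM. \<exists>w\<in>carrier kM. v \<oplus>\<^bsub>kM\<^esub> w = \<zero>\<^bsub>kM\<^esub>"
  proof
    fix v assume "v \<in> carrier kM"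
    then obtain a where "v = coset a" by (auto simp: carrier_kM)
    then have "v \<oplus>\<^bsub>kM\<^esub> coset (- a) = \<zero>\<^bsub>kM\<^esub>"
      by (simp add: add_kM coset_add coset_zero zero_kM)
    then show "\<exists>w\<in>carrier kM. v \<oplus>\<^bsub>kM\<^esub> w = \<zero>\<^bsub>kM\<^esub>" by (auto simp: carrier_kM)
  qed
  show "\<forall>v\<in>carrier kM. v \<oplus>\<^bsub>kM\<^esub> \<zero>\<^bsub>kM\<^esub> = v"
  proof
    fix v assume "v \<in> carrier kM"
    then obtain a where "v = coset a" by (auto simp: carrier_kM)
    then show "v \<oplus>\<^bsub>kM\<^esub> \<zero>\<^bsub>kM\<^esub> = v"
      using coset_add[of a 0] by (simp add: add_kM zero_kM coset_zero)
  qed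
qed (auto simp: carrier_kM add_kM coset_add smult_kM add_ac
      scale_left_distrib scale_right_distrib)

sublocale Q: vectorspace class_ring kM
  by (rule vectorspace_kM)

lemma finsum_coset:
  assumes "finite X"
  shows "finsum kM (\<lambda>x. coset (f x)) X = coset (sum f X)"
  using assms
proof (induction X rule: finite_induct)
  case empty
  then show ?case by (simp add: zero_kM coset_zero)
next
  case (insert x X)
  then have "finsum kM (\<lambda>x. coset (f x)) (insert x X) =
      coset (f x) \<oplus>\<^bsub>kM\<^esub> finsum kM (\<lambda>x. coset (f x)) X"
    by (intro Q.finsum_insert) (auto simp: carrier_kM)
  then show ?case using insert by (simp add: add_kM coset_add)
qed

lemma lincomb_coset:
  assumes "finite X" "inj_on coset X"
  shows "Q.lincomb a (coset ` X) = coset (\<Sum>x\<in>X. scale (a (coset x)) x)"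
proof -
  have "Q.lincomb a (coset ` X) = finsum kM (\<lambda>v. a v \<odot>\<^bsub>kM\<^esub> v) (coset ` X)"
    by (simp add: Q.lincomb_def)
  also have "\<dots> = finsum kM (\<lambda>x. a (coset x) \<odot>\<^bsub>kM\<^esub> coset x) X"
    by (rule Q.finsum_reindex) (use assms in \<open>auto simp: smult_kM carrier_kM\<close>)
  also have "\<dots> = finsum kM (\<lambda>x. coset (scale (a (coset x)) x)) X"
    by (simp add: smult_kM)
  finally show ?thesis using finsum_coset[OF assms(1)] by simp
qed

lemma subspace_coset_image:
  assumes "subspace U"
  shows "VectorSpace.subspace class_ring (coset ` U) kM"
proof -
  have "submodule class_ring (coset ` U) kM"
  proof
    show "coset ` U \<subseteq> carrier kM" by (auto simp: carrier_kM)
    have "coset 0 \<in> coset ` U" by (rule imageI[OF subspace_0[OF assms]])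
    then show "\<zero>\<^bsub>kM\<^esub> \<in> coset ` U" by (simp only: coset_zero zero_kM)
  qed (auto simp: add_kM coset_add smult_kM intro: subspace_add[OF assms] subspace_scale[OF assms])
  then show ?thesis by (simp add: VectorSpace.subspace_def vectorspace_kM)
qed

lemma span_coset_image: "Q.span (coset ` X) = coset ` span X"
proof
  have "coset ` X \<subseteq> coset ` span X" using span_superset by blast
  then show "Q.span (coset ` X) \<subseteq> coset ` span X"
    by (rule Q.span_is_subset) (use subspace_coset_image[OF subspace_span] in \<open>auto simp: VectorSpace.subspace_def\<close>)
next
  have sub: "submodule class_ring (Q.span (coset ` X)) kM"
    by (rule Q.span_is_submodule) (auto simp: carrier_kM)
  then interpret S: submodule class_ring "Q.span (coset ` X)" kM .
  have "subspace {a. coset a \<in> Q.span (coset ` X)}"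
  proof (rule subspaceI)
    show "0 \<in> {a. coset a \<in> Q.span (coset ` X)}"
      using S.zero_closed by (simp add: coset_zero zero_kM)
    fix a b assume "a \<in> {a. coset a \<in> Q.span (coset ` X)}" "b \<in> {a. coset a \<in> Q.span (coset ` X)}"
    then show "a + b \<in> {a. coset a \<in> Q.span (coset ` X)}"
      using S.m_closed[of "coset a" "coset b"] by (simp add: add_kM coset_add)
  next
    fix a c assume "a \<in> {a. coset a \<in> Q.span (coset ` X)}"
    then show "scale c a \<in> {a. coset a \<in> Q.span (coset ` X)}"
      using S.smult_closed[of c "coset a"] by (simp add: smult_kM)
  qed
  moreover have "X \<subseteq> {a. coset a \<in> Q.span (coset ` X)}"
    using Q.in_own_span[of "coset ` X"] by (auto simp: carrier_kM)
  ultimately have "span X \<subseteq> {a. coset a \<in> Q.span (coset ` X)}"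
    by (intro span_minimal) auto
  then show "coset ` span X \<subseteq> Q.span (coset ` X)" by blast
qed

lemma k_span_coset: "k_span scale M (coset ` X) = coset ` span X"
  using span_coset_image by (simp add: k_span_def)

text \<open>
  Linear independence of the cosets, stated for representatives.
\<close>

definition indep_mod :: "'a set \<Rightarrow> bool" where
  "indep_mod B \<longleftrightarrow> (\<forall>c. (\<Sum>b\<in>B. scale (c b) b) \<in> I \<longrightarrow> (\<forall>b\<in>B. c b = 0))"

lemma indep_mod_inj: "finite B \<Longrightarrow> indep_mod B \<Longrightarrow> inj_on coset B"
proof (rule inj_onI, rule ccontr)
  fix x y assume B: "finite B" "indep_mod B" and xy: "x \<in> B" "y \<in> B" "coset x = coset y" "x \<noteq> y"
  let ?c = "\<lambda>b. if b = x then 1 else if b = y then -1 else 0 :: 'k"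
  have "(\<Sum>b\<in>B. scale (?c b) b) = (\<Sum>b\<in>{x, y}. scale (?c b) b)"
    using xy B(1) by (intro sum.mono_neutral_right) auto
  also have "\<dots> = x - y" using xy(4) by simp
  finally have "(\<Sum>b\<in>B. scale (?c b) b) \<in> I" using xy(3) by (simp add: coset_eq_iff)
  from B(2)[unfolded indep_mod_def, rule_format, OF this xy(1)] have "?c x = 0" .
  then show False by simp
qed

lemma indep_mod_lin_indpt:
  assumes "finite B" "indep_mod B"
  shows "Q.lin_indpt (coset ` B)"
proof (rule Q.finite_lin_indpt2)
  fix a :: "'a set \<Rightarrow> 'k"
  assume "Q.lincomb a (coset ` B) = \<zero>\<^bsub>kM\<^esub>"
  then have "(\<Sum>b\<in>B. scale (a (coset b)) b) \<in> I"
    using lincomb_coset[OF assms(1) indep_mod_inj[OF assms]] by (simp add: zero_kM coset_eq_zero_iff)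
  then have "\<forall>b\<in>B. a (coset b) = 0"
    using assms(2)[unfolded indep_mod_def, rule_format, of "\<lambda>b. a (coset b)"] by blast
  then show "\<forall>v\<in>coset ` B. a v = \<zero>\<^bsub>class_ring\<^esub>" by simp
qed (use assms in \<open>auto simp: carrier_kM\<close>)

lemma k_dim_span_indep_mod:
  assumes "finite B" "indep_mod B"
  shows "k_dim scale M (coset ` span B) = card B"
proof -
  let ?W = "coset ` span B"
  have W: "VectorSpace.subspace class_ring ?W kM"
    by (rule subspace_coset_image[OF subspace_span])
  interpret W: vectorspace class_ring "Q.vs ?W"
    by (rule Q.subspace_is_vs[OF W])
  have BW: "coset ` B \<subseteq> ?W" using span_superset by blast
  have sub: "submodule class_ring ?W kM" using W by (simp add: VectorSpace.subspace_def)
  have "W.basis (coset ` B)"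
    unfolding W.basis_def using Q.span_li_not_depend[OF BW sub] indep_mod_lin_indpt[OF assms]
    by (auto simp: span_coset_image BW[THEN subsetD])
  then have "W.dim = card (coset ` B)"
    by (intro W.dim_basis) (use assms in auto)
  then show ?thesis
    using card_image[OF indep_mod_inj[OF assms]] by (simp add: k_dim_def)
qed

text \<open>
  The smaller space \<open>W\<close> is not known to be finitely generated.  Independent subsets of \<open>W\<close> stay
  independent in the larger space, so their sizes are bounded and a largest one is a basis of \<open>W\<close>.
\<close>

lemma k_dim_mono:
  assumes W: "VectorSpace.subspace class_ring W kM" and WU: "W \<subseteq> coset ` span B" and B: "finite B"
  shows "k_dim scale M W \<le> k_dim scale M (coset ` span B)"
proof -
  let ?U = "coset ` span B"
  have U: "VectorSpace.subspace class_ring ?U kM"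
    by (rule subspace_coset_image[OF subspace_span])
  have subW: "submodule class_ring W kM" and subU: "submodule class_ring ?U kM"
    using W U by (simp_all add: VectorSpace.subspace_def)
  interpret W: vectorspace class_ring "Q.vs W" by (rule Q.subspace_is_vs[OF W])
  interpret U: vectorspace class_ring "Q.vs ?U" by (rule Q.subspace_is_vs[OF U])
  have BU: "coset ` B \<subseteq> ?U" using span_superset by blast
  have "U.gen_set (coset ` B)"
    using Q.span_li_not_depend(1)[OF BU subU] by (simp add: span_coset_image)
  then have U_fin: "U.fin_dim"
    unfolding U.fin_dim_def using B BU by (intro exI[of _ "coset ` B"]) simp
  have bound: "finite A \<and> card A \<le> U.dim" if A: "A \<subseteq> W" "W.lin_indpt A" for A
  proof -
    have "U.lin_indpt A"
      using A Q.span_li_not_depend(2)[OF A(1) subW] Q.span_li_not_depend(2)[OF _ subU, of A] WU by auto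
    then show ?thesis using U.li_le_dim[OF U_fin] A(1) WU by auto
  qed
  have "W.lin_indpt {}" by (auto simp: W.lin_dep_def)
  then obtain A where A: "finite A" "maximal A (\<lambda>A. A \<subseteq> carrier (Q.vs W) \<and> W.lin_indpt A)"
    using maximal_exists[of "\<lambda>A. A \<subseteq> carrier (Q.vs W) \<and> W.lin_indpt A" U.dim "{}"] bound by auto
  then have "W.basis A" by (intro W.max_li_is_basis)
  then have "W.dim = card A" using W.dim_basis A(1) by simp
  also have "\<dots> \<le> U.dim" using bound \<open>W.basis A\<close> by (auto simp: W.basis_def)
  finally show ?thesis by (simp add: k_dim_def)
qed

text \<open>
  The sum in the quotient module is a \<open>finsum\<close>, which depends only on the additive structure; this
  structure is shared by the module over the algebra and its underlying vector space.
\<close>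

lemma sum_components_coset:
  "sum_components M (\<lambda>j. coset ` U j) i = coset ` {\<Sum>j\<le>i. a j | a. \<forall>j\<le>i. a j \<in> U j}"
proof -
  have fs: "finsum M w X = finsum kM w X" for w and X :: "nat set"
    by (simp add: finsum_def finprod_def k_module_def)
  show ?thesis
  proof (rule equalityI; rule subsetI)
    fix v assume "v \<in> sum_components M (\<lambda>j. coset ` U j) i"
    then obtain w where w: "v = finsum kM w {..i}" "\<forall>j\<le>i. w j \<in> coset ` U j"
      by (auto simp: sum_components_def fs Pi_iff)
    have "\<forall>j\<in>{..i}. \<exists>a. w j = coset a \<and> a \<in> U j"
      using w(2) by blast
    from bchoice[OF this] obtain a where a: "\<forall>j\<le>i. w j = coset (a j) \<and> a j \<in> U j"
      by auto
    have "v = finsum kM (\<lambda>j. coset (a j)) {..i}"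
      unfolding w(1) by (rule Q.finsum_cong') (use a in \<open>auto simp: carrier_kM\<close>)
    then show "v \<in> coset ` {\<Sum>j\<le>i. a j | a. \<forall>j\<le>i. a j \<in> U j}"
      using a finsum_coset[of "{..i}" a] by auto
  next
    fix v assume "v \<in> coset ` {\<Sum>j\<le>i. a j | a. \<forall>j\<le>i. a j \<in> U j}"
    then obtain a where "v = coset (\<Sum>j\<le>i. a j)" "\<forall>j\<le>i. a j \<in> U j" by auto
    then show "v \<in> sum_components M (\<lambda>j. coset ` U j) i"
      using finsum_coset[of "{..i}" a] by (auto simp: sum_components_def fs Pi_iff)
  qed
qed

lemma act_space_coset:
  "act_space scale M V (coset ` U) = coset ` span {v * u | v u. v \<in> V \<and> u \<in> U}"
proof -
  have "{smult M v f | v f. v \<in> V \<and> f \<in> coset ` U} = coset ` {v * u | v u. v \<in> V \<and> u \<in> U}"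
    using smult_M by (auto simp: image_iff) blast+
  then show ?thesis by (simp add: act_space_def k_span_coset)
qed

end

section \<open>Monomials with coefficients on the left\<close>

text \<open>
  The exponent that \<open>x\<^sub>i X\<^sup>\<alpha>\<close> has when the generators commute.
\<close>

definition raise :: "nat \<Rightarrow> (nat \<Rightarrow> nat) \<Rightarrow> nat \<Rightarrow> nat" where
  "raise i \<alpha> = \<alpha>(i := Suc (\<alpha> i))"

lemma raise_in_exponents [simp]: "i < l \<Longrightarrow> raise i \<alpha> \<in> exponents l \<longleftrightarrow> \<alpha> \<in> exponents l"
  by (auto simp: raise_def exponents_def)

lemma raise_commute: "raise i (raise j \<alpha>) = raise j (raise i \<alpha>)"
  by (auto simp: raise_def fun_eq_iff)

lemma tot_deg_raise [simp]: "i < l \<Longrightarrow> tot_deg l (raise i \<alpha>) = Suc (tot_deg l \<alpha>)"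
proof -
  assume i: "i < l"
  have "(\<Sum>j<l. raise i \<alpha> j) = (\<Sum>j<l. \<alpha> j + (if j = i then 1 else 0))"
    by (intro sum.cong) (auto simp: raise_def)
  then show ?thesis using i by (simp add: tot_deg_def sum.distrib)
qed

lemma le_raise: "\<alpha> \<le> raise i \<alpha>"
  by (auto simp: raise_def le_fun_def)

lemma inj_raise: "inj (raise i)"
proof (rule injI)
  fix \<alpha> \<beta> assume eq: "raise i \<alpha> = raise i \<beta>"
  show "\<alpha> = \<beta>"
  proof
    fix j show "\<alpha> j = \<beta> j"
      using fun_cong[OF eq, of j] by (cases "j = i") (auto simp: raise_def)
  qed
qed

lemma zero_in_exponents [simp]: "(\<lambda>_. 0) \<in> exponents l"
  by (simp add: exponents_def)

lemma tot_deg_zero [simp]: "tot_deg l (\<lambda>_. 0) = 0"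
  by (simp add: tot_deg_def)

text \<open>
  Monomials are products in a fixed order, so a monomial grows by one factor on the left when its
  new variable does not come after the variables that it already contains.  Removing the first
  variable that occurs gives an induction in which this always holds.
\<close>

lemma exponents_induct [consumes 1, case_names zero raise]:
  assumes \<alpha>: "\<alpha> \<in> exponents l"
    and zero: "P (\<lambda>_. 0)"
    and step: "\<And>i \<alpha>. i < l \<Longrightarrow> \<alpha> \<in> exponents l \<Longrightarrow> (\<And>j. j < i \<Longrightarrow> \<alpha> j = 0) \<Longrightarrow> P \<alpha> \<Longrightarrow> P (raise i \<alpha>)"
  shows "P \<alpha>"
  using \<alpha>
proof (induction "tot_deg l \<alpha>" arbitrary: \<alpha>)
  case 0
  then have "\<alpha> = (\<lambda>_. 0)"
    by (auto simp: tot_deg_def exponents_def fun_eq_iff) (metis lessThan_iff not_le)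
  then show ?case using zero by simp
next
  case (Suc t)
  have "\<exists>i. \<alpha> i \<noteq> 0"
  proof (rule ccontr)
    assume "\<nexists>i. \<alpha> i \<noteq> 0"
    then have "tot_deg l \<alpha> = 0" by (simp add: tot_deg_def)
    then show False using Suc(2) by simp
  qed
  then have ex: "\<exists>i. \<alpha> i \<noteq> 0" .
  define i where "i = (LEAST i. \<alpha> i \<noteq> 0)"
  have i1: "\<alpha> i \<noteq> 0"
    unfolding i_def by (rule LeastI_ex[OF ex])
  have i2: "\<alpha> j = 0" if "j < i" for j
    using not_less_Least[OF that[unfolded i_def]] by (rule notnotD)
  have il: "i < l"
  proof (rule ccontr)
    assume "\<not> i < l"
    then show False using i1 Suc(3) by (simp add: exponents_def)
  qed
  let ?\<beta> = "\<alpha>(i := \<alpha> i - 1)"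
  have eq: "\<alpha> = raise i ?\<beta>" using i1 by (auto simp: raise_def)
  have "?\<beta> \<in> exponents l" using Suc(3) by (auto simp: exponents_def)
  moreover have "t = tot_deg l ?\<beta>" using Suc(2) tot_deg_raise[OF il, of ?\<beta>] eq by simp
  ultimately have "P ?\<beta>" using Suc(1) by blast
  then have "P (raise i ?\<beta>)"
    using \<open>?\<beta> \<in> exponents l\<close> il i2 by (intro step) auto
  then show ?case using eq by simp
qed

lemma mono_at_zero [simp]: "mono_at l x (\<lambda>_. 0) = 1"
proof -
  have "prod_list (map (\<lambda>_. 1) xs) = (1::'a::ring_1)" for xs :: "nat list" by (induction xs) auto
  then show ?thesis by (simp add: mono_at_def)
qed

text \<open>
  The new factor must pass the powers of the earlier variables to reach its place, and nothing else.
\<close>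

lemma mono_at_raise:
  fixes x :: "nat \<Rightarrow> 'a::ring_1"
  assumes i: "i < l" and comm: "\<And>j. j < i \<Longrightarrow> \<alpha> j \<noteq> 0 \<Longrightarrow> x i * x j = x j * x i"
  shows "x i * mono_at l x \<alpha> = mono_at l x (raise i \<alpha>)"
proof -
  let ?P = "\<lambda>\<alpha> js. prod_list (map (\<lambda>j. x j ^ \<alpha> j) js)"
  have upt: "[0..<l] = [0..<i] @ i # [Suc i..<l]"
    using i by (metis upt_conv_Cons upt_add_eq_append le0 le_add_diff_inverse less_imp_le)
  have pow: "x i * x j ^ \<alpha> j = x j ^ \<alpha> j * x i" if "j < i" for j
    using power_commuting_commutes[of "x j" "x i" "\<alpha> j"] comm[OF that] by (cases "\<alpha> j = 0") simp_all
  have comm_js: "x i * ?P \<alpha> js = ?P \<alpha> js * x i" if "set js \<subseteq> {..<i}" for js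
    using that
  proof (induction js)
    case (Cons j js)
    have "x i * ?P \<alpha> (j # js) = x j ^ \<alpha> j * (x i * ?P \<alpha> js)"
      using pow[of j] Cons.prems by (simp add: mult.assoc[symmetric])
    then show ?case using Cons by (simp add: mult.assoc)
  qed simp
  have comm_P: "x i * ?P \<alpha> [0..<i] = ?P \<alpha> [0..<i] * x i" by (rule comm_js) auto
  have split: "mono_at l x \<beta> = ?P \<beta> [0..<i] * (x i ^ \<beta> i * ?P \<beta> [Suc i..<l])" for \<beta>
    by (simp add: mono_at_def upt)
  have P1: "?P (raise i \<alpha>) [0..<i] = ?P \<alpha> [0..<i]"
    by (rule arg_cong[where f = prod_list], rule map_cong) (auto simp: raise_def)
  have P2: "?P (raise i \<alpha>) [Suc i..<l] = ?P \<alpha> [Suc i..<l]"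
    by (rule arg_cong[where f = prod_list], rule map_cong) (auto simp: raise_def)
  have "x i * mono_at l x \<alpha> = (x i * ?P \<alpha> [0..<i]) * (x i ^ \<alpha> i * ?P \<alpha> [Suc i..<l])"
    unfolding split by (simp only: mult.assoc)
  also have "\<dots> = ?P \<alpha> [0..<i] * ((x i * x i ^ \<alpha> i) * ?P \<alpha> [Suc i..<l])"
    unfolding comm_P by (simp only: mult.assoc)
  also have "x i * x i ^ \<alpha> i = x i ^ raise i \<alpha> i"
    by (simp add: raise_def)
  finally show ?thesis
    unfolding split[of "raise i \<alpha>"] P1 P2 .
qed

text \<open>
  An algebra with a left basis of ordered monomials, without any rule for multiplying coefficients
  and monomials in the other order.
\<close>

locale left_monomial_basis = k_algebra scale
  for scale :: "'k::field \<Rightarrow> 'a::ring_1 \<Rightarrow> 'a" +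
  fixes R :: "'a set" and l :: nat and x :: "nat \<Rightarrow> 'a"
  assumes R_subalgebra: "subalgebra scale R"
    and left_basis: "monos_left_basis R l x"
begin

abbreviation X :: "(nat \<Rightarrow> nat) \<Rightarrow> 'a" where "X \<equiv> mono_at l x"

lemma R_one: "1 \<in> R"
  and R_mult: "a \<in> R \<Longrightarrow> b \<in> R \<Longrightarrow> a * b \<in> R"
  and R_subspace: "subspace R"
  using R_subalgebra by (auto simp: subalgebra_def)

lemma R_zero: "0 \<in> R"
  and R_add: "a \<in> R \<Longrightarrow> b \<in> R \<Longrightarrow> a + b \<in> R"
  and R_scale: "a \<in> R \<Longrightarrow> scale c a \<in> R"
  and R_uminus: "a \<in> R \<Longrightarrow> - a \<in> R"
  using R_subspace by (auto simp: subspace_0 subspace_add subspace_scale subspace_neg)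

definition coef :: "'a \<Rightarrow> (nat \<Rightarrow> nat) \<Rightarrow> 'a" where
  "coef f = (THE c. is_left_expansion R l x f c)"

definition supp :: "'a \<Rightarrow> (nat \<Rightarrow> nat) set" where
  "supp f = {\<alpha>. coef f \<alpha> \<noteq> 0}"

lemma coef_expansion: "is_left_expansion R l x f (coef f)"
  unfolding coef_def by (rule theI'[OF left_basis[unfolded monos_left_basis_def, rule_format]])

lemma coef_eqI: "is_left_expansion R l x f c \<Longrightarrow> coef f = c"
  unfolding coef_def by (rule the1_equality[OF left_basis[unfolded monos_left_basis_def, rule_format]])

lemma finite_supp: "finite (supp f)"
  and supp_exponents: "supp f \<subseteq> exponents l"
  and coef_in_R: "coef f \<alpha> \<in> R"
  and expansion: "f = (\<Sum>\<alpha>\<in>supp f. coef f \<alpha> * X \<alpha>)"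
  using coef_expansion[of f] by (auto simp: is_left_expansion_def supp_def)

lemma coef_sum_monos:
  assumes A: "finite A" "A \<subseteq> exponents l" and c: "\<And>\<alpha>. \<alpha> \<in> A \<Longrightarrow> c \<alpha> \<in> R"
  shows "coef (\<Sum>\<alpha>\<in>A. c \<alpha> * X \<alpha>) = (\<lambda>\<alpha>. if \<alpha> \<in> A then c \<alpha> else 0)"
proof (rule coef_eqI)
  let ?c = "\<lambda>\<alpha>. if \<alpha> \<in> A then c \<alpha> else 0"
  have sub: "{\<alpha>. ?c \<alpha> \<noteq> 0} \<subseteq> A" by auto
  have "(\<Sum>\<alpha>\<in>A. c \<alpha> * X \<alpha>) = (\<Sum>\<alpha> | ?c \<alpha> \<noteq> 0. ?c \<alpha> * X \<alpha>)"
    using A(1) by (intro sum.mono_neutral_cong_right) auto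
  then show "is_left_expansion R l x (\<Sum>\<alpha>\<in>A. c \<alpha> * X \<alpha>) ?c"
    using A finite_subset[OF sub A(1)] c R_zero unfolding is_left_expansion_def by auto
qed

lemma coef_mono: "\<alpha> \<in> exponents l \<Longrightarrow> r \<in> R \<Longrightarrow> coef (r * X \<alpha>) = (\<lambda>\<beta>. if \<beta> = \<alpha> then r else 0)"
  using coef_sum_monos[of "{\<alpha>}" "\<lambda>_. r"] by simp

lemma coef_zero [simp]: "coef 0 = (\<lambda>_. 0)"
  using coef_sum_monos[of "{}"] by simp

lemma expansion_superset:
  assumes "finite A" "supp f \<subseteq> A"
  shows "f = (\<Sum>\<alpha>\<in>A. coef f \<alpha> * X \<alpha>)"
proof -
  have "(\<Sum>\<alpha>\<in>supp f. coef f \<alpha> * X \<alpha>) = (\<Sum>\<alpha>\<in>A. coef f \<alpha> * X \<alpha>)"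
    using assms by (intro sum.mono_neutral_left) (auto simp: supp_def)
  then show ?thesis using expansion[of f] by simp
qed

lemma coef_add: "coef (f + g) \<alpha> = coef f \<alpha> + coef g \<alpha>"
proof -
  let ?A = "supp f \<union> supp g"
  have "f + g = (\<Sum>\<alpha>\<in>?A. coef f \<alpha> * X \<alpha>) + (\<Sum>\<alpha>\<in>?A. coef g \<alpha> * X \<alpha>)"
    using expansion_superset[of ?A f] expansion_superset[of ?A g] finite_supp by simp
  also have "\<dots> = (\<Sum>\<alpha>\<in>?A. (coef f \<alpha> + coef g \<alpha>) * X \<alpha>)"
    by (simp add: distrib_right sum.distrib)
  finally have "coef (f + g) = (\<lambda>\<alpha>. if \<alpha> \<in> ?A then coef f \<alpha> + coef g \<alpha> else 0)"
    using coef_sum_monos[of ?A "\<lambda>\<alpha>. coef f \<alpha> + coef g \<alpha>"] finite_supp supp_exponents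
    by (simp add: R_add coef_in_R)
  then show ?thesis by (auto simp: supp_def)
qed

lemma coef_mult_left: "r \<in> R \<Longrightarrow> coef (r * f) \<alpha> = r * coef f \<alpha>"
proof -
  assume r: "r \<in> R"
  have "r * f = (\<Sum>\<alpha>\<in>supp f. (r * coef f \<alpha>) * X \<alpha>)"
    by (subst expansion[of f]) (simp add: sum_distrib_left mult.assoc)
  then have "coef (r * f) = (\<lambda>\<alpha>. if \<alpha> \<in> supp f then r * coef f \<alpha> else 0)"
    using coef_sum_monos[of "supp f" "\<lambda>\<alpha>. r * coef f \<alpha>"] finite_supp supp_exponents r
    by (simp add: R_mult coef_in_R)
  then show ?thesis by (auto simp: supp_def)
qed

lemma coef_scale: "coef (scale c f) \<alpha> = scale c (coef f \<alpha>)"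
  using coef_mult_left[OF R_scale[OF R_one], of c f] by (simp add: scale_mult_left)

lemma coef_uminus: "coef (- f) \<alpha> = - coef f \<alpha>"
  using coef_mult_left[OF R_uminus[OF R_one], of f] by simp

lemma coef_diff: "coef (f - g) \<alpha> = coef f \<alpha> - coef g \<alpha>"
  using coef_add[of f "- g"] by (simp add: coef_uminus)

lemma coef_sum: "coef (sum f A) \<alpha> = (\<Sum>a\<in>A. coef (f a) \<alpha>)"
  by (induction A rule: infinite_finite_induct) (auto simp: coef_add)

lemma supp_empty_iff: "supp f = {} \<longleftrightarrow> f = 0"
  using expansion[of f] by (auto simp: supp_def)

lemma inj_mono: "inj_on X (exponents l)"
proof (rule inj_onI)
  fix \<alpha> \<beta> assume "\<alpha> \<in> exponents l" "\<beta> \<in> exponents l" "X \<alpha> = X \<beta>"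
  then have "(\<lambda>\<gamma>. if \<gamma> = \<alpha> then 1 else 0 :: 'a) = (\<lambda>\<gamma>. if \<gamma> = \<beta> then 1 else 0)"
    using coef_mono[of \<alpha> 1] coef_mono[of \<beta> 1] R_one by simp
  from fun_cong[OF this, of \<alpha>] show "\<alpha> = \<beta>" by (simp split: if_splits)
qed

lemma exponent_of_mono [simp]: "\<alpha> \<in> exponents l \<Longrightarrow> exponent_of l x (X \<alpha>) = \<alpha>"
  by (simp add: exponent_of_def inj_mono)

lemma tdeg_mono [simp]: "\<alpha> \<in> exponents l \<Longrightarrow> tdeg l x (X \<alpha>) = tot_deg l \<alpha>"
  by (simp add: tdeg_def tot_deg_def)

lemma monos_le_eq: "monos_le l x t = X ` {\<alpha> \<in> exponents l. tot_deg l \<alpha> \<le> t}"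
  and monos_eq_eq: "monos_eq l x t = X ` {\<alpha> \<in> exponents l. tot_deg l \<alpha> = t}"
  by (auto simp: monos_le_def monos_eq_def monomials_def)

lemma mono_support_eq: "mono_support R l x f = X ` supp f"
  by (simp add: mono_support_def supp_def coef_def)

text \<open>
  The left \<open>R\<close>-span of the monomials with exponent in \<open>E\<close>.  Describing it by supports makes the
  monotonicity in \<open>E\<close> and the absence of certain monomials immediate; \<open>lspan_subset\<close> recovers the
  description by generators.
\<close>

definition lspan :: "(nat \<Rightarrow> nat) set \<Rightarrow> 'a set" where
  "lspan E = {f. supp f \<subseteq> E}"

lemma lspan_zero: "0 \<in> lspan E"
  by (simp add: lspan_def supp_def)

lemma lspan_add: "f \<in> lspan E \<Longrightarrow> g \<in> lspan E \<Longrightarrow> f + g \<in> lspan E"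
  unfolding lspan_def supp_def mem_Collect_eq subset_iff coef_add by (metis add_0)

lemma lspan_mult_left: "r \<in> R \<Longrightarrow> f \<in> lspan E \<Longrightarrow> r * f \<in> lspan E"
  by (auto simp: lspan_def supp_def coef_mult_left)

lemma lspan_diff: "f \<in> lspan E \<Longrightarrow> g \<in> lspan E \<Longrightarrow> f - g \<in> lspan E"
  unfolding lspan_def supp_def mem_Collect_eq subset_iff coef_diff by (metis diff_self)

lemma lspan_sum: "(\<And>a. a \<in> A \<Longrightarrow> f a \<in> lspan E) \<Longrightarrow> sum f A \<in> lspan E"
  by (induction A rule: infinite_finite_induct) (auto intro: lspan_add lspan_zero)

lemma lspan_mono: "E \<subseteq> E' \<Longrightarrow> f \<in> lspan E \<Longrightarrow> f \<in> lspan E'"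
  by (auto simp: lspan_def)

lemma X_in_lspan: "\<alpha> \<in> exponents l \<Longrightarrow> \<alpha> \<in> E \<Longrightarrow> X \<alpha> \<in> lspan E"
  using coef_mono[of \<alpha> 1] R_one by (auto simp: lspan_def supp_def split: if_splits)

lemma X_in_lspanD: "\<alpha> \<in> exponents l \<Longrightarrow> X \<alpha> \<in> lspan E \<Longrightarrow> \<alpha> \<in> E"
  using coef_mono[of \<alpha> 1] R_one by (auto simp: lspan_def supp_def split: if_splits)

lemma subspace_lspan: "subspace (lspan E)"
  by (rule subspaceI) (auto simp: lspan_zero lspan_add, auto simp: lspan_def supp_def coef_scale)

lemma lspan_subset:
  assumes J: "0 \<in> J" "\<And>f g. f \<in> J \<Longrightarrow> g \<in> J \<Longrightarrow> f + g \<in> J"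
    and mono: "\<And>r \<alpha>. r \<in> R \<Longrightarrow> \<alpha> \<in> E \<Longrightarrow> \<alpha> \<in> exponents l \<Longrightarrow> r * X \<alpha> \<in> J"
  shows "lspan E \<subseteq> J"
proof
  fix f assume f: "f \<in> lspan E"
  have "(\<Sum>\<alpha>\<in>A. coef f \<alpha> * X \<alpha>) \<in> J" if "finite A" "A \<subseteq> supp f" for A
    using that
  proof (induction A rule: finite_induct)
    case (insert \<alpha> A)
    then have "coef f \<alpha> * X \<alpha> \<in> J"
      using f supp_exponents[of f] by (intro mono coef_in_R) (auto simp: lspan_def)
    then show ?case using insert J(2) by simp
  qed (simp add: J(1))
  from this[OF finite_supp subset_refl] show "f \<in> J"
    using expansion[of f] by simp
qed

lemma mult_lspan:
  assumes "\<And>r \<alpha>. r \<in> R \<Longrightarrow> \<alpha> \<in> E \<Longrightarrow> \<alpha> \<in> exponents l \<Longrightarrow> g * (r * X \<alpha>) \<in> lspan E'"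
    and f: "f \<in> lspan E"
  shows "g * f \<in> lspan E'"
proof -
  have "lspan E \<subseteq> {f. g * f \<in> lspan E'}"
    by (rule lspan_subset) (auto simp: lspan_zero distrib_left lspan_add assms(1))
  then show ?thesis using f by blast
qed

lemma left_span_monos:
  assumes E: "E \<subseteq> exponents l"
  shows "left_span R (X ` E) = lspan E"
proof (rule equalityI; rule subsetI)
  fix f assume "f \<in> left_span R (X ` E)"
  then obtain U c where U: "f = (\<Sum>u\<in>U. c u * u)" "U \<subseteq> X ` E" "c \<in> U \<rightarrow> R"
    by (auto simp: left_span_def)
  show "f \<in> lspan E"
    unfolding U(1)
  proof (rule lspan_sum)
    fix u assume u: "u \<in> U"
    then obtain \<alpha> where "u = X \<alpha>" "\<alpha> \<in> E" using U(2) by blast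
    then show "c u * u \<in> lspan E"
      using U(3) u E by (auto intro!: lspan_mult_left X_in_lspan)
  qed
next
  fix f assume f: "f \<in> lspan E"
  let ?c = "\<lambda>u. coef f (exponent_of l x u)"
  have "(\<Sum>u\<in>X ` supp f. ?c u * u) = (\<Sum>\<alpha>\<in>supp f. ?c (X \<alpha>) * X \<alpha>)"
    by (rule sum.reindex_cong[of X]) (auto intro: inj_on_subset[OF inj_mono supp_exponents])
  also have "\<dots> = (\<Sum>\<alpha>\<in>supp f. coef f \<alpha> * X \<alpha>)"
    by (rule sum.cong) (use supp_exponents[of f] in auto)
  also have "\<dots> = f" using expansion[of f] by simp
  finally have "f = (\<Sum>u\<in>X ` supp f. ?c u * u)" by simp
  moreover have "finite (X ` supp f)" "X ` supp f \<subseteq> X ` E" "?c \<in> X ` supp f \<rightarrow> R"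
    using f by (auto simp: finite_supp lspan_def coef_in_R)
  ultimately show "f \<in> left_span R (X ` E)"
    unfolding left_span_def mem_Collect_eq
    by (intro exI[of _ "X ` supp f"] exI[of _ ?c] conjI)
qed

text \<open>
  Over a finite-dimensional \<open>R\<close> this passes from left \<open>R\<close>-spans to subspaces over the ground field.
\<close>

lemma lspan_eq_span:
  assumes K: "R = span K"
  shows "lspan E = span {b * X \<alpha> | b \<alpha>. b \<in> K \<and> \<alpha> \<in> E \<inter> exponents l}"
    (is "_ = span ?B")
proof
  show "lspan E \<subseteq> span ?B"
  proof (rule lspan_subset)
    fix r \<alpha> assume r: "r \<in> R" and \<alpha>: "\<alpha> \<in> E" "\<alpha> \<in> exponents l"
    have "subspace {r. r * X \<alpha> \<in> span ?B}"
      by (rule subspaceI) (auto simp: span_zero distrib_right span_add scale_mult_left span_scale)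
    moreover have "K \<subseteq> {r. r * X \<alpha> \<in> span ?B}"
      using \<alpha> by (auto intro!: span_base)
    ultimately have "span K \<subseteq> {r. r * X \<alpha> \<in> span ?B}"
      by (intro span_minimal)
    then show "r * X \<alpha> \<in> span ?B" using r K by blast
  qed (auto intro: span_zero span_add)
  have "K \<subseteq> R" using K span_superset by blast
  then have "?B \<subseteq> lspan E" by (auto intro!: lspan_mult_left X_in_lspan)
  then show "span ?B \<subseteq> lspan E" by (intro span_minimal subspace_lspan)
qed

text \<open>
  The elements of degree less than \<open>t\<close>.  The strict bound makes \<open>below (tot_deg l \<alpha>)\<close> the space of
  terms of lower degree than \<open>X\<^sup>\<alpha>\<close>, also when this degree is 0; the elements of degree at most \<open>t\<close>
  are \<open>below (Suc t)\<close>.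
\<close>

abbreviation below :: "nat \<Rightarrow> 'a set" where
  "below t \<equiv> lspan {\<alpha>. tot_deg l \<alpha> < t}"

lemma in_below_ex: "\<exists>t. f \<in> below t"
proof -
  have "supp f \<subseteq> {\<alpha>. tot_deg l \<alpha> < Suc (Max (tot_deg l ` supp f))}"
    using finite_supp[of f] by (auto simp: less_Suc_eq_le)
  then show ?thesis unfolding lspan_def by blast
qed

lemma below_mono: "f \<in> below s \<Longrightarrow> s \<le> t \<Longrightarrow> f \<in> below t"
  by (erule lspan_mono[rotated]) auto

end

section \<open>Multiplication in a differential difference algebra\<close>

text \<open>
  The map is only assumed to be linear on \<open>V\<close>, so it is first replaced by a linear map \<open>g\<close> of the
  whole space that agrees with it on \<open>V\<close>.
\<close>

lemma (in vector_space) injective_endomorphism_surj: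
  assumes V: "subspace V" "V \<subseteq> span B" "finite B"
    and f: "f \<in> V \<rightarrow> V" "\<And>a b. a \<in> V \<Longrightarrow> b \<in> V \<Longrightarrow> f (a + b) = f a + f b"
      "\<And>c a. a \<in> V \<Longrightarrow> f (scale c a) = scale c (f a)"
    and inj: "inj_on f V"
  shows "f ` V = V"
proof -
  interpret vp: vector_space_pair scale scale ..
  obtain b where b: "b \<subseteq> V" "independent b" "V \<subseteq> span b"
    using maximal_independent_subset by metis
  have Vb: "V = span b" using b V(1) span_minimal by blast
  have fb: "finite b" using independent_span_bound[OF V(3) b(2)] b(1) V(2) by blast
  obtain g where g: "Vector_Spaces.linear scale scale g" "\<And>v. v \<in> b \<Longrightarrow> g v = f v"
    using vp.linear_independent_extend[OF b(2), of f] by blast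
  interpret g: Vector_Spaces.linear scale scale g by (rule g(1))
  have "subspace {v \<in> V. g v = f v}"
  proof (rule subspaceI)
    have "f 0 = 0" using f(3)[OF subspace_0[OF V(1)], of 0] by simp
    then show "0 \<in> {v \<in> V. g v = f v}" using subspace_0[OF V(1)] by (simp add: g.zero)
  qed (use V(1) f in \<open>auto simp: g.add g.scale subspace_add subspace_scale\<close>)
  then have "span b \<subseteq> {v \<in> V. g v = f v}"
    using b(1) g(2) by (intro span_minimal) auto
  then have gf: "g v = f v" if "v \<in> V" for v using that Vb by blast
  have "inj_on g (span b)" using inj gf Vb by (metis inj_on_cong)
  then have ind: "independent (g ` b)"
    by (rule vp.linear_independent_injective_image[OF g(1) b(2)])
  have card: "card (g ` b) = card b"
    using \<open>inj_on g (span b)\<close> by (intro card_image) (meson inj_on_subset span_superset)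
  have sub: "g ` b \<subseteq> V"
  proof (rule image_subsetI)
    fix v assume "v \<in> b"
    then have "v \<in> V" using b(1) by blast
    then show "g v \<in> V" using gf[of v] f(1) by auto
  qed
  have "V \<subseteq> span (g ` b)"
  proof
    fix v assume v: "v \<in> V"
    show "v \<in> span (g ` b)"
    proof (rule ccontr)
      \<comment> \<open>A vector missed by the image would extend the image of the basis \<open>b\<close> to an independent
        set with more elements than \<open>b\<close> inside the span of \<open>b\<close>.\<close>
      assume nv: "v \<notin> span (g ` b)"
      then have "independent (insert v (g ` b))" using ind by (simp add: independent_insert)
      then have "card (insert v (g ` b)) \<le> card b"
        using independent_span_bound[OF fb, of "insert v (g ` b)"] sub v Vb by blast
      moreover have "v \<notin> g ` b" using nv span_superset by blast
      ultimately show False using card fb by simp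
    qed
  qed
  also have "span (g ` b) = g ` span b"
    by (rule vp.linear_span_image[OF g(1)])
  finally have "V \<subseteq> f ` V" using gf Vb by auto
  then show ?thesis using f(1) by auto
qed

lemma (in k_algebra) subalgebra_subalgebra_generated: "subalgebra scale (subalgebra_generated scale H)"
  unfolding subalgebra_generated_def subalgebra_def by (auto intro!: subspace_Inter)

lemma (in k_algebra) subalgebra_generated_least:
  "subalgebra scale B \<Longrightarrow> H \<subseteq> B \<Longrightarrow> subalgebra_generated scale H \<subseteq> B"
  unfolding subalgebra_generated_def by blast

lemma (in k_algebra) subalgebra_generated_superset: "H \<subseteq> subalgebra_generated scale H"
  unfolding subalgebra_generated_def by blast

sublocale dd_algebra \<subseteq> left_monomial_basis scale R "m + n" "dd_gens m S D"
  by unfold_locales (rule subalgebra_R, rule basis)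

context dd_algebra
begin

abbreviation l where "l \<equiv> m + n"
abbreviation x where "x \<equiv> dd_gens m S D"
abbreviation RD where "RD \<equiv> subalgebra_generated scale (R \<union> D ` {..<n})"

lemma x_S: "i < m \<Longrightarrow> x i = S i"
  and x_D: "x (m + s) = D s"
  by (simp_all add: dd_gens_def)

lemma RD_subspace: "subspace RD"
  and RD_one: "1 \<in> RD"
  and RD_mult: "a \<in> RD \<Longrightarrow> b \<in> RD \<Longrightarrow> a * b \<in> RD"
  using subalgebra_subalgebra_generated[of "R \<union> D ` {..<n}"] by (auto simp: subalgebra_def)

lemma R_in_RD: "r \<in> R \<Longrightarrow> r \<in> RD"
  and D_in_RD: "s < n \<Longrightarrow> D s \<in> RD"
  using subalgebra_generated_superset[of "R \<union> D ` {..<n}"] by auto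

lemma sigma_RD:
  assumes "j < m"
  shows "bij_betw (\<sigma> j) RD RD" "\<sigma> j 1 = 1"
    "a \<in> RD \<Longrightarrow> b \<in> RD \<Longrightarrow> \<sigma> j (a + b) = \<sigma> j a + \<sigma> j b"
    "a \<in> RD \<Longrightarrow> \<sigma> j (scale c a) = scale c (\<sigma> j a)"
    "a \<in> RD \<Longrightarrow> b \<in> RD \<Longrightarrow> \<sigma> j (a * b) = \<sigma> j a * \<sigma> j b"
  using automorphism[OF assms] by (auto simp: algebra_automorphism_on_def)

lemma sigma_in_RD: "j < m \<Longrightarrow> a \<in> RD \<Longrightarrow> \<sigma> j a \<in> RD"
  using sigma_RD(1) bij_betwE by blast

lemma sigma_zero: "j < m \<Longrightarrow> \<sigma> j 0 = 0"
  using sigma_RD(4)[of j 0 0] subspace_0[OF RD_subspace] by simp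

lemma sigma_sum:
  assumes "j < m" "finite A" "\<And>a. a \<in> A \<Longrightarrow> f a \<in> RD"
  shows "\<sigma> j (sum f A) = (\<Sum>a\<in>A. \<sigma> j (f a))"
  using assms(2,3)
proof (induction A rule: finite_induct)
  case (insert a A)
  then show ?case
    using sigma_RD(3)[OF assms(1), of "f a" "sum f A"] subspace_sum[OF RD_subspace, of A f] by simp
qed (simp add: sigma_zero assms(1))

lemma sigma_R_bij: "j < m \<Longrightarrow> bij_betw (\<sigma> j) R R"
  using automorphism_R by (auto simp: algebra_automorphism_on_def)

lemma sigma_in_R: "j < m \<Longrightarrow> r \<in> R \<Longrightarrow> \<sigma> j r \<in> R"
  using sigma_R_bij bij_betwE by blast

lemma sigma_nonzero: "j < m \<Longrightarrow> r \<in> R \<Longrightarrow> r \<noteq> 0 \<Longrightarrow> \<sigma> j r \<noteq> 0"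
  using bij_betw_imp_inj_on[OF sigma_R_bij] sigma_zero R_zero by (metis inj_onD)

text \<open>
  The rules for \<open>r S\<^sub>j\<close> and \<open>D\<^sub>i S\<^sub>j\<close> say this for generators of \<open>R\<langle>D\<rangle>\<close>, and the elements that satisfy
  it form a subalgebra because \<open>\<sigma>\<^sub>j\<close> is a homomorphism.
\<close>

lemma RD_S:
  assumes j: "j < m" and b: "b \<in> RD"
  shows "b * S j = S j * \<sigma> j b"
proof -
  let ?B = "{b \<in> RD. b * S j = S j * \<sigma> j b}"
  have "subspace ?B"
    by (rule subspaceI)
      (auto simp: sigma_zero sigma_RD j subspace_0[OF RD_subspace] subspace_add[OF RD_subspace]
        subspace_scale[OF RD_subspace] distrib_left distrib_right scale_mult_left scale_mult_right)
  moreover have "a * b \<in> ?B" if "a \<in> ?B" "b \<in> ?B" for a b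
  proof -
    have "(a * b) * S j = a * (S j * \<sigma> j b)" using that by (simp add: mult.assoc)
    also have "\<dots> = (S j * \<sigma> j a) * \<sigma> j b" using that by (simp add: mult.assoc[symmetric])
    also have "\<dots> = S j * \<sigma> j (a * b)" using that sigma_RD(5)[OF j, of a b] by (simp add: mult.assoc)
    finally show ?thesis using that RD_mult by simp
  qed
  moreover have "1 \<in> ?B" using RD_one sigma_RD(2)[OF j] by simp
  ultimately have "subalgebra scale ?B" unfolding subalgebra_def by blast
  moreover have "R \<union> D ` {..<n} \<subseteq> ?B"
    using R_in_RD D_in_RD S_coeff[OF j] D_S[OF _ j] by auto
  ultimately have "RD \<subseteq> ?B" by (rule subalgebra_generated_least)
  then show ?thesis using b by blast
qed

lemma S_R_commute:
  assumes j: "j < m" and r: "r \<in> R"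
  obtains r' where "r' \<in> R" "S j * r = r' * S j" "r \<noteq> 0 \<Longrightarrow> r' \<noteq> 0"
proof -
  obtain r' where "r' \<in> R" "\<sigma> j r' = r"
    using bij_betw_imp_surj_on[OF sigma_R_bij[OF j]] r by (metis imageE)
  then show ?thesis using S_coeff[OF j, of r'] sigma_zero[OF j] by (intro that[of r']) auto
qed

lemma delta_in_R: "s < n \<Longrightarrow> r \<in> R \<Longrightarrow> \<delta> s r \<in> R"
  using derivation[of s] by (auto simp: derivation_on_def)

lemma gen_D: "m \<le> i \<Longrightarrow> i < l \<Longrightarrow> \<exists>s<n. i = m + s \<and> x i = D s"
  by (intro exI[of _ "i - m"]) (auto simp: dd_gens_def)

text \<open>
  Moving a coefficient across a generator replaces it by another coefficient up to a term without
  the generator, and never kills it.  The next lemma is the same in the other direction.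
\<close>

lemma x_coeff:
  assumes i: "i < l" and r: "r \<in> R"
  obtains r' s where "r' \<in> R" "s \<in> R" "x i * r = r' * x i + s" "r \<noteq> 0 \<Longrightarrow> r' \<noteq> 0"
proof (cases "i < m")
  case True
  obtain r' where "r' \<in> R" "S i * r = r' * S i" "r \<noteq> 0 \<Longrightarrow> r' \<noteq> 0"
    by (rule S_R_commute[OF True r]) blast
  then show ?thesis using True R_zero by (intro that[of r' 0]) (auto simp: x_S)
next
  case False
  then obtain s where "s < n" "x i = D s" using gen_D i by (metis not_less)
  then show ?thesis using r D_coeff delta_in_R by (intro that[of r "\<delta> s r"]) auto
qed

lemma coeff_x:
  assumes i: "i < l" and r: "r \<in> R"
  obtains r' s where "r' \<in> R" "s \<in> R" "r * x i = x i * r' + s" "r \<noteq> 0 \<Longrightarrow> r' \<noteq> 0"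
proof (cases "i < m")
  case True
  then show ?thesis
    using r R_zero S_coeff sigma_in_R sigma_nonzero by (intro that[of "\<sigma> i r" 0]) (auto simp: x_S)
next
  case False
  then obtain s where s: "s < n" "x i = D s" using gen_D i by (metis not_less)
  then have "r * x i = x i * r + - \<delta> s r" using D_coeff r by simp
  then show ?thesis using r s delta_in_R R_uminus by (intro that[of r "- \<delta> s r"]) auto
qed

lemma S_raise: "i < m \<Longrightarrow> S i * X \<alpha> = X (raise i \<alpha>)"
  using mono_at_raise[of i l \<alpha> x] S_commute by (simp add: x_S)

lemma D_raise:
  assumes "m \<le> i" "i < l" "\<And>j. j < m \<Longrightarrow> \<alpha> j = 0"
  shows "x i * X \<alpha> = X (raise i \<alpha>)"
proof (rule mono_at_raise[OF assms(2)])
  fix j assume j: "j < i" "\<alpha> j \<noteq> 0"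
  then have "m \<le> j" using assms(3) by (metis not_less)
  then show "x i * x j = x j * x i"
    using gen_D[of j] gen_D[of i] assms j D_commute by (metis less_trans)
qed

text \<open>
  The left \<open>R\<close>-span of the \<open>D\<^sub>s\<close>.  It is stable under every \<open>\<sigma>\<^sub>j\<close>, while a single \<open>D\<^sub>s\<close> need not be
  mapped to a multiple of itself; inductions over products of the \<open>S\<^sub>j\<close> need this larger set.
\<close>

definition linear_forms :: "'a set" where
  "linear_forms = {\<Sum>s<n. a s * D s | a. \<forall>s<n. a s \<in> R}"

lemma linear_forms_zero: "0 \<in> linear_forms"
  unfolding linear_forms_def by (auto intro!: exI[of _ "\<lambda>_. 0"] simp: R_zero)

lemma linear_forms_add: "d \<in> linear_forms \<Longrightarrow> d' \<in> linear_forms \<Longrightarrow> d + d' \<in> linear_forms"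
proof -
  assume "d \<in> linear_forms" "d' \<in> linear_forms"
  then obtain a a' where "d = (\<Sum>s<n. a s * D s)" "\<forall>s<n. a s \<in> R"
    "d' = (\<Sum>s<n. a' s * D s)" "\<forall>s<n. a' s \<in> R" by (auto simp: linear_forms_def)
  then show ?thesis unfolding linear_forms_def mem_Collect_eq
    by (intro exI[of _ "\<lambda>s. a s + a' s"]) (auto simp: distrib_right sum.distrib R_add)
qed

lemma linear_forms_mult: "r \<in> R \<Longrightarrow> d \<in> linear_forms \<Longrightarrow> r * d \<in> linear_forms"
proof -
  assume r: "r \<in> R" and "d \<in> linear_forms"
  then obtain a where "d = (\<Sum>s<n. a s * D s)" "\<forall>s<n. a s \<in> R" by (auto simp: linear_forms_def)
  then show ?thesis unfolding linear_forms_def mem_Collect_eq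
    using r by (intro exI[of _ "\<lambda>s. r * a s"]) (auto simp: sum_distrib_left mult.assoc R_mult)
qed

lemma linear_forms_sum: "(\<And>a. a \<in> A \<Longrightarrow> f a \<in> linear_forms) \<Longrightarrow> sum f A \<in> linear_forms"
  by (induction A rule: infinite_finite_induct) (auto intro: linear_forms_zero linear_forms_add)

lemma linear_forms_RD: "d \<in> linear_forms \<Longrightarrow> d \<in> RD"
  unfolding linear_forms_def by (auto intro!: subspace_sum[OF RD_subspace] intro: RD_mult R_in_RD D_in_RD)

lemma D_linear_form: "s < n \<Longrightarrow> D s \<in> linear_forms"
proof -
  assume s: "s < n"
  have "(\<Sum>t<n. (if t = s then 1 else 0) * D t) = (\<Sum>t<n. if t = s then D t else 0)"
    by (intro sum.cong) auto
  also have "\<dots> = D s" using s by simp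
  finally show ?thesis unfolding linear_forms_def mem_Collect_eq
    by (intro exI[of _ "\<lambda>t. if t = s then 1 else 0"]) (auto simp: R_one R_zero)
qed

lemma sigma_linear_form:
  assumes j: "j < m" and d: "d \<in> linear_forms"
  shows "\<sigma> j d \<in> linear_forms"
proof -
  obtain a where a: "d = (\<Sum>s<n. a s * D s)" "\<forall>s<n. a s \<in> R" using d by (auto simp: linear_forms_def)
  have "\<sigma> j d = (\<Sum>s<n. \<sigma> j (a s * D s))"
    unfolding a(1) using a(2) j by (intro sigma_sum) (auto intro: RD_mult R_in_RD D_in_RD)
  also have "\<dots> = (\<Sum>s<n. \<sigma> j (a s) * \<sigma> j (D s))"
    using a(2) j by (intro sum.cong refl sigma_RD(5)) (auto intro: R_in_RD D_in_RD)
  also have "\<dots> \<in> linear_forms"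
  proof (rule linear_forms_sum)
    fix s assume s: "s \<in> {..<n}"
    then have "\<sigma> j (D s) \<in> linear_forms"
      using automorphism_D[OF j, of s] unfolding linear_forms_def by auto
    then show "\<sigma> j (a s) * \<sigma> j (D s) \<in> linear_forms"
      using a(2) s j by (intro linear_forms_mult sigma_in_R) auto
  qed
  finally show ?thesis .
qed

lemma linear_form_pure_D:
  assumes d: "d \<in> linear_forms" and \<gamma>: "\<gamma> \<in> exponents l" "\<And>j. j < m \<Longrightarrow> \<gamma> j = 0"
  shows "d * X \<gamma> \<in> lspan {raise s \<gamma> | s. m \<le> s \<and> s < l}"
proof -
  obtain a where a: "d = (\<Sum>s<n. a s * D s)" "\<forall>s<n. a s \<in> R" using d by (auto simp: linear_forms_def)
  have "d * X \<gamma> = (\<Sum>s<n. a s * (D s * X \<gamma>))"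
    unfolding a(1) by (simp add: sum_distrib_right mult.assoc)
  also have "\<dots> \<in> lspan {raise s \<gamma> | s. m \<le> s \<and> s < l}"
  proof (rule lspan_sum)
    fix s assume s: "s \<in> {..<n}"
    have "D s * X \<gamma> = X (raise (m + s) \<gamma>)"
      using D_raise[of "m + s" \<gamma>] s \<gamma> by (simp add: x_D)
    moreover have "X (raise (m + s) \<gamma>) \<in> lspan {raise s \<gamma> | s. m \<le> s \<and> s < l}"
      using s \<gamma>(1) by (intro X_in_lspan) auto
    ultimately show "a s * (D s * X \<gamma>) \<in> lspan {raise s \<gamma> | s. m \<le> s \<and> s < l}"
      using a(2) s by (simp add: lspan_mult_left)
  qed
  finally show ?thesis .
qed

lemma S_mult_lspan:
  assumes i: "i < m" and f: "f \<in> lspan E"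
  shows "S i * f \<in> lspan (raise i ` E)"
proof (rule mult_lspan[OF _ f])
  fix r \<alpha> assume r: "r \<in> R" and \<alpha>: "\<alpha> \<in> E" "\<alpha> \<in> exponents l"
  obtain r' where r': "r' \<in> R" "S i * r = r' * S i" by (rule S_R_commute[OF i r]) blast
  have "S i * (r * X \<alpha>) = r' * (S i * X \<alpha>)"
    unfolding mult.assoc[symmetric] r'(2) ..
  also have "\<dots> = r' * X (raise i \<alpha>)" using S_raise[OF i] by simp
  also have "\<dots> \<in> lspan (raise i ` E)"
    using r' \<alpha> i by (intro lspan_mult_left X_in_lspan) auto
  finally show "S i * (r * X \<alpha>) \<in> lspan (raise i ` E)" .
qed

text \<open>
  A linear form passes each \<open>S\<^sub>i\<close> on its right and becomes another linear form, until only powers of the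
  \<open>D\<^sub>s\<close> are left, with which each \<open>D\<^sub>s\<close> commutes.
\<close>

lemma linear_form_mono:
  assumes "d \<in> linear_forms" "\<gamma> \<in> exponents l"
  shows "d * X \<gamma> \<in> lspan {raise s \<gamma> | s. m \<le> s \<and> s < l}"
  using assms(2,1)
proof (induction \<gamma> arbitrary: d rule: exponents_induct)
  case zero
  then show ?case by (intro linear_form_pure_D) auto
next
  case (raise i \<gamma>)
  show ?case
  proof (cases "i < m")
    case False
    then have "raise i \<gamma> j = 0" if "j < m" for j
      using raise(3)[of j] that by (simp add: raise_def)
    then show ?thesis using raise by (intro linear_form_pure_D) auto
  next
    case True
    have "d * X (raise i \<gamma>) = (d * S i) * X \<gamma>"
      unfolding S_raise[OF True, symmetric] by (simp only: mult.assoc)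
    also have "\<dots> = S i * (\<sigma> i d * X \<gamma>)"
      unfolding RD_S[OF True linear_forms_RD[OF raise(5)]] by (simp only: mult.assoc)
    also have "\<dots> \<in> lspan (raise i ` {raise s \<gamma> | s. m \<le> s \<and> s < l})"
      by (intro S_mult_lspan True raise(4) sigma_linear_form raise(5))
    also have "raise i ` {raise s \<gamma> | s. m \<le> s \<and> s < l} = {raise s (raise i \<gamma>) | s. m \<le> s \<and> s < l}"
      using raise_commute[of i _ \<gamma>] by (auto simp: image_iff) metis+
    finally show ?thesis .
  qed
qed

text \<open>
  This replaces the rule \<open>x\<^sub>i X\<^sup>\<gamma> = X\<^bsup>\<gamma> + e\<^sub>i\<^esup>\<close> of a commutative polynomial ring.  The product may involve
  other exponents \<open>\<gamma> + e\<^sub>s\<close>, but each of them has degree one more than \<open>\<gamma>\<close> and lies above \<open>\<gamma>\<close>.  The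
  degree filtration and the divisibility criterion depend on nothing else.
\<close>

lemma x_mono:
  assumes i: "i < l" and \<gamma>: "\<gamma> \<in> exponents l"
  shows "x i * X \<gamma> \<in> lspan {raise s \<gamma> | s. s < l}"
proof (cases "i < m")
  case True
  then show ?thesis using S_raise[OF True] \<gamma> i by (auto simp: x_S intro!: X_in_lspan)
next
  case False
  then obtain s where "s < n" "x i = D s" using gen_D i by (metis not_less)
  then have "x i * X \<gamma> \<in> lspan {raise s \<gamma> | s. m \<le> s \<and> s < l}"
    using linear_form_mono[OF D_linear_form \<gamma>] by simp
  then show ?thesis by (rule lspan_mono[rotated]) auto
qed

lemma x_mult_lspan:
  assumes i: "i < l" and f: "f \<in> lspan E"
    and closed: "\<And>\<alpha>. \<alpha> \<in> E \<Longrightarrow> \<alpha> \<in> exponents l \<Longrightarrow> \<alpha> \<in> E' \<and> (\<forall>s<l. raise s \<alpha> \<in> E')"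
  shows "x i * f \<in> lspan E'"
proof (rule mult_lspan[OF _ f])
  fix r \<alpha> assume r: "r \<in> R" and \<alpha>: "\<alpha> \<in> E" "\<alpha> \<in> exponents l"
  obtain r' s where r': "r' \<in> R" "s \<in> R" "x i * r = r' * x i + s" by (rule x_coeff[OF i r]) blast
  have "x i * (r * X \<alpha>) = (x i * r) * X \<alpha>" by (simp only: mult.assoc)
  also have "\<dots> = r' * (x i * X \<alpha>) + s * X \<alpha>" unfolding r'(3) by (simp only: distrib_right mult.assoc)
  also have "\<dots> \<in> lspan E'"
  proof -
    have "{raise s \<alpha> | s. s < l} \<subseteq> E'" using closed[OF \<alpha>] by blast
    then have "x i * X \<alpha> \<in> lspan E'" using x_mono[OF i \<alpha>(2)] by (rule lspan_mono)
    moreover have "X \<alpha> \<in> lspan E'" using closed[OF \<alpha>] \<alpha> by (intro X_in_lspan) auto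
    ultimately show ?thesis using r' by (simp add: lspan_add lspan_mult_left)
  qed
  finally show "x i * (r * X \<alpha>) \<in> lspan E'" .
qed

lemma X_raise_least: "i < l \<Longrightarrow> (\<And>j. j < i \<Longrightarrow> \<alpha> j = 0) \<Longrightarrow> X (raise i \<alpha>) = x i * X \<alpha>"
  by (rule mono_at_raise[symmetric]) auto

lemma mono_mult_below:
  assumes "\<gamma> \<in> exponents l" and f: "f \<in> below t"
  shows "X \<gamma> * f \<in> below (tot_deg l \<gamma> + t)"
  using assms(1)
proof (induction \<gamma> rule: exponents_induct)
  case (raise i \<gamma>)
  have "x i * (X \<gamma> * f) \<in> below (Suc (tot_deg l \<gamma> + t))"
    by (rule x_mult_lspan[OF raise(1,4)]) auto
  then show ?case
    using X_raise_least[of i \<gamma>] raise by (simp add: mult.assoc)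
qed (simp add: f)

text \<open>
  Multiplicativity of the filtration by degree: \<open>g\<close> has degree at most \<open>s\<close> and \<open>f\<close> degree less than
  \<open>t\<close>, hence the asymmetric bounds.
\<close>

lemma mult_below:
  assumes g: "g \<in> below (Suc s)" and f: "f \<in> below t"
  shows "g * f \<in> below (s + t)"
proof -
  have "below (Suc s) \<subseteq> {g. g * f \<in> below (s + t)}"
  proof (rule lspan_subset)
    fix r \<alpha> assume "r \<in> R" and \<alpha>: "\<alpha> \<in> {\<alpha>. tot_deg l \<alpha> < Suc s}" "\<alpha> \<in> exponents l"
    have "X \<alpha> * f \<in> below (s + t)"
      using mono_mult_below[OF \<alpha>(2) f] \<alpha>(1) by (auto intro: below_mono)
    then show "r * X \<alpha> \<in> {g. g * f \<in> below (s + t)}"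
      using \<open>r \<in> R\<close> by (simp add: mult.assoc lspan_mult_left)
  qed (auto simp: lspan_zero distrib_right lspan_add)
  then show ?thesis using g by blast
qed

text \<open>
  The left \<open>R\<close>-span of the monomials with exponent above \<open>\<beta>\<close> is a left ideal, since multiplication by
  generators only raises exponents.
\<close>

lemma mult_above:
  assumes f: "f \<in> lspan {\<alpha>. \<beta> \<le> \<alpha>}"
  shows "g * f \<in> lspan {\<alpha>. \<beta> \<le> \<alpha>}"
proof -
  have X: "X \<gamma> * f \<in> lspan {\<alpha>. \<beta> \<le> \<alpha>}" if "\<gamma> \<in> exponents l" for \<gamma>
    using that
  proof (induction \<gamma> rule: exponents_induct)
    case (raise i \<gamma>)
    have "x i * (X \<gamma> * f) \<in> lspan {\<alpha>. \<beta> \<le> \<alpha>}"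
      by (rule x_mult_lspan[OF raise(1,4)]) (auto intro: order_trans[OF _ le_raise])
    then show ?case
      using X_raise_least[of i \<gamma>] raise by (simp add: mult.assoc)
  qed (simp add: f)
  have "lspan UNIV \<subseteq> {g. g * f \<in> lspan {\<alpha>. \<beta> \<le> \<alpha>}}"
    by (rule lspan_subset) (auto simp: lspan_zero distrib_right lspan_add mult.assoc lspan_mult_left X)
  then show ?thesis by (auto simp: lspan_def)
qed

lemma right_divisible_monoD:
  assumes "right_divisible (X \<alpha>) (X \<beta>)" "\<alpha> \<in> exponents l" "\<beta> \<in> exponents l"
  shows "\<beta> \<le> \<alpha>"
proof -
  obtain h where "X \<alpha> = h * X \<beta>" using assms(1) by (auto simp: right_divisible_def)
  moreover have "h * X \<beta> \<in> lspan {\<alpha>. \<beta> \<le> \<alpha>}"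
    using assms(3) by (intro mult_above X_in_lspan) auto
  ultimately show ?thesis using X_in_lspanD[OF assms(2)] by auto
qed

text \<open>
  Left multiplication by \<open>S\<^sub>j\<close> shifts the support by \<open>e\<^sub>j\<close> and twists the coefficients by an injective
  map, here called \<open>\<tau>\<close>, so it raises the degree by exactly one.
\<close>

lemma S_cancel_below:
  assumes j: "j < m" and f: "S j * f \<in> below (Suc t)"
  shows "f \<in> below t"
proof -
  have "\<forall>r\<in>R. \<exists>r'. r' \<in> R \<and> S j * r = r' * S j \<and> (r \<noteq> 0 \<longrightarrow> r' \<noteq> 0)"
  proof
    fix r assume "r \<in> R"
    from S_R_commute[OF j this] show "\<exists>r'. r' \<in> R \<and> S j * r = r' * S j \<and> (r \<noteq> 0 \<longrightarrow> r' \<noteq> 0)"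
      by metis
  qed
  from bchoice[OF this] obtain \<tau> where \<tau>: "\<And>r. r \<in> R \<Longrightarrow> \<tau> r \<in> R" "\<And>r. r \<in> R \<Longrightarrow> S j * r = \<tau> r * S j"
    "\<And>r. r \<in> R \<Longrightarrow> r \<noteq> 0 \<Longrightarrow> \<tau> r \<noteq> 0" by metis
  have S_term: "S j * (coef f \<alpha> * X \<alpha>) = \<tau> (coef f \<alpha>) * X (raise j \<alpha>)" for \<alpha>
  proof -
    have "S j * (coef f \<alpha> * X \<alpha>) = (S j * coef f \<alpha>) * X \<alpha>" by (simp only: mult.assoc)
    also have "\<dots> = \<tau> (coef f \<alpha>) * (S j * X \<alpha>)"
      unfolding \<tau>(2)[OF coef_in_R] by (simp only: mult.assoc)
    finally show ?thesis unfolding S_raise[OF j] .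
  qed
  have "S j * f = (\<Sum>\<alpha>\<in>supp f. \<tau> (coef f \<alpha>) * X (raise j \<alpha>))"
    by (subst expansion[of f]) (simp add: sum_distrib_left S_term)
  then have "coef (S j * f) (raise j \<beta>) = (\<Sum>\<alpha>\<in>supp f. if \<alpha> = \<beta> then \<tau> (coef f \<alpha>) else 0)" for \<beta>
  proof -
    assume eq: "S j * f = (\<Sum>\<alpha>\<in>supp f. \<tau> (coef f \<alpha>) * X (raise j \<alpha>))"
    show ?thesis
      unfolding eq coef_sum
    proof (rule sum.cong[OF refl])
      fix \<alpha> assume "\<alpha> \<in> supp f"
      then have "raise j \<alpha> \<in> exponents l" using supp_exponents[of f] j by auto
      then show "coef (\<tau> (coef f \<alpha>) * X (raise j \<alpha>)) (raise j \<beta>) = (if \<alpha> = \<beta> then \<tau> (coef f \<alpha>) else 0)"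
        using coef_mono[of "raise j \<alpha>" "\<tau> (coef f \<alpha>)"] \<tau>(1)[OF coef_in_R, of f \<alpha>] injD[OF inj_raise, of j \<alpha> \<beta>]
        by auto
    qed
  qed
  then have "coef (S j * f) (raise j \<beta>) \<noteq> 0" if "\<beta> \<in> supp f" for \<beta>
    using that \<tau>(3)[OF coef_in_R, of f \<beta>] finite_supp by (simp add: supp_def)
  then have "raise j \<beta> \<in> {\<alpha>. tot_deg l \<alpha> < Suc t}" if "\<beta> \<in> supp f" for \<beta>
    using that f by (auto simp: lspan_def supp_def)
  then show ?thesis using j by (auto simp: lspan_def)
qed

text \<open>
  \<open>S\<^sub>j \<sigma>\<^sub>j(f) = f S\<^sub>j\<close> has degree at most one more than \<open>f\<close>, and cancelling \<open>S\<^sub>j\<close> lowers the degree by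
  one again.
\<close>

lemma sigma_below:
  assumes j: "j < m" and f: "f \<in> RD" "f \<in> below t"
  shows "\<sigma> j f \<in> below t"
proof (cases t)
  case 0
  then have "f = 0" using f(2) supp_empty_iff by (auto simp: lspan_def)
  then show ?thesis using sigma_zero[OF j] lspan_zero by simp
next
  case (Suc s)
  have "S j = X (raise j (\<lambda>_. 0))" using S_raise[OF j, of "\<lambda>_. 0"] by simp
  then have "S j \<in> below (Suc 1)" using j by (auto intro!: X_in_lspan)
  then have "f * S j \<in> below (s + Suc 1)" using f(2) Suc by (intro mult_below) simp
  then have "S j * \<sigma> j f \<in> below (Suc t)" using RD_S[OF j f(1)] Suc by simp
  then show ?thesis by (rule S_cancel_below[OF j])
qed

section \<open>Right divisibility of monomials\<close>


definition pure_S :: "(nat \<Rightarrow> nat) \<Rightarrow> bool" where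
  "pure_S \<alpha> \<longleftrightarrow> (\<forall>j\<ge>m. \<alpha> j = 0)"

definition pure_D :: "(nat \<Rightarrow> nat) \<Rightarrow> bool" where
  "pure_D \<alpha> \<longleftrightarrow> (\<forall>j<m. \<alpha> j = 0)"

lemma pure_S_raise: "pure_S (raise i \<alpha>) \<Longrightarrow> i < m \<and> pure_S \<alpha>"
  unfolding pure_S_def raise_def by (metis fun_upd_apply nat.distinct(1) not_less)

lemma pure_D_raise: "pure_D (raise i \<alpha>) \<Longrightarrow> m \<le> i \<and> pure_D \<alpha>"
  unfolding pure_D_def raise_def by (metis fun_upd_apply nat.distinct(1) not_less)

lemma S_mono_mult:
  assumes "a \<in> exponents l" "pure_S a"
  shows "X a * X \<gamma> = X (\<lambda>i. a i + \<gamma> i)"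
  using assms
proof (induction a rule: exponents_induct)
  case (raise i a)
  then have i: "i < m" "pure_S a" using pure_S_raise by blast+
  have "X (raise i a) * X \<gamma> = S i * (X a * X \<gamma>)"
    unfolding S_raise[OF i(1), symmetric] by (simp only: mult.assoc)
  also have "\<dots> = X (raise i (\<lambda>i. a i + \<gamma> i))"
    using raise(4)[OF i(2)] S_raise[OF i(1)] by simp
  also have "raise i (\<lambda>i. a i + \<gamma> i) = (\<lambda>j. raise i a j + \<gamma> j)"
    by (auto simp: raise_def)
  finally show ?case .
qed simp

lemma D_mono_mult:
  assumes "a \<in> exponents l" "pure_D a" and \<gamma>: "pure_D \<gamma>"
  shows "X a * X \<gamma> = X (\<lambda>i. a i + \<gamma> i)"
  using assms(1,2)
proof (induction a rule: exponents_induct)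
  case (raise i a)
  then have i: "m \<le> i" "pure_D a" using pure_D_raise by blast+
  have "X (raise i a) * X \<gamma> = x i * (X a * X \<gamma>)"
    using X_raise_least[of i a] raise by (simp add: mult.assoc)
  also have "\<dots> = x i * X (\<lambda>i. a i + \<gamma> i)"
    using raise(4)[OF i(2)] by simp
  also have "\<dots> = X (raise i (\<lambda>i. a i + \<gamma> i))"
    using i(2) \<gamma> by (intro D_raise[OF i(1) raise(1)]) (simp add: pure_D_def)
  also have "raise i (\<lambda>i. a i + \<gamma> i) = (\<lambda>j. raise i a j + \<gamma> j)"
    by (auto simp: raise_def)
  finally show ?case .
qed simp

lemma D_mono_in_RD:
  assumes "\<kappa> \<in> exponents l" "pure_D \<kappa>"
  shows "X \<kappa> \<in> RD"
  using assms
proof (induction \<kappa> rule: exponents_induct)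
  case (raise i \<kappa>)
  then have i: "m \<le> i" "pure_D \<kappa>" using pure_D_raise by blast+
  then have "x i \<in> RD" using gen_D[OF i(1) raise(1)] D_in_RD by auto
  then show ?case
    using X_raise_least[of i \<kappa>] raise i(2) RD_mult by simp
qed (simp add: RD_one)

definition S_part :: "(nat \<Rightarrow> nat) \<Rightarrow> nat \<Rightarrow> nat" where
  "S_part \<alpha> = (\<lambda>i. if i < m then \<alpha> i else 0)"

definition D_part :: "(nat \<Rightarrow> nat) \<Rightarrow> nat \<Rightarrow> nat" where
  "D_part \<alpha> = (\<lambda>i. if i < m then 0 else \<alpha> i)"

lemma mono_split:
  assumes "\<alpha> \<in> exponents l"
  shows "X \<alpha> = X (S_part \<alpha>) * X (D_part \<alpha>)"
proof -
  have "X (S_part \<alpha>) * X (D_part \<alpha>) = X (\<lambda>i. S_part \<alpha> i + D_part \<alpha> i)"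
    using assms by (intro S_mono_mult) (auto simp: S_part_def pure_S_def exponents_def)
  also have "(\<lambda>i. S_part \<alpha> i + D_part \<alpha> i) = \<alpha>" by (auto simp: S_part_def D_part_def)
  finally show ?thesis ..
qed

text \<open>
  Each generator exchanges places with a coefficient up to a term of degree 0, so a whole monomial
  does so up to terms of lower degree.  This lemma and the next one cover the two directions.
\<close>

lemma mono_coeff_exchange:
  assumes "\<alpha> \<in> exponents l" "r \<in> R"
  shows "\<exists>r'\<in>R. (r \<noteq> 0 \<longrightarrow> r' \<noteq> 0) \<and> X \<alpha> * r - r' * X \<alpha> \<in> below (tot_deg l \<alpha>)"
  using assms(1)
proof (induction \<alpha> rule: exponents_induct)
  case zero
  show ?case using assms(2) by (intro bexI[of _ r]) (auto simp: lspan_zero)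
next
  case (raise i \<alpha>)
  let ?t = "tot_deg l \<alpha>"
  obtain r1 where r1: "r1 \<in> R" "r \<noteq> 0 \<Longrightarrow> r1 \<noteq> 0" "X \<alpha> * r - r1 * X \<alpha> \<in> below ?t"
    using raise by blast
  obtain r2 s where r2: "r2 \<in> R" "s \<in> R" "x i * r1 = r2 * x i + s" "r1 \<noteq> 0 \<Longrightarrow> r2 \<noteq> 0"
    by (rule x_coeff[OF raise(1) r1(1)]) blast
  have X: "X (raise i \<alpha>) = x i * X \<alpha>" using X_raise_least[of i \<alpha>] raise by simp
  have "X (raise i \<alpha>) * r - r2 * X (raise i \<alpha>) = x i * (X \<alpha> * r - r1 * X \<alpha>) + (x i * r1) * X \<alpha> - r2 * (x i * X \<alpha>)"
    unfolding X by (simp add: algebra_simps)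
  also have "\<dots> = x i * (X \<alpha> * r - r1 * X \<alpha>) + s * X \<alpha>"
    unfolding r2(3) by (simp add: algebra_simps)
  also have "\<dots> \<in> below (Suc ?t)"
  proof (rule lspan_add)
    show "x i * (X \<alpha> * r - r1 * X \<alpha>) \<in> below (Suc ?t)"
      by (rule x_mult_lspan[OF raise(1) r1(3)]) auto
    show "s * X \<alpha> \<in> below (Suc ?t)"
      using raise(2) r2(2) by (intro lspan_mult_left X_in_lspan) auto
  qed
  finally show ?case
    using r1 r2 raise(1) by (intro bexI[of _ r2]) auto
qed

lemma coeff_mono_exchange:
  assumes "\<alpha> \<in> exponents l" "r \<in> R"
  shows "\<exists>r'\<in>R. (r \<noteq> 0 \<longrightarrow> r' \<noteq> 0) \<and> r * X \<alpha> - X \<alpha> * r' \<in> below (tot_deg l \<alpha>)"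
  using assms
proof (induction \<alpha> arbitrary: r rule: exponents_induct)
  case zero
  then show ?case by (intro bexI[of _ r]) (auto simp: lspan_zero)
next
  case (raise i \<alpha>)
  let ?t = "tot_deg l \<alpha>"
  obtain r1 s where r1: "r1 \<in> R" "s \<in> R" "r * x i = x i * r1 + s" "r \<noteq> 0 \<Longrightarrow> r1 \<noteq> 0"
    by (rule coeff_x[OF raise(1) raise(5)]) blast
  obtain r2 where r2: "r2 \<in> R" "r1 \<noteq> 0 \<Longrightarrow> r2 \<noteq> 0" "r1 * X \<alpha> - X \<alpha> * r2 \<in> below ?t"
    using raise(4)[OF r1(1)] by blast
  have X: "X (raise i \<alpha>) = x i * X \<alpha>" using X_raise_least[of i \<alpha>] raise by simp
  have "r * X (raise i \<alpha>) - X (raise i \<alpha>) * r2 = (r * x i) * X \<alpha> - x i * (X \<alpha> * r2)"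
    unfolding X by (simp add: mult.assoc)
  also have "\<dots> = x i * (r1 * X \<alpha> - X \<alpha> * r2) + s * X \<alpha>"
    unfolding r1(3) by (simp add: algebra_simps)
  also have "\<dots> \<in> below (Suc ?t)"
  proof (rule lspan_add)
    show "x i * (r1 * X \<alpha> - X \<alpha> * r2) \<in> below (Suc ?t)"
      by (rule x_mult_lspan[OF raise(1) r2(3)]) auto
    show "s * X \<alpha> \<in> below (Suc ?t)"
      using raise(2) r1(2) by (intro lspan_mult_left X_in_lspan) auto
  qed
  finally show ?case
    using r1 r2 raise(1) by (intro bexI[of _ r2]) auto
qed

text \<open>
  A coefficient inserted between \<open>h\<close> and \<open>X\<^sup>\<beta>\<close> changes \<open>h X\<^sup>\<beta> = X\<^sup>\<alpha>\<close> only by a nonzero coefficient and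
  terms of lower degree: move it to the right of \<open>X\<^sup>\<beta>\<close>, then back to the left of \<open>X\<^sup>\<alpha>\<close>.  The degree
  bound on \<open>h\<close> keeps the error terms of the first exchange below \<open>X\<^sup>\<alpha>\<close>.
\<close>

lemma left_factor_coeff_leading:
  assumes \<alpha>: "\<alpha> \<in> exponents l" and \<beta>: "\<beta> \<in> exponents l" and le: "tot_deg l \<beta> \<le> tot_deg l \<alpha>"
    and h: "h * X \<beta> = X \<alpha>" "h \<in> below (Suc (tot_deg l \<alpha> - tot_deg l \<beta>))"
    and r: "r \<in> R" "r \<noteq> 0"
  obtains r' where "r' \<in> R" "r' \<noteq> 0" "h * (r * X \<beta>) - r' * X \<alpha> \<in> below (tot_deg l \<alpha>)"
proof -
  obtain r1 where r1: "r1 \<in> R" "r1 \<noteq> 0" "r * X \<beta> - X \<beta> * r1 \<in> below (tot_deg l \<beta>)"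
    using coeff_mono_exchange[OF \<beta> r(1)] r(2) by blast
  obtain r2 where r2: "r2 \<in> R" "r2 \<noteq> 0" "X \<alpha> * r1 - r2 * X \<alpha> \<in> below (tot_deg l \<alpha>)"
    using mono_coeff_exchange[OF \<alpha> r1(1)] r1(2) by blast
  have "h * (r * X \<beta>) - r2 * X \<alpha> = h * (r * X \<beta> - X \<beta> * r1) + ((h * X \<beta>) * r1 - r2 * X \<alpha>)"
    by (simp add: algebra_simps)
  also have "\<dots> = h * (r * X \<beta> - X \<beta> * r1) + (X \<alpha> * r1 - r2 * X \<alpha>)"
    unfolding h(1) ..
  also have "\<dots> \<in> below (tot_deg l \<alpha>)"
    using mult_below[OF h(2) r1(3)] r2(3) le by (intro lspan_add) simp_all
  finally show ?thesis using r2 that by blast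
qed

end

locale dd_algebra_finite = dd_algebra +
  assumes finite_extension: "finite_field_extension scale R"
begin

lemma R_inverse:
  assumes "a \<in> R" "a \<noteq> 0"
  obtains b where "b \<in> R" "b * a = 1"
proof -
  obtain b where "b \<in> R" "a * b = 1"
    using finite_extension assms unfolding finite_field_extension_def by blast
  moreover from this have "b * a = a * b"
    using finite_extension assms unfolding finite_field_extension_def by blast
  ultimately show ?thesis using that by simp
qed

lemma R_basis:
  obtains K where "finite K" "independent K" "R = span K" "K \<noteq> {}"
proof -
  obtain B where B: "finite B" "R = span B"
    using finite_extension by (auto simp: finite_field_extension_def fin_dim_subspace_def)
  obtain K where K: "K \<subseteq> B" "independent K" "B \<subseteq> span K"
    using maximal_independent_subset[of B] by blast
  have "K \<subseteq> span B" using K(1) span_superset[of B] by (rule subset_trans)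
  then have "span K = span B" using K(3) by (simp add: span_eq)
  moreover have "K \<noteq> {}"
  proof
    assume "K = {}"
    then have "R = {0}" using B \<open>span K = span B\<close> by simp
    then show False using R_one by simp
  qed
  moreover have "finite K" using finite_subset[OF K(1) B(1)] .
  ultimately show ?thesis using that[of K] K(2) B(2) by simp
qed

lemma below_finite_dim:
  obtains B where "finite B" "below t = span B"
proof -
  obtain K where K: "finite K" "R = span K" by (rule R_basis)
  have "finite {\<alpha> \<in> exponents l. tot_deg l \<alpha> < t}"
    by (rule finite_subset[OF _ finite_exponents_total[of l t]]) auto
  then have "finite ((\<lambda>(b, \<alpha>). b * X \<alpha>) ` (K \<times> {\<alpha> \<in> exponents l. tot_deg l \<alpha> < t}))"
    using K(1) by blast
  moreover have "(\<lambda>(b, \<alpha>). b * X \<alpha>) ` (K \<times> {\<alpha> \<in> exponents l. tot_deg l \<alpha> < t}) =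
      {b * X \<alpha> | b \<alpha>. b \<in> K \<and> \<alpha> \<in> {\<alpha>. tot_deg l \<alpha> < t} \<inter> exponents l}"
    by auto
  ultimately show ?thesis
    using that[of "(\<lambda>(b, \<alpha>). b * X \<alpha>) ` (K \<times> {\<alpha> \<in> exponents l. tot_deg l \<alpha> < t})"]
    unfolding lspan_eq_span[OF K(2)] by simp
qed

text \<open>
  That \<open>\<sigma>\<^sub>j\<close> is an automorphism of \<open>R\<langle>D\<rangle>\<close> provides preimages but no bound on their degree.  The bound
  comes from finite dimension: \<open>\<sigma>\<^sub>j\<close> is injective on the elements of bounded degree and does not raise
  the degree.
\<close>

lemma sigma_surj_below:
  assumes j: "j < m"
  shows "\<sigma> j ` (RD \<inter> below t) = RD \<inter> below t"
proof -
  obtain B where B: "finite B" "below t = span B" by (rule below_finite_dim)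
  have "inj_on (\<sigma> j) (RD \<inter> below t)"
    using bij_betw_imp_inj_on[OF sigma_RD(1)[OF j]] by (rule inj_on_subset) blast
  moreover have "subspace (RD \<inter> below t)"
    using RD_subspace subspace_lspan by (rule subspace_inter)
  ultimately show ?thesis
  proof (intro injective_endomorphism_surj[of _ B])
    show "\<sigma> j \<in> RD \<inter> below t \<rightarrow> RD \<inter> below t"
      using sigma_in_RD[OF j] sigma_below[OF j] by blast
  qed (use B sigma_RD(3,4)[OF j] in blast)+
qed

text \<open>
  An element of \<open>R\<langle>D\<rangle>\<close> to the right of a product of the \<open>S\<^sub>j\<close> can be moved to its left without raising
  its degree, by inverting \<open>\<sigma>\<^sub>j\<close> once for each factor.
\<close>

lemma RD_S_mono_exchange:
  assumes "\<beta> \<in> exponents l" "pure_S \<beta>" "f \<in> RD \<inter> below t"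
  shows "\<exists>h \<in> RD \<inter> below t. h * X \<beta> = X \<beta> * f"
  using assms
proof (induction \<beta> rule: exponents_induct)
  case (raise i \<beta>)
  then have i: "i < m" "pure_S \<beta>" using pure_S_raise by blast+
  obtain h1 where h1: "h1 \<in> RD \<inter> below t" "h1 * X \<beta> = X \<beta> * f"
    using raise i(2) by blast
  have "h1 \<in> \<sigma> i ` (RD \<inter> below t)"
    unfolding sigma_surj_below[OF i(1)] by (rule h1(1))
  then obtain h where h: "h \<in> RD \<inter> below t" "\<sigma> i h = h1"
    by (elim imageE) simp
  have "h * X (raise i \<beta>) = (h * S i) * X \<beta>"
    unfolding S_raise[OF i(1), symmetric] by (simp only: mult.assoc)
  also have "\<dots> = S i * (h1 * X \<beta>)"
    using RD_S[OF i(1), of h] h by (simp add: mult.assoc)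
  also have "\<dots> = X (raise i \<beta>) * f"
    unfolding S_raise[OF i(1), symmetric] h1(2) by (simp only: mult.assoc)
  finally show ?case using h(1) by blast
qed auto

text \<open>
  The quotient of \<open>X\<^sup>\<alpha>\<close> by \<open>X\<^sup>\<beta>\<close>.  The excess of \<open>S\<close>-factors can stay on the left of \<open>X\<^sup>\<beta>\<close>; the excess
  of \<open>D\<close>-factors belongs in the middle, between the two parts of \<open>X\<^sup>\<beta>\<close>, and is moved to the left across
  the \<open>S\<close>-part.  So \<open>h\<close> is in general not a monomial.
\<close>

lemma mono_left_factor:
  assumes \<alpha>: "\<alpha> \<in> exponents l" and \<beta>: "\<beta> \<in> exponents l" and le: "\<beta> \<le> \<alpha>"
  obtains h where "h * X \<beta> = X \<alpha>" "h \<in> below (Suc (tot_deg l \<alpha> - tot_deg l \<beta>))"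
proof -
  let ?\<delta> = "\<lambda>i. \<alpha> i - \<beta> i"
  have le': "\<beta> i \<le> \<alpha> i" for i using le by (simp add: le_fun_def)
  have \<delta>: "?\<delta> \<in> exponents l" using \<alpha> by (auto simp: exponents_def)
  have parts: "S_part \<gamma> \<in> exponents l" "D_part \<gamma> \<in> exponents l" "pure_S (S_part \<gamma>)" "pure_D (D_part \<gamma>)"
    if "\<gamma> \<in> exponents l" for \<gamma>
    using that by (auto simp: S_part_def D_part_def pure_S_def pure_D_def exponents_def)
  have D\<delta>: "X (D_part ?\<delta>) \<in> RD \<inter> below (Suc (tot_deg l (D_part ?\<delta>)))"
    using parts[OF \<delta>] D_mono_in_RD by (auto intro!: X_in_lspan)
  obtain h0 where h0: "h0 \<in> RD \<inter> below (Suc (tot_deg l (D_part ?\<delta>)))"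
    "h0 * X (S_part \<beta>) = X (S_part \<beta>) * X (D_part ?\<delta>)"
    using RD_S_mono_exchange[OF parts(1,3)[OF \<beta>] D\<delta>] by blast
  let ?h = "X (S_part ?\<delta>) * h0"
  have "?h * X \<beta> = X (S_part ?\<delta>) * (h0 * X (S_part \<beta>)) * X (D_part \<beta>)"
    unfolding mono_split[OF \<beta>] by (simp only: mult.assoc)
  also have "\<dots> = (X (S_part ?\<delta>) * X (S_part \<beta>)) * (X (D_part ?\<delta>) * X (D_part \<beta>))"
    unfolding h0(2) by (simp only: mult.assoc)
  also have "X (S_part ?\<delta>) * X (S_part \<beta>) = X (S_part \<alpha>)"
    unfolding S_mono_mult[OF parts(1,3)[OF \<delta>]]
    by (rule arg_cong[where f = X]) (auto simp: S_part_def le')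
  also have "X (D_part ?\<delta>) * X (D_part \<beta>) = X (D_part \<alpha>)"
    unfolding D_mono_mult[OF parts(2,4)[OF \<delta>] parts(4)[OF \<beta>]]
    by (rule arg_cong[where f = X]) (auto simp: D_part_def le')
  also have "X (S_part \<alpha>) * X (D_part \<alpha>) = X \<alpha>" using mono_split[OF \<alpha>] ..
  finally have "?h * X \<beta> = X \<alpha>" .
  moreover have "?h \<in> below (Suc (tot_deg l \<alpha> - tot_deg l \<beta>))"
  proof -
    have "tot_deg l (S_part ?\<delta>) + tot_deg l (D_part ?\<delta>) = tot_deg l ?\<delta>"
      unfolding tot_deg_def sum.distrib[symmetric] by (rule sum.cong) (auto simp: S_part_def D_part_def)
    also have "\<dots> = tot_deg l \<alpha> - tot_deg l \<beta>"
      unfolding tot_deg_def by (rule sum_subtractf_nat) (rule le')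
    finally show ?thesis
      using mono_mult_below[OF parts(1)[OF \<delta>], of h0 "Suc (tot_deg l (D_part ?\<delta>))"] h0(1) by simp
  qed
  ultimately show ?thesis by (rule that)
qed

lemma right_divisible_mono_iff:
  assumes "\<alpha> \<in> exponents l" "\<beta> \<in> exponents l"
  shows "right_divisible (X \<alpha>) (X \<beta>) \<longleftrightarrow> \<beta> \<le> \<alpha>"
proof
  assume "\<beta> \<le> \<alpha>"
  from mono_left_factor[OF assms this] show "right_divisible (X \<alpha>) (X \<beta>)"
    unfolding right_divisible_def by metis
qed (rule right_divisible_monoD[OF _ assms])

end

section \<open>Normal forms modulo a left ideal\<close>

text \<open>
  The hypotheses of the theorem on the ideal, the ordering and the basis.
\<close>

locale dd_groebner = dd_algebra_finite +
  fixes ord :: "'b rel" and I G :: "'b set"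
  assumes ideal: "left_ideal I" and proper: "I \<noteq> UNIV"
    and monomial_ord: "dd_monomial_ordering R (m + n) (dd_gens m S D) ord"
    and degree_ord: "total_degree_ordering (m + n) (dd_gens m S D) ord"
    and finite_G: "finite G" and GS: "left_GS_basis R (m + n) (dd_gens m S D) ord I G"
begin

sublocale left_ideal_quotient scale I
  by unfold_locales (rule ideal)

abbreviation lead :: "'b \<Rightarrow> 'b" where "lead \<equiv> lm R l x ord"

lemma X_monomial: "\<alpha> \<in> exponents l \<Longrightarrow> X \<alpha> \<in> monomials l x"
  by (simp add: monomials_def)

lemma ord_wf: "wf (ord - Id)"
  and ord_antisym: "(u, v) \<in> ord \<Longrightarrow> (v, u) \<in> ord \<Longrightarrow> u = v"
  and ord_trans: "(u, v) \<in> ord \<Longrightarrow> (v, w) \<in> ord \<Longrightarrow> (u, w) \<in> ord"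
  and ord_total: "u \<in> monomials l x \<Longrightarrow> v \<in> monomials l x \<Longrightarrow> (u, v) \<in> ord \<or> (v, u) \<in> ord"
proof -
  have wo: "well_order_on (monomials l x) ord"
    using monomial_ord unfolding dd_monomial_ordering_def by blast
  then show "wf (ord - Id)" by (simp add: well_order_on_def)
  have lin: "refl_on (monomials l x) ord" "trans ord" "antisym ord" "total_on (monomials l x) ord"
    using wo by (auto simp: well_order_on_def linear_order_on_def partial_order_on_def preorder_on_def)
  show "(u, v) \<in> ord \<Longrightarrow> (v, u) \<in> ord \<Longrightarrow> u = v" using lin(3) by (rule antisymD)
  show "(u, v) \<in> ord \<Longrightarrow> (v, w) \<in> ord \<Longrightarrow> (u, w) \<in> ord" using lin(2) by (rule transD)
  show "(u, v) \<in> ord \<or> (v, u) \<in> ord" if "u \<in> monomials l x" "v \<in> monomials l x"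
  proof (cases "u = v")
    case True
    then show ?thesis using refl_onD[OF lin(1) that(1)] by simp
  next
    case False
    then show ?thesis using lin(4)[unfolded total_on_def, rule_format, OF that] by simp
  qed
qed

lemma ord_degree: "\<alpha> \<in> exponents l \<Longrightarrow> \<beta> \<in> exponents l \<Longrightarrow> tot_deg l \<beta> < tot_deg l \<alpha> \<Longrightarrow> (X \<beta>, X \<alpha>) \<in> ord - Id"
  using degree_ord[unfolded total_degree_ordering_def, rule_format, of "X \<alpha>" "X \<beta>"]
    X_monomial[of \<alpha>] X_monomial[of \<beta>] by simp

lemma ord_degree_le:
  assumes "\<alpha> \<in> exponents l" "\<beta> \<in> exponents l" "(X \<beta>, X \<alpha>) \<in> ord"
  shows "tot_deg l \<beta> \<le> tot_deg l \<alpha>"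
proof (rule ccontr)
  assume "\<not> tot_deg l \<beta> \<le> tot_deg l \<alpha>"
  then have "(X \<alpha>, X \<beta>) \<in> ord - Id" using ord_degree assms by simp
  then show False using ord_antisym assms(3) by blast
qed

lemma ord_mult:
  assumes "\<alpha> \<in> exponents l" "\<beta> \<in> exponents l" "(X \<beta>, X \<alpha>) \<in> ord - Id" "f \<noteq> 0"
  shows "(lead (f * X \<beta>), lead (f * X \<alpha>)) \<in> ord - Id"
  by (rule monomial_ord[unfolded dd_monomial_ordering_def, THEN conjunct2, rule_format,
        OF X_monomial[OF assms(1)] X_monomial[OF assms(2)] assms(3,4)])

lemma lead_eqI:
  assumes "\<alpha> \<in> supp f" "\<And>\<beta>. \<beta> \<in> supp f \<Longrightarrow> (X \<beta>, X \<alpha>) \<in> ord"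
  shows "lead f = X \<alpha>"
  unfolding lm_def mono_support_eq
proof (rule the_equality)
  show "X \<alpha> \<in> X ` supp f \<and> (\<forall>v\<in>X ` supp f. (v, X \<alpha>) \<in> ord)" using assms by blast
  fix u assume "u \<in> X ` supp f \<and> (\<forall>v\<in>X ` supp f. (v, u) \<in> ord)"
  then show "u = X \<alpha>" using assms ord_antisym by blast
qed

lemma lead_exponent:
  assumes "f \<noteq> 0"
  obtains \<alpha> where "\<alpha> \<in> supp f" "lead f = X \<alpha>" "\<And>\<beta>. \<beta> \<in> supp f \<Longrightarrow> (X \<beta>, X \<alpha>) \<in> ord"
proof -
  have "\<exists>\<alpha>\<in>A. \<forall>\<beta>\<in>A. (X \<beta>, X \<alpha>) \<in> ord" if "finite A" "A \<noteq> {}" "A \<subseteq> exponents l" for A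
    using that
  proof (induction A rule: finite_ne_induct)
    case (singleton \<alpha>)
    then show ?case using ord_total X_monomial by blast
  next
    case (insert \<gamma> A)
    then obtain \<alpha> where \<alpha>: "\<alpha> \<in> A" "\<forall>\<beta>\<in>A. (X \<beta>, X \<alpha>) \<in> ord" by blast
    have mon: "X \<alpha> \<in> monomials l x" "X \<gamma> \<in> monomials l x" using \<alpha> insert.prems X_monomial by blast+
    show ?case
    proof (cases "(X \<gamma>, X \<alpha>) \<in> ord")
      case True
      then show ?thesis using \<alpha> by blast
    next
      case False
      then have "(X \<alpha>, X \<gamma>) \<in> ord" using ord_total[OF mon] by blast
      then have "\<forall>\<beta>\<in>insert \<gamma> A. (X \<beta>, X \<gamma>) \<in> ord"
        using \<alpha>(2) ord_trans ord_total[OF mon(2) mon(2)] by blast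
      then show ?thesis by blast
    qed
  qed
  then obtain \<alpha> where "\<alpha> \<in> supp f" "\<forall>\<beta>\<in>supp f. (X \<beta>, X \<alpha>) \<in> ord"
    using finite_supp supp_exponents supp_empty_iff assms by metis
  then show ?thesis using that lead_eqI by blast
qed

lemma lead_of_top_degree:
  assumes \<alpha>: "\<alpha> \<in> exponents l" and r: "r \<in> R" "r \<noteq> 0" and f: "f - r * X \<alpha> \<in> below (tot_deg l \<alpha>)"
  shows "lead f = X \<alpha>"
proof (rule lead_eqI)
  have coef: "coef f \<beta> = coef (f - r * X \<alpha>) \<beta> + (if \<beta> = \<alpha> then r else 0)" for \<beta>
    using coef_add[of "f - r * X \<alpha>" "r * X \<alpha>" \<beta>] coef_mono[OF \<alpha> r(1)] by simp
  have low: "tot_deg l \<beta> < tot_deg l \<alpha>" if "coef (f - r * X \<alpha>) \<beta> \<noteq> 0" for \<beta>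
    using f that by (auto simp: lspan_def supp_def)
  have "coef (f - r * X \<alpha>) \<alpha> = 0" using low by blast
  then show \<alpha>f: "\<alpha> \<in> supp f" using coef[of \<alpha>] r(2) by (simp add: supp_def)
  fix \<beta> assume \<beta>: "\<beta> \<in> supp f"
  show "(X \<beta>, X \<alpha>) \<in> ord"
  proof (cases "\<beta> = \<alpha>")
    case True
    then show ?thesis using ord_total X_monomial[OF \<alpha>] by blast
  next
    case False
    then have "tot_deg l \<beta> < tot_deg l \<alpha>" using \<beta> coef[of \<beta>] low by (simp add: supp_def)
    then show ?thesis using ord_degree[OF \<alpha>, of \<beta>] \<beta> supp_exponents by blast
  qed
qed

definition lead_exponents :: "(nat \<Rightarrow> nat) set" where
  "lead_exponents = (\<lambda>g. exponent_of l x (lead g)) ` G"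

lemma lead_exponents_iff: "\<beta> \<in> lead_exponents \<longleftrightarrow> \<beta> \<in> exponents l \<and> (\<exists>g\<in>G. lead g = X \<beta>)"
proof
  assume "\<beta> \<in> lead_exponents"
  then obtain g where g: "g \<in> G" "\<beta> = exponent_of l x (lead g)" by (auto simp: lead_exponents_def)
  then have "g \<noteq> 0" using GS by (auto simp: left_GS_basis_def)
  then obtain \<alpha> where "\<alpha> \<in> supp g" "lead g = X \<alpha>" by (rule lead_exponent)
  moreover from this have "\<alpha> \<in> exponents l" using supp_exponents by blast
  ultimately show "\<beta> \<in> exponents l \<and> (\<exists>g\<in>G. lead g = X \<beta>)"
    using g(1) unfolding g(2) by auto
next
  assume "\<beta> \<in> exponents l \<and> (\<exists>g\<in>G. lead g = X \<beta>)"
  then obtain g where g: "\<beta> \<in> exponents l" "g \<in> G" "lead g = X \<beta>" by blast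
  have "exponent_of l x (lead g) = \<beta>" unfolding g(3) by (rule exponent_of_mono[OF g(1)])
  then show "\<beta> \<in> lead_exponents" using g(2) unfolding lead_exponents_def by blast
qed

text \<open>
  Let \<open>g\<close> have leading exponent \<open>\<beta>\<close> and \<open>h X\<^sup>\<beta> = X\<^sup>\<alpha>\<close>.  After normalising the leading coefficient of \<open>g\<close>
  to 1, the product \<open>h g\<close> is \<open>X\<^sup>\<alpha>\<close> plus terms \<open>h r X\<^sup>\<gamma>\<close> with \<open>X\<^sup>\<gamma>\<close> below \<open>X\<^sup>\<beta>\<close>.  The ordering compares
  \<open>h r X\<^sup>\<gamma>\<close> with \<open>h r X\<^sup>\<beta>\<close>, not with \<open>h X\<^sup>\<beta>\<close>; but these two have the same leading monomial \<open>X\<^sup>\<alpha>\<close> by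
  \<open>left_factor_coeff_leading\<close>.
\<close>

lemma reducible_lead:
  assumes \<alpha>: "\<alpha> \<in> exponents l" and \<beta>: "\<beta> \<in> lead_exponents" "\<beta> \<le> \<alpha>"
  obtains f where "f \<in> I" "coef f \<alpha> = 1" "\<And>\<gamma>. \<gamma> \<in> supp f \<Longrightarrow> (X \<gamma>, X \<alpha>) \<in> ord"
proof -
  obtain g where g: "g \<in> G" "lead g = X \<beta>" and \<beta>l: "\<beta> \<in> exponents l"
    using \<beta>(1) lead_exponents_iff by blast
  have gI: "g \<in> I" "g \<noteq> 0" using GS g(1) by (auto simp: left_GS_basis_def)
  obtain \<beta>' where \<beta>': "\<beta>' \<in> supp g" "lead g = X \<beta>'" "\<And>\<gamma>. \<gamma> \<in> supp g \<Longrightarrow> (X \<gamma>, X \<beta>') \<in> ord"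
    by (rule lead_exponent[OF gI(2)]) blast
  have "\<beta>' \<in> exponents l" using \<beta>'(1) supp_exponents by blast
  then have "\<beta>' = \<beta>" using inj_onD[OF inj_mono _ _ \<beta>l, of \<beta>'] \<beta>'(2) g(2) by simp
  then have \<beta>g: "\<beta> \<in> supp g" and top: "\<And>\<gamma>. \<gamma> \<in> supp g \<Longrightarrow> (X \<gamma>, X \<beta>) \<in> ord" using \<beta>' by auto
  \<comment> \<open>\<open>c\<close> normalises the leading coefficient of \<open>g\<close>; its own inverse \<open>c'\<close> only serves to see that
    multiplication by \<open>c\<close> kills no coefficient of \<open>g\<close>.\<close>
  obtain c where c: "c \<in> R" "c * coef g \<beta> = 1"
    using R_inverse[OF coef_in_R, of g \<beta>] \<beta>g by (auto simp: supp_def)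
  have "c \<noteq> 0" using c(2) by auto
  then obtain c' where c': "c' \<in> R" "c' * c = 1" using R_inverse[OF c(1)] by blast
  obtain h where h: "h * X \<beta> = X \<alpha>" "h \<in> below (Suc (tot_deg l \<alpha> - tot_deg l \<beta>))"
    by (rule mono_left_factor[OF \<alpha> \<beta>l \<beta>(2)]) blast
  have deg: "tot_deg l \<beta> \<le> tot_deg l \<alpha>"
    using \<beta>(2) unfolding tot_deg_def by (intro sum_mono) (simp add: le_fun_def)
  let ?f = "h * (c * g)"
  let ?t = "\<lambda>\<gamma>. h * ((c * coef g \<gamma>) * X \<gamma>)"
  have small: "(X \<epsilon>, X \<alpha>) \<in> ord - Id" if \<gamma>: "\<gamma> \<in> supp g" "\<gamma> \<noteq> \<beta>" and \<epsilon>: "\<epsilon> \<in> supp (?t \<gamma>)" for \<gamma> \<epsilon>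
  proof -
    let ?r = "c * coef g \<gamma>"
    have rR: "?r \<in> R" using c(1) coef_in_R R_mult by blast
    have "c' * ?r = coef g \<gamma>" using c'(2) by (simp add: mult.assoc[symmetric])
    then have r0: "?r \<noteq> 0" using \<gamma>(1) by (auto simp: supp_def)
    have \<gamma>l: "\<gamma> \<in> exponents l" using \<gamma>(1) supp_exponents by blast
    \<comment> \<open>A term \<open>h r X\<^sup>\<gamma>\<close> that vanishes has empty support, so only nonzero terms, which have a
      leading monomial, have to be considered.\<close>
    have t0: "?t \<gamma> \<noteq> 0" using \<epsilon> supp_empty_iff[of "?t \<gamma>"] by blast
    then have hr: "h * ?r \<noteq> 0" by (auto simp: mult.assoc[symmetric])
    have "(X \<gamma>, X \<beta>) \<in> ord - Id"
      using top[OF \<gamma>(1)] \<gamma>(2) inj_onD[OF inj_mono _ \<gamma>l \<beta>l] by blast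
    from ord_mult[OF \<beta>l \<gamma>l this hr]
    have "(lead (?t \<gamma>), lead (h * (?r * X \<beta>))) \<in> ord - Id" by (simp only: mult.assoc)
    moreover have "lead (h * (?r * X \<beta>)) = X \<alpha>"
      using left_factor_coeff_leading[OF \<alpha> \<beta>l deg h rR r0] lead_of_top_degree[OF \<alpha>] by metis
    moreover obtain \<epsilon>' where "lead (?t \<gamma>) = X \<epsilon>'" "(X \<epsilon>, X \<epsilon>') \<in> ord"
      using lead_exponent[OF t0] \<epsilon> by metis
    ultimately show ?thesis using ord_trans ord_antisym by (metis DiffD1 DiffD2 DiffI IdI pair_in_Id_conv)
  qed
  have "?f = (\<Sum>\<gamma>\<in>supp g. ?t \<gamma>)"
  proof -
    have "?f = h * (c * (\<Sum>\<gamma>\<in>supp g. coef g \<gamma> * X \<gamma>))" using expansion[of g] by simp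
    then show ?thesis by (simp add: sum_distrib_left mult.assoc)
  qed
  also have "\<dots> = ?t \<beta> + (\<Sum>\<gamma>\<in>supp g - {\<beta>}. ?t \<gamma>)"
    by (rule sum.remove[OF finite_supp \<beta>g])
  also have "?t \<beta> = 1 * X \<alpha>" using c(2) h(1) by simp
  finally have coef_f: "coef ?f \<epsilon> = (if \<epsilon> = \<alpha> then 1 else 0) + (\<Sum>\<gamma>\<in>supp g - {\<beta>}. coef (?t \<gamma>) \<epsilon>)" for \<epsilon>
    using coef_mono[OF \<alpha> R_one] by (simp add: coef_add coef_sum)
  have "coef (?t \<gamma>) \<alpha> = 0" if "\<gamma> \<in> supp g - {\<beta>}" for \<gamma>
    using small[of \<gamma> \<alpha>] that by (auto simp: supp_def)
  then have "coef ?f \<alpha> = 1" using coef_f[of \<alpha>] by simp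
  moreover have "(X \<epsilon>, X \<alpha>) \<in> ord" if "\<epsilon> \<in> supp ?f" for \<epsilon>
  proof (cases "\<epsilon> = \<alpha>")
    case True
    then show ?thesis using ord_total X_monomial[OF \<alpha>] by blast
  next
    case False
    then have "(\<Sum>\<gamma>\<in>supp g - {\<beta>}. coef (?t \<gamma>) \<epsilon>) \<noteq> 0" using that coef_f[of \<epsilon>] by (simp add: supp_def)
    then obtain \<gamma> where "\<gamma> \<in> supp g - {\<beta>}" "coef (?t \<gamma>) \<epsilon> \<noteq> 0" by (rule sum.not_neutral_contains_not_neutral)
    then show ?thesis using small[of \<gamma> \<epsilon>] by (simp add: supp_def)
  qed
  moreover have "?f \<in> I" using gI(1) I_mult by blast
  ultimately show ?thesis using that by blast
qed

text \<open>
  By \<open>right_divisible_mono_iff\<close> these are the exponents of the irreducible monomials, see \<open>Irr_eq\<close>.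
\<close>

abbreviation normal :: "(nat \<Rightarrow> nat) set" where
  "normal \<equiv> staircase l lead_exponents"

lemma normal_exponents: "normal \<subseteq> exponents l"
  by (auto simp: staircase_def)

text \<open>
  Well-founded induction over the monomial ordering.  As the ordering refines the total degree,
  reduction never raises the degree, which makes normal forms compatible with the filtration.
\<close>

lemma normal_form_mono:
  assumes "\<alpha> \<in> exponents l" "tot_deg l \<alpha> \<le> t"
  shows "\<exists>v \<in> lspan {\<beta> \<in> normal. tot_deg l \<beta> \<le> t}. X \<alpha> - v \<in> I"
  using assms
proof (induction \<alpha> rule: wf_induct_rule[OF wf_inv_image[OF ord_wf, of X]])
  case (1 \<alpha>)
  let ?N = "lspan {\<beta> \<in> normal. tot_deg l \<beta> \<le> t}"
  show ?case
  proof (cases "\<alpha> \<in> normal")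
    case True
    then show ?thesis using 1 I_zero by (intro bexI[of _ "X \<alpha>"] X_in_lspan) auto
  next
    case False
    then obtain \<beta> where "\<beta> \<in> lead_exponents" "\<beta> \<le> \<alpha>" using 1(2) by (auto simp: staircase_def)
    then obtain f where f: "f \<in> I" "coef f \<alpha> = 1" "\<And>\<gamma>. \<gamma> \<in> supp f \<Longrightarrow> (X \<gamma>, X \<alpha>) \<in> ord"
      using reducible_lead[OF 1(2)] by blast
    let ?A = "supp f - {\<alpha>}"
    have "\<forall>\<gamma>\<in>?A. \<exists>v. v \<in> ?N \<and> X \<gamma> - v \<in> I"
    proof
      fix \<gamma> assume \<gamma>: "\<gamma> \<in> ?A"
      then have \<gamma>l: "\<gamma> \<in> exponents l" using supp_exponents by blast
      have "(\<gamma>, \<alpha>) \<in> inv_image (ord - Id) X"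
        using \<gamma> f(3)[of \<gamma>] inj_onD[OF inj_mono _ \<gamma>l 1(2)] by (auto simp: in_inv_image)
      moreover have "tot_deg l \<gamma> \<le> t" using ord_degree_le[OF 1(2) \<gamma>l] f(3)[of \<gamma>] \<gamma> 1(3) by auto
      ultimately show "\<exists>v. v \<in> ?N \<and> X \<gamma> - v \<in> I" using 1(1)[of \<gamma>] \<gamma>l by blast
    qed
    from bchoice[OF this] obtain v where v: "\<And>\<gamma>. \<gamma> \<in> ?A \<Longrightarrow> v \<gamma> \<in> ?N" "\<And>\<gamma>. \<gamma> \<in> ?A \<Longrightarrow> X \<gamma> - v \<gamma> \<in> I"
      by blast
    let ?v = "- (\<Sum>\<gamma>\<in>?A. coef f \<gamma> * v \<gamma>)"
    have "\<alpha> \<in> supp f" using f(2) by (simp add: supp_def)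
    from sum.remove[OF finite_supp this, of "\<lambda>\<gamma>. coef f \<gamma> * X \<gamma>"]
    have "f = X \<alpha> + (\<Sum>\<gamma>\<in>?A. coef f \<gamma> * X \<gamma>)" using expansion[of f] f(2) by simp
    then have X_eq: "X \<alpha> = f - (\<Sum>\<gamma>\<in>?A. coef f \<gamma> * X \<gamma>)"
      unfolding eq_diff_eq by (rule sym)
    have "X \<alpha> - ?v = f - (\<Sum>\<gamma>\<in>?A. coef f \<gamma> * (X \<gamma> - v \<gamma>))"
      unfolding X_eq by (simp add: right_diff_distrib sum_subtractf)
    also have "\<dots> \<in> I" by (rule I_diff[OF f(1) I_sum[OF I_mult[OF v(2)]]])
    finally have "X \<alpha> - ?v \<in> I" .
    moreover have "?v \<in> ?N"
      using lspan_diff[OF lspan_zero lspan_sum, of ?A "\<lambda>\<gamma>. coef f \<gamma> * v \<gamma>"] v(1)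
      by (simp add: lspan_mult_left coef_in_R)
    ultimately show ?thesis by blast
  qed
qed

lemma normal_form:
  assumes "f \<in> below (Suc t)"
  shows "\<exists>v \<in> lspan {\<beta> \<in> normal. tot_deg l \<beta> \<le> t}. f - v \<in> I"
proof -
  let ?N = "lspan {\<beta> \<in> normal. tot_deg l \<beta> \<le> t}"
  have "below (Suc t) \<subseteq> {f. \<exists>v\<in>?N. f - v \<in> I}"
  proof (rule lspan_subset)
    show "0 \<in> {f. \<exists>v\<in>?N. f - v \<in> I}" using I_zero by (auto intro!: bexI[of _ 0] lspan_zero)
    fix f g assume "f \<in> {f. \<exists>v\<in>?N. f - v \<in> I}" "g \<in> {f. \<exists>v\<in>?N. f - v \<in> I}"
    then obtain v w where "v \<in> ?N" "w \<in> ?N" "f - v \<in> I" "g - w \<in> I" by blast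
    then have "v + w \<in> ?N" "(f + g) - (v + w) \<in> I"
      using lspan_add I_add[of "f - v" "g - w"] by (simp_all add: algebra_simps)
    then show "f + g \<in> {f. \<exists>v\<in>?N. f - v \<in> I}" by blast
  next
    fix r \<alpha> assume "r \<in> R" "\<alpha> \<in> {\<alpha>. tot_deg l \<alpha> < Suc t}" "\<alpha> \<in> exponents l"
    moreover from this obtain v where "v \<in> ?N" "X \<alpha> - v \<in> I" using normal_form_mono[of \<alpha> t] by auto
    ultimately have "r * v \<in> ?N" "r * X \<alpha> - r * v \<in> I"
      using lspan_mult_left I_mult[of "X \<alpha> - v" r] by (simp_all add: right_diff_distrib)
    then show "r * X \<alpha> \<in> {f. \<exists>v\<in>?N. f - v \<in> I}" by blast
  qed
  then show ?thesis using assms by blast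
qed

text \<open>
  A nonzero element of the ideal has a leading monomial divisible by some leading monomial of the
  basis, and so is not a combination of irreducible monomials.
\<close>

lemma normal_independent:
  assumes "f \<in> lspan normal" "f \<in> I"
  shows "f = 0"
proof (rule ccontr)
  assume "f \<noteq> 0"
  then obtain \<alpha> where \<alpha>: "\<alpha> \<in> supp f" "lead f = X \<alpha>" by (rule lead_exponent)
  obtain g where g: "g \<in> G" "right_divisible (lead f) (lead g)"
    using GS assms(2) \<open>f \<noteq> 0\<close> unfolding left_GS_basis_def by blast
  have "g \<noteq> 0" using GS g(1) by (auto simp: left_GS_basis_def)
  then obtain \<beta> where \<beta>: "\<beta> \<in> supp g" "lead g = X \<beta>" by (rule lead_exponent)
  have l: "\<alpha> \<in> exponents l" "\<beta> \<in> exponents l" using \<alpha> \<beta> supp_exponents by blast+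
  have "\<beta> \<le> \<alpha>" using g(2) right_divisible_mono_iff[OF l] unfolding \<alpha>(2) \<beta>(2) by blast
  moreover have "\<beta> \<in> lead_exponents" using l \<beta> g(1) lead_exponents_iff by blast
  moreover have "\<alpha> \<in> normal" using \<alpha>(1) assms(1) by (auto simp: lspan_def)
  ultimately show False by (auto simp: staircase_def)
qed

text \<open>
  Otherwise 1 would be reducible, and the reduction lemma would put 1 itself into the ideal, as no
  other monomial lies below it.
\<close>

lemma zero_normal: "(\<lambda>_. 0) \<in> normal"
proof (rule ccontr)
  assume "(\<lambda>_. 0) \<notin> normal"
  then obtain \<beta> where "\<beta> \<in> lead_exponents" "\<beta> \<le> (\<lambda>_. 0)" by (auto simp: staircase_def)
  then obtain f where f: "f \<in> I" "coef f (\<lambda>_. 0) = 1" "\<And>\<gamma>. \<gamma> \<in> supp f \<Longrightarrow> (X \<gamma>, X (\<lambda>_. 0)) \<in> ord"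
    using reducible_lead[OF zero_in_exponents] by blast
  have "\<gamma> = (\<lambda>_. 0)" if "\<gamma> \<in> supp f" for \<gamma>
  proof -
    have \<gamma>: "\<gamma> \<in> exponents l" using that supp_exponents by blast
    then have "tot_deg l \<gamma> = 0" using ord_degree_le[OF zero_in_exponents \<gamma> f(3)[OF that]] by simp
    then show ?thesis using \<gamma> by (auto simp: tot_deg_def exponents_def fun_eq_iff) (metis lessThan_iff not_less)
  qed
  then have "f = (\<Sum>\<gamma>\<in>{\<lambda>_. 0}. coef f \<gamma> * X \<gamma>)" by (intro expansion_superset) auto
  then have "1 \<in> I" using f by simp
  then have "a \<in> I" for a using I_mult[of 1 a] by simp
  then show False using proper by blast
qed

lemma Irr_eq: "Irr R l x ord G = X ` normal"
proof -
  have "X \<alpha> \<in> Irr R l x ord G \<longleftrightarrow> \<alpha> \<in> normal" if \<alpha>: "\<alpha> \<in> exponents l" for \<alpha>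
  proof -
    have "X \<alpha> \<in> Irr R l x ord G \<longleftrightarrow> (\<forall>g\<in>G. \<not> right_divisible (X \<alpha>) (lead g))"
      using X_monomial[OF \<alpha>] by (auto simp: Irr_def right_divisible_def)
    also have "\<dots> \<longleftrightarrow> (\<forall>\<beta>\<in>lead_exponents. \<not> right_divisible (X \<alpha>) (X \<beta>))"
    proof safe
      fix \<beta> assume "\<forall>g\<in>G. \<not> right_divisible (X \<alpha>) (lead g)" "\<beta> \<in> lead_exponents" "right_divisible (X \<alpha>) (X \<beta>)"
      then show False using lead_exponents_iff by metis
    next
      fix g assume *: "\<forall>\<beta>\<in>lead_exponents. \<not> right_divisible (X \<alpha>) (X \<beta>)" "g \<in> G" "right_divisible (X \<alpha>) (lead g)"
      then have "g \<noteq> 0" using GS by (auto simp: left_GS_basis_def)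
      then obtain \<beta> where "\<beta> \<in> supp g" "lead g = X \<beta>" by (rule lead_exponent)
      then show False using * lead_exponents_iff supp_exponents by (metis subsetD)
    qed
    also have "\<dots> \<longleftrightarrow> \<alpha> \<in> normal"
      using right_divisible_mono_iff[OF \<alpha>] lead_exponents_iff \<alpha> by (auto simp: staircase_def)
    finally show ?thesis .
  qed
  moreover have "Irr R l x ord G \<subseteq> X ` exponents l" by (auto simp: Irr_def monomials_def)
  ultimately show ?thesis using normal_exponents by blast
qed

section \<open>Hilbert function and Gelfand-Kirillov dimension\<close>


text \<open>
  Modulo the ideal, the irreducible monomials of degree at most \<open>t\<close> form a left \<open>R\<close>-basis of the
  elements of degree at most \<open>t\<close>; their products with a basis of \<open>R\<close> over the ground field are a
  basis over the ground field.
\<close>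

lemma k_dim_below:
  obtains d where "0 < d"
    and "\<And>t. k_dim scale M (coset ` below (Suc t)) = d * card {\<alpha> \<in> normal. tot_deg l \<alpha> \<le> t}"
proof -
  obtain K where K: "finite K" "independent K" "R = span K" "K \<noteq> {}" by (rule R_basis)
  have KR: "K \<subseteq> R" using K(3) span_superset by blast
  have "k_dim scale M (coset ` below (Suc t)) = card K * card {\<alpha> \<in> normal. tot_deg l \<alpha> \<le> t}" for t
  proof -
    let ?E = "{\<alpha> \<in> normal. tot_deg l \<alpha> \<le> t}"
    let ?g = "\<lambda>(b, \<alpha>). b * X \<alpha>"
    let ?B = "?g ` (K \<times> ?E)"
    have E_exp: "\<alpha> \<in> exponents l" if "\<alpha> \<in> ?E" for \<alpha> using that normal_exponents by blast
    have finE: "finite ?E"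
      by (rule finite_subset[OF _ finite_exponents_total[of l t]]) (use E_exp in auto)
    have finB: "finite ?B" using K(1) finE by blast
    have spanB: "span ?B = lspan ?E"
    proof -
      have "?B = {b * X \<alpha> | b \<alpha>. b \<in> K \<and> \<alpha> \<in> ?E \<inter> exponents l}"
        using E_exp by fastforce
      then show ?thesis using lspan_eq_span[OF K(3)] by simp
    qed
    have image: "coset ` below (Suc t) = coset ` span ?B"
      unfolding spanB
    proof (rule equalityI; rule image_subsetI)
      fix f assume "f \<in> below (Suc t)"
      then obtain v where "v \<in> lspan ?E" "f - v \<in> I" using normal_form by blast
      then show "coset f \<in> coset ` lspan ?E" using coset_eq_iff by blast
    next
      fix f assume "f \<in> lspan ?E"
      then have "f \<in> below (Suc t)" by (rule lspan_mono[rotated]) auto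
      then show "coset f \<in> coset ` below (Suc t)" by blast
    qed
    have inj: "inj_on ?g (K \<times> ?E)"
    proof (rule inj_onI)
      fix u v assume u: "u \<in> K \<times> ?E" and v: "v \<in> K \<times> ?E" and eq: "?g u = ?g v"
      obtain b \<alpha> b' \<alpha>' where uv: "u = (b, \<alpha>)" "v = (b', \<alpha>')" by (metis surj_pair)
      have mem: "b \<in> R" "b' \<in> R" "\<alpha> \<in> exponents l" "\<alpha>' \<in> exponents l"
        using u v uv KR E_exp by auto
      have "b \<noteq> 0" using u uv K(2) dependent_zero by auto
      moreover have "b * X \<alpha> = b' * X \<alpha>'" using eq uv by simp
      then have "(\<lambda>\<gamma>. if \<gamma> = \<alpha> then b else 0) = (\<lambda>\<gamma>. if \<gamma> = \<alpha>' then b' else 0)"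
        using coef_mono[OF mem(3,1)] coef_mono[OF mem(4,2)] by simp
      from fun_cong[OF this, of \<alpha>] have "b = (if \<alpha> = \<alpha>' then b' else 0)" by simp
      ultimately show "u = v" using uv by (simp split: if_splits)
    qed
    have "indep_mod ?B"
      unfolding indep_mod_def
    proof (intro allI impI)
      fix c assume I: "(\<Sum>b\<in>?B. scale (c b) b) \<in> I"
      have "(\<Sum>b\<in>?B. scale (c b) b) \<in> span ?B"
        by (intro span_sum span_scale span_base)
      then have "(\<Sum>b\<in>?B. scale (c b) b) \<in> lspan normal"
        unfolding spanB by (rule lspan_mono[rotated]) auto
      then have zero: "(\<Sum>b\<in>?B. scale (c b) b) = 0" using I by (rule normal_independent)
      let ?a = "\<lambda>\<alpha>. \<Sum>b\<in>K. scale (c (b * X \<alpha>)) b"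
      have "(\<Sum>b\<in>?B. scale (c b) b) = (\<Sum>(b, \<alpha>)\<in>K \<times> ?E. scale (c (b * X \<alpha>)) (b * X \<alpha>))"
        by (subst sum.reindex[OF inj]) (simp add: case_prod_unfold)
      also have "\<dots> = (\<Sum>b\<in>K. \<Sum>\<alpha>\<in>?E. scale (c (b * X \<alpha>)) (b * X \<alpha>))"
        by (simp add: sum.cartesian_product)
      also have "\<dots> = (\<Sum>\<alpha>\<in>?E. ?a \<alpha> * X \<alpha>)"
        by (subst sum.swap) (simp add: sum_distrib_right scale_mult_left)
      finally have sum_zero: "(\<Sum>\<alpha>\<in>?E. ?a \<alpha> * X \<alpha>) = 0" using zero by simp
      have a_R: "?a \<alpha> \<in> R" for \<alpha>
        using KR by (intro subspace_sum[OF R_subspace] R_scale) blast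
      have "?E \<subseteq> exponents l" using E_exp by blast
      from coef_sum_monos[of ?E ?a, OF finE this a_R] have coef_zero_eq: "coef 0 = (\<lambda>\<alpha>. if \<alpha> \<in> ?E then ?a \<alpha> else 0)"
        unfolding sum_zero .
      have a_zero: "?a \<alpha> = 0" if "\<alpha> \<in> ?E" for \<alpha>
        using that fun_cong[OF coef_zero_eq, of \<alpha>] by simp
      show "\<forall>b\<in>?B. c b = 0"
      proof
        fix u assume "u \<in> ?B"
        then obtain b \<alpha> where u: "u = b * X \<alpha>" "b \<in> K" "\<alpha> \<in> ?E" by auto
        show "c u = 0"
          unfolding u(1) by (rule independentD[OF K(2,1) subset_refl a_zero[OF u(3)] u(2)])
      qed
    qed
    then have "k_dim scale M (coset ` span ?B) = card ?B"
      by (rule k_dim_span_indep_mod[OF finB])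
    then show ?thesis
      unfolding image using card_image[OF inj] by (simp add: card_cartesian_product)
  qed
  moreover have "0 < card K" using K(1,4) by (simp add: card_gt_0_iff)
  ultimately show ?thesis using that by blast
qed

text \<open>
  The components \<open>M\<^sub>0, \<dots>, M\<^sub>t\<close> are the images of the homogeneous parts of degree up to \<open>t\<close>, whose sum is
  the space of all elements of degree at most \<open>t\<close>.
\<close>

lemma hilbert_function_eq:
  "hilbert_function scale R l x I t = k_dim scale M (coset ` below (Suc t))"
proof -
  let ?U = "\<lambda>j. lspan {\<alpha> \<in> exponents l. tot_deg l \<alpha> = j}"
  have "hom_component R l x I = (\<lambda>j. coset ` ?U j)"
    unfolding hom_component_def monos_eq_eq by (subst left_span_monos) auto
  moreover have "{\<Sum>j\<le>t. a j | a. \<forall>j\<le>t. a j \<in> ?U j} = below (Suc t)"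
  proof (rule equalityI; rule subsetI)
    fix f assume "f \<in> {\<Sum>j\<le>t. a j | a. \<forall>j\<le>t. a j \<in> ?U j}"
    then obtain a where a: "f = (\<Sum>j\<le>t. a j)" "\<forall>j\<le>t. a j \<in> ?U j" by blast
    show "f \<in> below (Suc t)"
      unfolding a(1)
    proof (rule lspan_sum)
      fix j assume "j \<in> {..t}"
      then show "a j \<in> below (Suc t)" using a(2) by (auto intro: lspan_mono[rotated])
    qed
  next
    fix f assume f: "f \<in> below (Suc t)"
    let ?a = "\<lambda>j. \<Sum>\<alpha>\<in>{\<alpha> \<in> supp f. tot_deg l \<alpha> = j}. coef f \<alpha> * X \<alpha>"
    have "(\<Sum>j\<le>t. ?a j) = (\<Sum>\<alpha>\<in>supp f. coef f \<alpha> * X \<alpha>)"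
      using f by (intro sum.group finite_supp) (auto simp: lspan_def)
    then have "f = (\<Sum>j\<le>t. ?a j)" using expansion[of f] by simp
    moreover have "?a j \<in> ?U j" for j
      using supp_exponents[of f] by (intro lspan_sum lspan_mult_left coef_in_R X_in_lspan) auto
    ultimately show "f \<in> {\<Sum>j\<le>t. a j | a. \<forall>j\<le>t. a j \<in> ?U j}" by blast
  qed
  ultimately show ?thesis
    by (simp only: hilbert_function_def sum_components_coset)
qed

lemma one_below: "1 \<in> below (Suc t)"
  using X_in_lspan[of "\<lambda>_. 0" "{\<alpha>. tot_deg l \<alpha> < Suc t}"] by simp

lemma power_space_below:
  assumes V: "V \<subseteq> below (Suc s)"
  shows "power_space scale V k \<subseteq> below (Suc (s * k))"
proof -
  have "prod_list vs \<in> below (Suc (s * length vs))" if "set vs \<subseteq> V" for vs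
    using that
  proof (induction vs)
    case (Cons v vs)
    then have "v * prod_list vs \<in> below (s + Suc (s * length vs))" using V by (intro mult_below) auto
    then show ?case by simp
  qed (use one_below[of 0] in simp)
  then show ?thesis
    unfolding power_space_def by (intro span_minimal subspace_lspan) auto
qed

lemma finite_subset_below:
  assumes "finite B"
  obtains s where "B \<subseteq> below (Suc s)"
proof -
  have "\<exists>s. B \<subseteq> below (Suc s)"
    using assms
  proof (induction B rule: finite_induct)
    case (insert b B)
    obtain s where "B \<subseteq> below (Suc s)" using insert by blast
    moreover obtain t where "b \<in> below t" using in_below_ex by blast
    ultimately have "insert b B \<subseteq> below (Suc (s + t))"
      using below_mono[of _ "Suc s" "Suc (s + t)"] below_mono[of b t "Suc (s + t)"] by auto
    then show ?case by blast
  qed simp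
  then show ?thesis using that by blast
qed

text \<open>
  Any generators of \<open>V\<close> and representatives of \<open>F\<close> have bounded degrees, say at most \<open>s\<close> and \<open>q\<close>; then
  \<open>V\<^sup>k F\<close> comes from elements of degree at most \<open>s * k + q\<close>.  Taking \<open>s\<close> one larger makes it positive.
\<close>

lemma k_dim_act_space_le:
  assumes V: "fin_dim_subspace scale V" and F: "finite B" "B \<subseteq> carrier M"
  obtains s q where "0 < s"
    "\<And>k. k_dim scale M (act_space scale M (power_space scale V k) (k_span scale M B))
      \<le> k_dim scale M (coset ` below (Suc (s * k + q)))"
proof -
  obtain BV where BV: "finite BV" "V = span BV" using V by (auto simp: fin_dim_subspace_def)
  obtain s where s: "BV \<subseteq> below (Suc s)" by (rule finite_subset_below[OF BV(1)])
  then have "V \<subseteq> below (Suc s)" unfolding BV(2) by (intro span_minimal subspace_lspan)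
  then have Vs: "V \<subseteq> below (Suc (Suc s))" using below_mono[of _ "Suc s" "Suc (Suc s)"] by auto
  obtain C where C: "finite C" "B = coset ` C"
    using finite_subset_image[OF F(1), of coset UNIV] F(2) unfolding carrier_M by blast
  obtain q where q: "C \<subseteq> below (Suc q)" by (rule finite_subset_below[OF C(1)])
  then have Cq: "span C \<subseteq> below (Suc q)" by (intro span_minimal subspace_lspan)
  have "k_dim scale M (act_space scale M (power_space scale V k) (k_span scale M B))
      \<le> k_dim scale M (coset ` below (Suc (Suc s * k + q)))" for k
  proof -
    let ?U = "{v * u | v u. v \<in> power_space scale V k \<and> u \<in> span C}"
    have act: "act_space scale M (power_space scale V k) (k_span scale M B) = coset ` span ?U"
      unfolding C(2) k_span_coset by (rule act_space_coset)
    have "?U \<subseteq> below (Suc (Suc s * k + q))"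
    proof
      fix z assume "z \<in> ?U"
      then obtain v u where z: "z = v * u" "v \<in> power_space scale V k" "u \<in> span C" by blast
      have "v * u \<in> below (Suc s * k + Suc q)"
        using z(2,3) power_space_below[OF Vs, of k] Cq by (intro mult_below) auto
      then show "z \<in> below (Suc (Suc s * k + q))" using z(1) by simp
    qed
    then have sub: "span ?U \<subseteq> below (Suc (Suc s * k + q))" by (intro span_minimal subspace_lspan)
    obtain B' where B': "finite B'" "below (Suc (Suc s * k + q)) = span B'" by (rule below_finite_dim)
    show ?thesis
      unfolding act B'(2)
      using sub B' by (intro k_dim_mono subspace_coset_image subspace_span image_mono) auto
  qed
  then show ?thesis by (rule that[of "Suc s" q, rotated]) simp
qed

text \<open>
  The space \<open>below 2\<close> is spanned by \<open>R\<close> and the generators with coefficients in \<open>R\<close>.  A term \<open>r X\<^sup>\<alpha>\<close> of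
  degree at most \<open>k\<close> is a product of \<open>k\<close> of its elements: the letters of \<open>X\<^sup>\<alpha>\<close>, filled up with 1,
  with \<open>r\<close> absorbed into the first factor.  That needs a first factor, so \<open>k\<close> has to be positive.
\<close>

lemma power_space_below_two:
  assumes "0 < k"
  shows "power_space scale (below 2) k = below (Suc k)"
proof
  have "below 2 = below (Suc 1)" by (simp add: numeral_2_eq_2)
  then show "power_space scale (below 2) k \<subseteq> below (Suc k)"
    using power_space_below[of "below 2" 1 k] by simp
  have one2: "1 \<in> below 2" using one_below[of 1] by (simp add: numeral_2_eq_2)
  have mono: "\<exists>vs. length vs = tot_deg l \<alpha> \<and> set vs \<subseteq> below 2 \<and> prod_list vs = X \<alpha>"
    if "\<alpha> \<in> exponents l" for \<alpha>
    using that
  proof (induction \<alpha> rule: exponents_induct)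
    case zero
    then show ?case by simp
  next
    case (raise i \<alpha>)
    then obtain vs where vs: "length vs = tot_deg l \<alpha>" "set vs \<subseteq> below 2" "prod_list vs = X \<alpha>" by blast
    have "x i = X (raise i (\<lambda>_. 0))" using X_raise_least[of i "\<lambda>_. 0"] raise(1) by simp
    moreover have "X (raise i (\<lambda>_. 0)) \<in> below 2" using raise(1) by (intro X_in_lspan) auto
    ultimately have "x i \<in> below 2" by simp
    then show ?case
      using vs raise X_raise_least[of i \<alpha>] by (intro exI[of _ "x i # vs"]) simp
  qed
  show "below (Suc k) \<subseteq> power_space scale (below 2) k"
  proof (rule lspan_subset)
    fix r \<alpha> assume r: "r \<in> R" and \<alpha>: "\<alpha> \<in> {\<alpha>. tot_deg l \<alpha> < Suc k}" "\<alpha> \<in> exponents l"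
    obtain vs where vs: "length vs = tot_deg l \<alpha>" "set vs \<subseteq> below 2" "prod_list vs = X \<alpha>"
      using mono[OF \<alpha>(2)] by blast
    let ?ws = "vs @ replicate (k - tot_deg l \<alpha>) 1"
    have "length ?ws = k" using vs(1) \<alpha>(1) by simp
    moreover have ws: "set ?ws \<subseteq> below 2" "prod_list ?ws = X \<alpha>"
      using vs one2 by (auto simp: prod_list_replicate)
    ultimately obtain w ws where w: "?ws = w # ws" "length ws = k - 1" using assms by (cases ?ws) auto
    have "r * w \<in> below 2" "set ws \<subseteq> below 2" using ws(1) lspan_mult_left[OF r] unfolding w(1) by auto
    moreover have "prod_list ((r * w) # ws) = r * X \<alpha>"
      using ws(2) unfolding w(1) by (simp add: mult.assoc)
    moreover have "length ((r * w) # ws) = k" using w(2) assms by simp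
    ultimately show "r * X \<alpha> \<in> power_space scale (below 2) k"
      unfolding power_space_def by (intro span_base CollectI exI[of _ "(r * w) # ws"]) auto
  qed (auto simp: power_space_def span_zero span_add)
qed

lemma act_space_below_two:
  assumes "0 < k"
  shows "act_space scale M (power_space scale (below 2) k) (k_span scale M {coset 1}) =
    coset ` below (Suc k)"
proof -
  let ?U = "{v * u | v u. v \<in> below (Suc k) \<and> u \<in> span {1}}"
  have "k_span scale M {coset 1} = coset ` span {1}" using k_span_coset[of "{1}"] by simp
  then have "act_space scale M (power_space scale (below 2) k) (k_span scale M {coset 1}) = coset ` span ?U"
    using act_space_coset by (simp add: power_space_below_two[OF assms])
  moreover have "span ?U = below (Suc k)"
  proof
    have "span {1} \<subseteq> below (Suc 0)" using one_below[of 0] by (intro span_minimal subspace_lspan) auto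
    then have "?U \<subseteq> below (Suc k)" using mult_below[of _ k _ "Suc 0"] by auto
    then show "span ?U \<subseteq> below (Suc k)" by (intro span_minimal subspace_lspan)
    show "below (Suc k) \<subseteq> span ?U"
    proof
      fix f assume "f \<in> below (Suc k)"
      then have "f * 1 \<in> ?U" using span_base[of 1 "{1}"] by blast
      then show "f \<in> span ?U" using span_base[of "f * 1" ?U] by simp
    qed
  qed
  ultimately show ?thesis by simp
qed

lemma log_nat_mono:
  assumes "a \<le> b" "2 \<le> k"
  shows "log_nat k a \<le> log_nat k b"
  using assms by (auto simp: log_nat_def)

text \<open>
  Upper bound: every pair \<open>V, F\<close> is dominated by a shifted and rescaled filtration.  Lower bound: the
  elements of degree at most 1 together with the coset of 1 reproduce the filtration itself.
\<close>

lemma GKdim_eq: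
  fixes e :: ereal
  assumes lim: "\<And>s q. 0 < s \<Longrightarrow>
    (\<lambda>k. log_nat k (k_dim scale M (coset ` below (Suc (s * k + q))))) \<longlonglongrightarrow> e"
  shows "GKdim scale M = e"
proof (rule antisym)
  show "GKdim scale M \<le> e"
    unfolding GKdim_def
  proof (rule SUP_least, clarify)
    fix V F B assume V: "fin_dim_subspace scale V" "1 \<in> V"
      and F: "finite B" "B \<subseteq> carrier M"
    obtain s q where sq: "0 < s"
      "\<And>k. k_dim scale M (act_space scale M (power_space scale V k) (k_span scale M B))
      \<le> k_dim scale M (coset ` below (Suc (s * k + q)))"
      by (rule k_dim_act_space_le[OF V(1) F]) blast
    have "limsup (\<lambda>k. log_nat k (k_dim scale M (act_space scale M (power_space scale V k) (k_span scale M B))))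
      \<le> limsup (\<lambda>k. log_nat k (k_dim scale M (coset ` below (Suc (s * k + q)))))"
    proof (rule Limsup_mono)
      show "\<forall>\<^sub>F k in sequentially.
          log_nat k (k_dim scale M (act_space scale M (power_space scale V k) (k_span scale M B)))
          \<le> log_nat k (k_dim scale M (coset ` below (Suc (s * k + q))))"
        using eventually_ge_at_top[of 2] by eventually_elim (rule log_nat_mono[OF sq(2)])
    qed
    also have "\<dots> = e" by (rule lim_imp_Limsup[OF _ lim[OF sq(1)]]) simp
    finally show "limsup (\<lambda>k. log_nat k (k_dim scale M (act_space scale M (power_space scale V k) (k_span scale M B)))) \<le> e" .
  qed
  have "limsup (\<lambda>k. log_nat k (k_dim scale M (act_space scale M (power_space scale (below 2) k) (k_span scale M {coset 1}))))
    = limsup (\<lambda>k. log_nat k (k_dim scale M (coset ` below (Suc k))))"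
  proof (rule Limsup_eq)
    show "\<forall>\<^sub>F k in sequentially.
        log_nat k (k_dim scale M (act_space scale M (power_space scale (below 2) k) (k_span scale M {coset 1})))
        = log_nat k (k_dim scale M (coset ` below (Suc k)))"
      using eventually_gt_at_top[of 0] by eventually_elim (simp only: act_space_below_two)
  qed
  also have "\<dots> = e"
    by (rule lim_imp_Limsup) (use lim[of 1 0] in simp_all)
  finally have "e = limsup (\<lambda>k. log_nat k (k_dim scale M (act_space scale M (power_space scale (below 2) k) (k_span scale M {coset 1}))))" ..
  also have "\<dots> \<le> GKdim scale M"
  proof -
    have "fin_dim_subspace scale (below 2)"
      using below_finite_dim[of 2] unfolding fin_dim_subspace_def by metis
    moreover have "1 \<in> below 2" using one_below[of 1] by (simp add: numeral_2_eq_2)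
    moreover have "finite {coset 1}" "{coset 1} \<subseteq> carrier M" by (auto simp: carrier_M)
    ultimately have "(below 2, k_span scale M {coset 1}) \<in> {(V, F). fin_dim_subspace scale V \<and> 1 \<in> V \<and>
        (\<exists>B. finite B \<and> B \<subseteq> carrier M \<and> F = k_span scale M B)}"
      by blast
    then show ?thesis unfolding GKdim_def by (rule SUP_upper2) simp
  qed
  finally show "e \<le> GKdim scale M" .
qed

lemma lead_exponents_bound:
  assumes "\<beta> \<in> lead_exponents"
  shows "\<beta> i \<le> max_lm_exponent R l x ord G"
proof (cases "i < l")
  case False
  then have "\<beta> i = 0" using assms lead_exponents_iff by (auto simp: exponents_def)
  then show ?thesis by simp
next
  case True
  obtain g where g: "g \<in> G" "\<beta> = exponent_of l x (lead g)" using assms by (auto simp: lead_exponents_def)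
  let ?Y = "{exponent_of l x (lead g) i | g i. g \<in> G \<and> i < l}"
  have "?Y = (\<lambda>(g, i). exponent_of l x (lead g) i) ` (G \<times> {..<l})" by auto
  then have "finite ?Y" using finite_G by simp
  moreover have "\<beta> i \<in> ?Y" using g True by blast
  ultimately have "\<beta> i \<le> Max ?Y" by (rule Max_ge)
  moreover have "max_lm_exponent R l x ord G = Max ?Y"
    using g True by (auto simp: max_lm_exponent_def)
  ultimately show ?thesis by simp
qed

text \<open>
  Clipped vectors have total degree at most \<open>l * p\<close>, so the restriction to monomials of degree at
  most \<open>t\<close> removes nothing.
\<close>

lemma clipped_Irr_eq:
  assumes t: "l * p \<le> t"
  shows "{card (top_at l x p u) | u. u \<in> Irr R l x ord G \<inter> monos_le l x t \<and> sh_at l x p u = u} =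
    (\<lambda>\<beta>. card (full_at l p \<beta>)) ` {\<beta> \<in> normal. clip p \<beta> = \<beta>}" (is "?L = ?R")
proof -
  have top: "top_at l x p (X \<beta>) = full_at l p \<beta>"
    and sh: "sh_at l x p (X \<beta>) = X \<beta> \<longleftrightarrow> clip p \<beta> = \<beta>" if "\<beta> \<in> normal" for \<beta>
  proof -
    have \<beta>: "\<beta> \<in> exponents l" using that normal_exponents by blast
    then have "clip p \<beta> \<in> exponents l" by (auto simp: exponents_def clip_def)
    then show "sh_at l x p (X \<beta>) = X \<beta> \<longleftrightarrow> clip p \<beta> = \<beta>"
      using inj_on_eq_iff[OF inj_mono _ \<beta>] \<beta> by (simp add: sh_at_def clip_def)
    show "top_at l x p (X \<beta>) = full_at l p \<beta>"
      using \<beta> by (simp add: top_at_def full_at_def)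
  qed
  have le: "X \<beta> \<in> monos_le l x t" if "\<beta> \<in> normal" "clip p \<beta> = \<beta>" for \<beta>
    using tot_deg_le_if_clipped[OF that(2), of l] t that(1) normal_exponents
    by (auto simp: monos_le_eq)
  show ?thesis
    unfolding Irr_eq
  proof (rule equalityI; rule subsetI)
    fix k assume "k \<in> {card (top_at l x p u) | u. u \<in> X ` normal \<inter> monos_le l x t \<and> sh_at l x p u = u}"
    then obtain \<beta> where "k = card (top_at l x p (X \<beta>))" "\<beta> \<in> normal" "sh_at l x p (X \<beta>) = X \<beta>" by blast
    then show "k \<in> ?R" using top sh by simp
  next
    fix k assume "k \<in> ?R"
    then obtain \<beta> where \<beta>: "k = card (full_at l p \<beta>)" "\<beta> \<in> normal" "clip p \<beta> = \<beta>" by blast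
    then show "k \<in> {card (top_at l x p u) | u. u \<in> X ` normal \<inter> monos_le l x t \<and> sh_at l x p u = u}"
      using top[OF \<beta>(2)] sh[OF \<beta>(2)] le[OF \<beta>(2,3)] by (intro CollectI exI[of _ "X \<beta>"]) simp
  qed
qed

end

theorem theorem4p4:
  fixes scale :: "'k::field_char_0 \<Rightarrow> 'a::ring_1 \<Rightarrow> 'a"
    and R I G :: "'a set"
    and m n l p :: nat
    and S D x :: "nat \<Rightarrow> 'a"
    and \<sigma> \<delta> :: "nat \<Rightarrow> 'a \<Rightarrow> 'a"
    and ord :: "'a rel"
    and M :: "('a, 'a set) module"
    and HF :: "nat \<Rightarrow> nat"
  assumes A: "dd_algebra scale R m n S D \<sigma> \<delta>"
    and R: "finite_field_extension scale R"
    and l: "l = m + n"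
    and x: "x = dd_gens m S D"
    and I: "left_ideal I" "I \<noteq> UNIV"
    and ord: "dd_monomial_ordering R l x ord" "total_degree_ordering l x ord"
    and G: "finite G" "left_GS_basis R l x ord I G"
    and p: "p = max_lm_exponent R l x ord G"
    and M: "M = quotient_module I"
    and HF: "HF = hilbert_function scale R l x I"
  shows "(\<exists>!h :: rat poly. \<forall>t\<ge>l * p. of_nat (HF t) = poly h (of_nat t)) \<and>
    (\<forall>h :: rat poly. (\<forall>t\<ge>l * p. of_nat (HF t) = poly h (of_nat t)) \<longrightarrow>
       GKdim scale M = ereal (real (degree h)) \<and>
       (\<forall>t\<ge>l * p. degree h =
          Max {card (top_at l x p u) | u.
                 u \<in> Irr R l x ord G \<inter> monos_le l x t \<and> sh_at l x p u = u}))"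
proof -
  interpret dd_algebra scale R m n S D \<sigma> \<delta> by (rule A)
  interpret dd_groebner scale R m n S D \<sigma> \<delta> ord I G
    using R I ord G unfolding l x by unfold_locales
  obtain d where d: "0 < d"
    "\<And>t. k_dim scale M (coset ` below (Suc t)) = d * card {\<alpha> \<in> normal. tot_deg (m + n) \<alpha> \<le> t}"
    unfolding M by (rule k_dim_below) blast
  have HF_eq: "HF t = k_dim scale M (coset ` below (Suc t))" for t
    unfolding HF l x M by (rule hilbert_function_eq)
  have bound: "\<forall>\<beta>\<in>lead_exponents. \<forall>i. \<beta> i \<le> p"
    unfolding p l x using lead_exponents_bound by blast
  obtain h :: "rat poly" where h: "\<And>t. l * p \<le> t \<Longrightarrow> of_nat (HF t) = poly h (of_nat t)"
    "lead_coeff h > 0"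
    "degree h = Max ((\<lambda>\<beta>. card (full_at l p \<beta>)) ` {\<beta> \<in> normal. clip p \<beta> = \<beta>})"
    using staircase_hilbert_polynomial[OF bound zero_normal d(1)] unfolding HF_eq d(2) l by blast
  have unique: "g = h" if "\<forall>t\<ge>l * p. of_nat (HF t) = poly g (of_nat t)" for g
    by (rule rat_poly_unique[of "l * p"]) (use that h(1) in metis)
  have "GKdim scale M = ereal (real (degree h))"
    unfolding M
  proof (rule GKdim_eq)
    fix s q :: nat assume "0 < s"
    from log_nat_poly_affine_tendsto[of h "l * p" HF s q, OF h(2) h(1) this]
    show "(\<lambda>k. log_nat k (k_dim scale (quotient_module I) (coset ` below (Suc (s * k + q))))) \<longlonglongrightarrow> ereal (real (degree h))"
      unfolding HF_eq M .
  qed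
  moreover have "degree h = Max {card (top_at l x p u) | u.
      u \<in> Irr R l x ord G \<inter> monos_le l x t \<and> sh_at l x p u = u}" if "l * p \<le> t" for t
    using clipped_Irr_eq[of p t] that h(3) unfolding l x by simp
  ultimately show ?thesis
    using h(1) unique by blast
qed

end
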